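(* Let $(\mathfrak g,\langle\cdot,\cdot\rangle)$ be a $5$-dimensional metric Lie algebra with center $\mathfrak z$. If $(\mathfrak g,\langle\cdot,\cdot\rangle)$ admits a strict CKY tensor $T$ with associated vector $\xi\in\mathfrak z$, then $(\mathfrak g,\langle\cdot,\cdot\rangle)$ is isometrically isomorphic to one and only one of the metric Lie algebras in the following list. In each item the Lie algebra has basis $\{e_1,f_1,e_2,f_2,\xi\}$, which is orthogonal, with $\|\xi\|=1$; brackets of basis elements not listed (and not determined by skew-symmetry) are zero; $\xi$ is central. (1) $\mathbb R\times\mathfrak e(2)\oplus_\mu\mathbb R\xi$: $[e_1,e_2]=-f_2$, $[e_1,f_2]=e_2$, $[e_1,f_1]=2ta_1^{-1}\xi$, $[e_2,f_2]=2ta_2^{-1}\xi$; $\|e_i\|^2=\|f_i\|^2=t$; $a_1,a_2,t>0$; form $\omega=ta_1e^1\wedge f^1+ta_2e^2\wedge f^2$. (2) $\mathbb R^2\times\mathfrak{aff}(\mathbb R)\oplus_\mu\mathbb R\xi$: $[e_1,f_1]=2ta_1^{-1}\xi$, $[e_2,f_2]=f_2+2ta_2^{-1}\xi$; $\|e_i\|^2=\|f_i\|^2=t$; $a_1,a_2,t>0$; form $\omega=ta_1e^1\wedge f^1+ta_2e^2\wedge f^2$. (3) $\mathfrak r'_{4,\lambda,0}\oplus_\mu\mathbb R\xi$: $[e_1,f_1]=\lambda f_1+2ta_1^{-1}\xi$, $[e_1,f_2]=-e_2$, $[e_1,e_2]=f_2$, $[e_2,f_2]=2ta_2^{-1}\xi$;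 $\|e_i\|^2=\|f_i\|^2=t$; $\lambda,a_1,a_2,t>0$; form $\omega=ta_1e^1\wedge f^1+ta_2e^2\wedge f^2$. (4) $\mathfrak{aff}(\mathbb R)\times\mathfrak{aff}(\mathbb R)\oplus_\mu\mathbb R\xi$: $[e_1,f_1]=f_1+2ta_1^{-1}\xi$, $[e_2,f_2]=f_2+2tsa_2^{-1}\xi$; $\|e_1\|^2=\|f_1\|^2=t$, $\|e_2\|^2=\|f_2\|^2=ts$; $t,s>0$, $s\le 1$, with $a_1,a_2>0$ if $s<1$, or $a_1\ge a_2>0$ if $s=1$; form $\omega=ta_1e^1\wedge f^1+sta_2e^2\wedge f^2$. (5) $\mathfrak d_{4,\frac12}\oplus_\mu\mathbb R\xi$: $[e_1,f_1]=f_1+2tc^{-1}\xi$, $[e_1,e_2]=\frac12e_2$, $[e_1,f_2]=\frac12f_2$, $[e_2,f_2]=f_1+2tc^{-1}\xi$; $\|e_i\|^2=\|f_i\|^2=t$; $c,t>0$; form $\omega=tc(e^1\wedge f^1+e^2\wedge f^2)$. (6) $\mathfrak d_{4,2}\oplus_\mu\mathbb R\xi$: $[e_1,f_1]=-e_1+2tc^{-1}\xi$, $[e_1,e_2]=f_2$, $[f_1,e_2]=-\frac12e_2$, $[f_1,f_2]=\frac12f_2$, $[e_2,f_2]=2tc^{-1}\xi$; $\|e_i\|^2=\|f_i\|^2=t$; $c,t>0$; form $\omega=tc(e^1\wedge f^1+e^2\wedge f^2)$. (7) $\mathfrak d'_{4,\frac\delta2}\oplus_\mu\mathbb R\xi$: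 $[e_1,f_1]=f_1+2tc^{-1}\xi$, $[e_1,e_2]=\frac12e_2-\frac1\delta f_2$, $[e_1,f_2]=\frac1\delta e_2+\frac12f_2$, $[e_2,f_2]=f_1+2tc^{-1}\xi$; $\|e_i\|^2=\|f_i\|^2=t$; $\delta,t>0$, $c\neq0$; form $\omega=tc(e^1\wedge f^1+e^2\wedge f^2)$. (8) $\mathbb R^4\oplus_\mu\mathbb R\xi$: $[e_1,f_1]=2a_1^{-1}\xi$, $[e_2,f_2]=2a_2^{-1}\xi$; $\|e_i\|=\|f_i\|=1$; $a_1,a_2>0$; form $\omega=a_1e^1\wedge f^1+a_2e^2\wedge f^2$. Moreover, the CKY tensor $T$ is uniquely determined, up to scaling, by the corresponding metric Lie algebra, and its associated $2$-form is, up to scaling, the form $\omega$ given in the corresponding item.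
   Context: A metric Lie algebra $(\mathfrak g,\langle\cdot,\cdot\rangle)$ is a finite-dimensional real Lie algebra with an inner product. Its Levi-Civita connection is given by $2\langle\nabla_xy,z\rangle=\langle[x,y],z\rangle-\langle[y,z],x\rangle+\langle[z,x],y\rangle$, and for an endomorphism $T$, $(\nabla_xT)y=\nabla_x(Ty)-T(\nabla_xy)$. A CKY (conformal Killing-Yano) tensor is a skew-symmetric endomorphism $T$ of $\mathfrak g$ for which there is $\theta\in\mathfrak g^*$ with $$\langle(\nabla_xT)y,z\rangle+\langle(\nabla_yT)x,z\rangle=2\langle x,y\rangle\theta(z)-\langle y,z\rangle\theta(x)-\langle x,z\rangle\theta(y)\quad\text{for all }x,y,z\in\mathfrak g;$$ $\theta$ is then unique. $T$ is strict if $\theta\neq0$. The associated vector of $T$ is the $\xi\in\mathfrak g$ with $\theta=\langle\xi,\cdot\rangle$; after rescaling $T$ it may be taken to be a unit vector. The $2$-form associated to $T$ is $\omega(x,y)=\langle Tx,y\rangle$. An isometric isomorphism is a Lie algebra isomorphism preserving the inner products. In the list, $\{e^1,f^1,e^2,f^2\}$ together with a form dual to $\xi$ denotes the dual basis of $\{e_1,f_1,e_2,f_2,\xi\}$ (so $e^i(e_i)=1$, $f^i(f_i)=1$, and each vanishes on the other basis vectors). Names such as $\mathfrak d_{4,2}\oplus_\mu\mathbb R\xi$ are only labels for the Lie algebras given by the listed brackets. "Up to scaling" means up to multiplication of $T$ (or $\omega$) by a non-zero real number.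
   Formalization: "One and only one" is proved up to two coincidences in the list: in (7), c and −c give isometrically isomorphic algebras (ξ→−ξ); in (8), so do (a₁,a₂) and (a₂,a₁) (swap indices). Otherwise item and parameters are unique. *)

theory Defs
  imports "HOL-Analysis.Analysis"
begin

section \<open>Metric Lie algebras\<close>

text \<open>A Lie bracket and an inner product are carried as explicit functions on a real vector
  space, so that one space can carry several metric Lie algebra structures.\<close>

definition lie_bracket :: "('a::real_vector \<Rightarrow> 'a \<Rightarrow> 'a) \<Rightarrow> bool" where
  "lie_bracket br \<longleftrightarrow> bilinear br \<and> (\<forall>x. br x x = 0) \<and>
     (\<forall>x y z. br x (br y z) + br y (br z x) + br z (br x y) = 0)"

definition inner_product :: "('a::real_vector \<Rightarrow> 'a \<Rightarrow> real) \<Rightarrow> bool" where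
  "inner_product g \<longleftrightarrow> bilinear g \<and> (\<forall>x y. g x y = g y x) \<and> (\<forall>x. x \<noteq> 0 \<longrightarrow> g x x > 0)"

definition metric_lie_algebra ::
  "('a::real_vector \<Rightarrow> 'a \<Rightarrow> 'a) \<Rightarrow> ('a \<Rightarrow> 'a \<Rightarrow> real) \<Rightarrow> bool" where
  "metric_lie_algebra br g \<longleftrightarrow>
     (\<exists>B::'a set. finite B \<and> span B = UNIV) \<and> lie_bracket br \<and> inner_product g"

definition lie_center :: "('a::real_vector \<Rightarrow> 'a \<Rightarrow> 'a) \<Rightarrow> 'a set" where
  "lie_center br = {x. \<forall>y. br x y = 0}"

definition isometric_isomorphism ::
  "('a::real_vector \<Rightarrow> 'a \<Rightarrow> 'a) \<Rightarrow> ('a \<Rightarrow> 'a \<Rightarrow> real) \<Rightarrow>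
   ('b::real_vector \<Rightarrow> 'b \<Rightarrow> 'b) \<Rightarrow> ('b \<Rightarrow> 'b \<Rightarrow> real) \<Rightarrow> ('a \<Rightarrow> 'b) \<Rightarrow> bool" where
  "isometric_isomorphism br g br' g' \<phi> \<longleftrightarrow> linear \<phi> \<and> bij \<phi> \<and>
     (\<forall>x y. \<phi> (br x y) = br' (\<phi> x) (\<phi> y)) \<and> (\<forall>x y. g' (\<phi> x) (\<phi> y) = g x y)"

definition isometrically_isomorphic ::
  "('a::real_vector \<Rightarrow> 'a \<Rightarrow> 'a) \<Rightarrow> ('a \<Rightarrow> 'a \<Rightarrow> real) \<Rightarrow>
   ('b::real_vector \<Rightarrow> 'b \<Rightarrow> 'b) \<Rightarrow> ('b \<Rightarrow> 'b \<Rightarrow> real) \<Rightarrow> bool" where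
  "isometrically_isomorphic br g br' g' \<longleftrightarrow> (\<exists>\<phi>. isometric_isomorphism br g br' g' \<phi>)"


section \<open>Conformal Killing-Yano tensors\<close>

text \<open>The vector below exists and is unique because an inner product on a finite-dimensional
  space is nondegenerate.\<close>

definition levi_civita ::
  "('a::real_vector \<Rightarrow> 'a \<Rightarrow> 'a) \<Rightarrow> ('a \<Rightarrow> 'a \<Rightarrow> real) \<Rightarrow> 'a \<Rightarrow> 'a \<Rightarrow> 'a" where
  "levi_civita br g x y =
     (THE v. \<forall>z. 2 * g v z = g (br x y) z - g (br y z) x + g (br z x) y)"

definition cov_deriv ::
  "('a::real_vector \<Rightarrow> 'a \<Rightarrow> 'a) \<Rightarrow> ('a \<Rightarrow> 'a \<Rightarrow> real) \<Rightarrow> 'a \<Rightarrow> ('a \<Rightarrow> 'a) \<Rightarrow> 'a \<Rightarrow> 'a" where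
  "cov_deriv br g x T y = levi_civita br g x (T y) - T (levi_civita br g x y)"

definition skew_endomorphism :: "('a::real_vector \<Rightarrow> 'a \<Rightarrow> real) \<Rightarrow> ('a \<Rightarrow> 'a) \<Rightarrow> bool" where
  "skew_endomorphism g T \<longleftrightarrow> linear T \<and> (\<forall>x y. g (T x) y = - g x (T y))"

definition cky_one_form ::
  "('a::real_vector \<Rightarrow> 'a \<Rightarrow> 'a) \<Rightarrow> ('a \<Rightarrow> 'a \<Rightarrow> real) \<Rightarrow> ('a \<Rightarrow> 'a) \<Rightarrow> ('a \<Rightarrow> real) \<Rightarrow> bool" where
  "cky_one_form br g T \<theta> \<longleftrightarrow> linear \<theta> \<and>
     (\<forall>x y z. g (cov_deriv br g x T y) z + g (cov_deriv br g y T x) z =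
        2 * g x y * \<theta> z - g y z * \<theta> x - g x z * \<theta> y)"

definition cky_tensor ::
  "('a::real_vector \<Rightarrow> 'a \<Rightarrow> 'a) \<Rightarrow> ('a \<Rightarrow> 'a \<Rightarrow> real) \<Rightarrow> ('a \<Rightarrow> 'a) \<Rightarrow> bool" where
  "cky_tensor br g T \<longleftrightarrow> skew_endomorphism g T \<and> (\<exists>\<theta>. cky_one_form br g T \<theta>)"

text \<open>In dimension at least two the 1-form of a CKY tensor is unique, so the existential
  quantifiers in the next two definitions speak about the same 1-form.\<close>

definition strict_cky_tensor ::
  "('a::real_vector \<Rightarrow> 'a \<Rightarrow> 'a) \<Rightarrow> ('a \<Rightarrow> 'a \<Rightarrow> real) \<Rightarrow> ('a \<Rightarrow> 'a) \<Rightarrow> bool" where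
  "strict_cky_tensor br g T \<longleftrightarrow>
     cky_tensor br g T \<and> (\<exists>\<theta>. cky_one_form br g T \<theta> \<and> \<theta> \<noteq> (\<lambda>_. 0))"

definition associated_vector ::
  "('a::real_vector \<Rightarrow> 'a \<Rightarrow> 'a) \<Rightarrow> ('a \<Rightarrow> 'a \<Rightarrow> real) \<Rightarrow> ('a \<Rightarrow> 'a) \<Rightarrow> 'a \<Rightarrow> bool" where
  "associated_vector br g T \<xi> \<longleftrightarrow> (\<exists>\<theta>. cky_one_form br g T \<theta> \<and> (\<forall>x. \<theta> x = g \<xi> x))"

definition two_form ::
  "('a::real_vector \<Rightarrow> 'a \<Rightarrow> real) \<Rightarrow> ('a \<Rightarrow> 'a) \<Rightarrow> 'a \<Rightarrow> 'a \<Rightarrow> real" where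
  "two_form g T x y = g (T x) y"


section \<open>The list\<close>

datatype frame = E1 | F1 | E2 | F2 | Xi

lemma UNIV_frame: "(UNIV :: frame set) = {E1, F1, E2, F2, Xi}"
  using frame.exhaust by auto

instance frame :: finite
  by standard (simp add: UNIV_frame)

text \<open>All listed metric Lie algebras live on \<^typ>\<open>real ^ frame\<close>. The basis
  $e_1,f_1,e_2,f_2,\xi$ is the standard basis and the dual basis consists of the coordinates
  \<open>\<lambda>x. x $ E1\<close> etc.\<close>

abbreviation "e1 \<equiv> (axis E1 1 :: real ^ frame)"
abbreviation "f1 \<equiv> (axis F1 1 :: real ^ frame)"
abbreviation "e2 \<equiv> (axis E2 1 :: real ^ frame)"
abbreviation "f2 \<equiv> (axis F2 1 :: real ^ frame)"
abbreviation "xi \<equiv> (axis Xi 1 :: real ^ frame)"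

datatype listed =
    R_e2 real real real                  \<comment> \<open>$a_1, a_2, t$\<close>
  | R2_aff real real real                \<comment> \<open>$a_1, a_2, t$\<close>
  | r4' real real real real              \<comment> \<open>$\lambda, a_1, a_2, t$\<close>
  | aff_aff real real real real          \<comment> \<open>$a_1, a_2, s, t$\<close>
  | d4_half real real                    \<comment> \<open>$c, t$\<close>
  | d4_two real real                     \<comment> \<open>$c, t$\<close>
  | d4' real real real                   \<comment> \<open>$\delta, c, t$\<close>
  | R4 real real                         \<comment> \<open>$a_1, a_2$\<close>

fun admissible :: "listed \<Rightarrow> bool" where
  "admissible (R_e2 a1 a2 t) \<longleftrightarrow> a1 > 0 \<and> a2 > 0 \<and> t > 0"
| "admissible (R2_aff a1 a2 t) \<longleftrightarrow> a1 > 0 \<and> a2 > 0 \<and> t > 0"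
| "admissible (r4' lam a1 a2 t) \<longleftrightarrow> lam > 0 \<and> a1 > 0 \<and> a2 > 0 \<and> t > 0"
| "admissible (aff_aff a1 a2 s t) \<longleftrightarrow> t > 0 \<and> s > 0 \<and>
     (s < 1 \<and> a1 > 0 \<and> a2 > 0 \<or> s = 1 \<and> a1 \<ge> a2 \<and> a2 > 0)"
| "admissible (d4_half c t) \<longleftrightarrow> c > 0 \<and> t > 0"
| "admissible (d4_two c t) \<longleftrightarrow> c > 0 \<and> t > 0"
| "admissible (d4' \<delta> c t) \<longleftrightarrow> \<delta> > 0 \<and> t > 0 \<and> c \<noteq> 0"
| "admissible (R4 a1 a2) \<longleftrightarrow> a1 > 0 \<and> a2 > 0"

text \<open>An entry \<open>((i, j), v)\<close> records that the bracket of the basis vectors with labels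
  \<open>i\<close> and \<open>j\<close> is \<open>v\<close>; every unordered pair of labels occurs at most once.\<close>

fun bracket_table :: "listed \<Rightarrow> ((frame \<times> frame) \<times> (real ^ frame)) list" where
  "bracket_table (R_e2 a1 a2 t) =
     [((E1, E2), - f2), ((E1, F2), e2),
      ((E1, F1), (2 * t / a1) *\<^sub>R xi), ((E2, F2), (2 * t / a2) *\<^sub>R xi)]"
| "bracket_table (R2_aff a1 a2 t) =
     [((E1, F1), (2 * t / a1) *\<^sub>R xi), ((E2, F2), f2 + (2 * t / a2) *\<^sub>R xi)]"
| "bracket_table (r4' lam a1 a2 t) =
     [((E1, F1), lam *\<^sub>R f1 + (2 * t / a1) *\<^sub>R xi), ((E1, F2), - e2), ((E1, E2), f2),
      ((E2, F2), (2 * t / a2) *\<^sub>R xi)]"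
| "bracket_table (aff_aff a1 a2 s t) =
     [((E1, F1), f1 + (2 * t / a1) *\<^sub>R xi), ((E2, F2), f2 + (2 * t * s / a2) *\<^sub>R xi)]"
| "bracket_table (d4_half c t) =
     [((E1, F1), f1 + (2 * t / c) *\<^sub>R xi), ((E1, E2), (1 / 2) *\<^sub>R e2),
      ((E1, F2), (1 / 2) *\<^sub>R f2), ((E2, F2), f1 + (2 * t / c) *\<^sub>R xi)]"
| "bracket_table (d4_two c t) =
     [((E1, F1), - e1 + (2 * t / c) *\<^sub>R xi), ((E1, E2), f2),
      ((F1, E2), - (1 / 2) *\<^sub>R e2), ((F1, F2), (1 / 2) *\<^sub>R f2),
      ((E2, F2), (2 * t / c) *\<^sub>R xi)]"
| "bracket_table (d4' \<delta> c t) =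
     [((E1, F1), f1 + (2 * t / c) *\<^sub>R xi),
      ((E1, E2), (1 / 2) *\<^sub>R e2 - (1 / \<delta>) *\<^sub>R f2),
      ((E1, F2), (1 / \<delta>) *\<^sub>R e2 + (1 / 2) *\<^sub>R f2),
      ((E2, F2), f1 + (2 * t / c) *\<^sub>R xi)]"
| "bracket_table (R4 a1 a2) =
     [((E1, F1), (2 / a1) *\<^sub>R xi), ((E2, F2), (2 / a2) *\<^sub>R xi)]"

definition list_bracket :: "listed \<Rightarrow> real ^ frame \<Rightarrow> real ^ frame \<Rightarrow> real ^ frame" where
  "list_bracket m x y = (\<Sum>((i, j), v) \<leftarrow> bracket_table m. (x $ i * y $ j - x $ j * y $ i) *\<^sub>R v)"

text \<open>Squared norms of $e_1,f_1$ (first component) and of $e_2,f_2$ (second component).\<close>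

fun norms_sq :: "listed \<Rightarrow> real \<times> real" where
  "norms_sq (R_e2 a1 a2 t) = (t, t)"
| "norms_sq (R2_aff a1 a2 t) = (t, t)"
| "norms_sq (r4' lam a1 a2 t) = (t, t)"
| "norms_sq (aff_aff a1 a2 s t) = (t, t * s)"
| "norms_sq (d4_half c t) = (t, t)"
| "norms_sq (d4_two c t) = (t, t)"
| "norms_sq (d4' \<delta> c t) = (t, t)"
| "norms_sq (R4 a1 a2) = (1, 1)"

definition list_metric :: "listed \<Rightarrow> real ^ frame \<Rightarrow> real ^ frame \<Rightarrow> real" where
  "list_metric m x y =
     fst (norms_sq m) * (x $ E1 * y $ E1 + x $ F1 * y $ F1) +
     snd (norms_sq m) * (x $ E2 * y $ E2 + x $ F2 * y $ F2) + x $ Xi * y $ Xi"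

text \<open>The coefficients of $e^1\wedge f^1$ and $e^2\wedge f^2$ in $\omega$.\<close>

fun form_coeffs :: "listed \<Rightarrow> real \<times> real" where
  "form_coeffs (R_e2 a1 a2 t) = (t * a1, t * a2)"
| "form_coeffs (R2_aff a1 a2 t) = (t * a1, t * a2)"
| "form_coeffs (r4' lam a1 a2 t) = (t * a1, t * a2)"
| "form_coeffs (aff_aff a1 a2 s t) = (t * a1, s * t * a2)"
| "form_coeffs (d4_half c t) = (t * c, t * c)"
| "form_coeffs (d4_two c t) = (t * c, t * c)"
| "form_coeffs (d4' \<delta> c t) = (t * c, t * c)"
| "form_coeffs (R4 a1 a2) = (a1, a2)"

definition list_form :: "listed \<Rightarrow> real ^ frame \<Rightarrow> real ^ frame \<Rightarrow> real" where
  "list_form m x y =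
     fst (form_coeffs m) * (x $ E1 * y $ F1 - x $ F1 * y $ E1) +
     snd (form_coeffs m) * (x $ E2 * y $ F2 - x $ F2 * y $ E2)"

text \<open>Two parameter values are regarded as naming the same member of the list if they are equal,
  except for the two redundancies of the parametrisation: in the family \<open>d4'\<close> the parameters
  \<open>c\<close> and \<open>- c\<close> give isometrically isomorphic algebras (replace $\xi$ by $-\xi$), and so do
  \<open>(a\<^sub>1, a\<^sub>2)\<close> and \<open>(a\<^sub>2, a\<^sub>1)\<close> in the family \<open>R4\<close> (exchange the indices 1 and 2).
  Members of different families are never identified.\<close>

fun same_entry :: "listed \<Rightarrow> listed \<Rightarrow> bool" where
  "same_entry (d4' \<delta> c t) (d4' \<delta>' c' t') \<longleftrightarrow> \<delta> = \<delta>' \<and> t = t' \<and> (c = c' \<or> c = - c')"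
| "same_entry (R4 a1 a2) (R4 b1 b2) \<longleftrightarrow> a1 = b1 \<and> a2 = b2 \<or> a1 = b2 \<and> a2 = b1"
| "same_entry m m' \<longleftrightarrow> m = m'"

lemma metric_lie_algebra_list:
  assumes "admissible m"
  shows "metric_lie_algebra (list_bracket m) (list_metric m)"
proof -
  have all_frame: "(\<forall>i. P i) \<longleftrightarrow> P E1 \<and> P F1 \<and> P E2 \<and> P F2 \<and> P Xi" for P
    by (metis frame.exhaust)
  have fin: "\<exists>B::(real ^ frame) set. finite B \<and> span B = UNIV"
    using finite_Basis span_Basis by blast
  have add: "list_bracket m (x + x') y = list_bracket m x y + list_bracket m x' y"
    and scale: "list_bracket m (r *\<^sub>R x) y = r *\<^sub>R list_bracket m x y"
    and skew: "list_bracket m y x = - list_bracket m x y" for x x' y r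
  proof -
    define L where "L = bracket_table m"
    show "list_bracket m (x + x') y = list_bracket m x y + list_bracket m x' y"
      unfolding list_bracket_def L_def[symmetric] by (induction L) (auto simp: algebra_simps)
    show "list_bracket m (r *\<^sub>R x) y = r *\<^sub>R list_bracket m x y"
      unfolding list_bracket_def L_def[symmetric] by (induction L) (auto simp: algebra_simps)
    show "list_bracket m y x = - list_bracket m x y"
      unfolding list_bracket_def L_def[symmetric] by (induction L) (auto simp: algebra_simps)
  qed
  have bil: "bilinear (list_bracket m)"
    unfolding bilinear_def
  proof (intro conjI allI linearI)
    show "list_bracket m x (y + z) = list_bracket m x y + list_bracket m x z" for x y z
      using add[of y z x] skew by (metis minus_add_distrib)
    show "list_bracket m x (r *\<^sub>R y) = r *\<^sub>R list_bracket m x y" for x y r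
      using scale[of r y x] skew by (metis scaleR_minus_right)
  qed (simp_all add: add scale)
  have jac: "list_bracket m x (list_bracket m y z) + list_bracket m y (list_bracket m z x)
      + list_bracket m z (list_bracket m x y) = 0" for x y z
    by (cases m)
      (simp_all add: list_bracket_def vec_eq_iff all_frame axis_def algebra_simps
        add_divide_distrib diff_divide_distrib)
  have alt: "list_bracket m x x = 0" for x
    by (cases m) (simp_all add: list_bracket_def)
  have inn: "bilinear (list_metric m)"
    by (auto simp: bilinear_def list_metric_def algebra_simps intro!: linearI)
  have sym: "list_metric m x y = list_metric m y x" for x y
    by (simp add: list_metric_def algebra_simps)
  have pos: "list_metric m x x > 0" if "x \<noteq> 0" for x
  proof -
    define p q where "p = fst (norms_sq m)" and "q = snd (norms_sq m)"
    have p: "p > 0" and q: "q > 0"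
      using assms by (cases m; auto simp: p_def q_def)+
    have eq: "list_metric m x x =
        p * ((x $ E1)\<^sup>2 + (x $ F1)\<^sup>2) + q * ((x $ E2)\<^sup>2 + (x $ F2)\<^sup>2) + (x $ Xi)\<^sup>2"
      by (simp add: list_metric_def p_def q_def power2_eq_square)
    have "x $ E1 \<noteq> 0 \<or> x $ F1 \<noteq> 0 \<or> x $ E2 \<noteq> 0 \<or> x $ F2 \<noteq> 0 \<or> x $ Xi \<noteq> 0"
      using that by (auto simp: vec_eq_iff all_frame)
    then have "(x $ E1)\<^sup>2 + (x $ F1)\<^sup>2 > 0 \<or> (x $ E2)\<^sup>2 + (x $ F2)\<^sup>2 > 0 \<or> (x $ Xi)\<^sup>2 > 0"
      by (auto simp: sum_power2_gt_zero_iff)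
    moreover have "(x $ E1)\<^sup>2 + (x $ F1)\<^sup>2 \<ge> 0" "(x $ E2)\<^sup>2 + (x $ F2)\<^sup>2 \<ge> 0" "(x $ Xi)\<^sup>2 \<ge> 0"
      by simp_all
    ultimately show ?thesis
      unfolding eq using p q
      by (smt (verit) mult_nonneg_nonneg mult_pos_pos)
  qed
  show ?thesis
    using fin bil jac alt inn sym pos
    by (simp add: metric_lie_algebra_def lie_bracket_def inner_product_def)
qed

end

theory Submission
  imports Defs
begin

text \<open>
  Write $\mu(x,y)=\langle[x,y],\xi\rangle$. Since $\xi$ is central, the CKY equation evaluated at $\xi$ gives
  $T\xi=0$ and $\mu(y,Tz)=2\langle y,z\rangle$ on $\mathfrak h=\xi^\perp$ (for $\|\xi\|=1$). Hence $\mu$ is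
  nondegenerate on $\mathfrak h$, the center is $\mathbb R\xi$, and $T$ is determined by $\mu$ up to scaling.
  On $\mathfrak h\cong\mathfrak g/\mathbb R\xi$ the 3-tensor $\langle(\nabla_xT)y,z\rangle$ is totally skew; in an
  orthonormal basis adapted to $T$ it vanishes, so $T$ is parallel on the 4-dimensional $\mathfrak h$.
  If $T$ has two eigenplanes, $\mathfrak h$ splits; otherwise $T=cJ$ and $\mathfrak h$ is Kaehler. In the
  latter case there is a unit $e\perp[\mathfrak h,\mathfrak h]$, and the Jacobi identity becomes a small polynomial
  system in a unitary basis through $e$. The entries of the list are told apart by metric traces of
  the trace form, the Killing form and $\mu$.
\<close>


text \<open>When the two eigenvalues of T^2 on the complement of xi coincide, every complex line
  there is T-invariant and T no longer selects a basis. A unit vector e orthogonal to all brackets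
  breaks this symmetry: it removes six of the 24 structure constants modulo xi, and the Kaehler
  condition removes eight more. The rotation of the plane orthogonal to e and Je is still free and
  is spent before the Jacobi identity is solved.

  The models use orthonormal bases and parameters of either sign. The scale t of an entry appears
  only afterwards, when the vectors of a plane are divided by a structure constant; t is the inverse
  square of that constant.

  An isomorphism between two entries preserves the center, so it sends xi to xi or -xi. Invariants
  that are even in mu are therefore available without any further knowledge of the isomorphism, and
  for the same reason they cannot see the sign of c in \<open>d4'\<close>.\<close>

lemma all_frame: "(\<forall>i. P i) \<longleftrightarrow> P E1 \<and> P F1 \<and> P E2 \<and> P F2 \<and> P Xi"
  by (metis frame.exhaust)

lemma sum_frame:
  fixes f :: "frame \<Rightarrow> 'b::comm_monoid_add"
  shows "(\<Sum>i\<in>UNIV. f i) = f E1 + f F1 + f E2 + f F2 + f Xi"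
  by (simp add: UNIV_frame add.assoc)

section \<open>Metric Lie algebras of dimension five\<close>

locale metric_lie5 =
  fixes br :: "'a::real_vector \<Rightarrow> 'a \<Rightarrow> 'a" and g :: "'a \<Rightarrow> 'a \<Rightarrow> real"
  assumes metric_lie_algebra: "metric_lie_algebra br g"
    and dim5: "dim (UNIV :: 'a set) = 5"
begin

lemma bilinear_br: "bilinear br" and br_self [simp]: "br x x = 0"
  and jacobi: "br x (br y z) + br y (br z x) + br z (br x y) = 0"
  and bilinear_g: "bilinear g" and g_sym: "g x y = g y x"
  and g_pos: "x \<noteq> 0 \<Longrightarrow> g x x > 0"
  using metric_lie_algebra
  by (auto simp: metric_lie_algebra_def lie_bracket_def inner_product_def)

lemmas br_lin = bilinear_ladd[OF bilinear_br] bilinear_radd[OF bilinear_br]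
  bilinear_lsub[OF bilinear_br] bilinear_rsub[OF bilinear_br]
  bilinear_lneg[OF bilinear_br] bilinear_rneg[OF bilinear_br]
  bilinear_lmul[OF bilinear_br] bilinear_rmul[OF bilinear_br]
  bilinear_lzero[OF bilinear_br] bilinear_rzero[OF bilinear_br]

lemmas g_lin = bilinear_ladd[OF bilinear_g] bilinear_radd[OF bilinear_g]
  bilinear_lsub[OF bilinear_g] bilinear_rsub[OF bilinear_g]
  bilinear_lneg[OF bilinear_g] bilinear_rneg[OF bilinear_g]
  bilinear_lmul[OF bilinear_g, unfolded real_scaleR_def]
  bilinear_rmul[OF bilinear_g, unfolded real_scaleR_def]
  bilinear_lzero[OF bilinear_g] bilinear_rzero[OF bilinear_g]

lemma linear_g_right: "linear (g x)" and linear_g_left: "linear (\<lambda>x. g x y)"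
  and linear_br_right: "linear (br x)" and linear_br_left: "linear (\<lambda>x. br x y)"
  using bilinear_g bilinear_br by (auto simp: bilinear_def)

lemma br_skew: "br y x = - br x y"
proof -
  have "br x y + br y x = br (x + y) (x + y)"
    by (simp only: br_lin) simp
  then have "br x y + br y x = 0" by (simp only: br_self)
  then show ?thesis by (simp add: eq_neg_iff_add_eq_0 add.commute)
qed

lemma g_self_eq_0 [simp]: "g x x = 0 \<longleftrightarrow> x = 0"
  using g_pos[of x] g_lin(9)[of x] by (metis less_irrefl)

lemma g_nonneg: "g x x \<ge> 0"
  using g_pos[of x] by (cases "x = 0") (auto simp: g_lin)

lemma eq_by_g: "x = y" if "\<And>z. g x z = g y z"
proof -
  have "g (x - y) (x - y) = 0" using that[of "x - y"] by (simp add: g_lin)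
  then show ?thesis by simp
qed

lemma independent_orthogonal:
  assumes "finite F" "\<And>v w. v \<in> F \<Longrightarrow> w \<in> F \<Longrightarrow> v \<noteq> w \<Longrightarrow> g v w = 0" "0 \<notin> F"
  shows "independent F"
proof
  assume "dependent F"
  then obtain u v where v: "v \<in> F" "u v \<noteq> 0" and s: "(\<Sum>w\<in>F. u w *\<^sub>R w) = 0"
    using dependent_finite[OF \<open>finite F\<close>] by blast
  have "0 = g (\<Sum>w\<in>F. u w *\<^sub>R w) v" using s by (simp add: g_lin)
  also have "\<dots> = (\<Sum>w\<in>F. u w * g w v)"
    by (simp add: linear_sum[OF linear_g_left] g_lin)
  also have "\<dots> = (\<Sum>w\<in>F. if w = v then u v * g v v else 0)"
    using assms(2) v by (intro sum.cong) auto
  also have "\<dots> = u v * g v v" using v \<open>finite F\<close> by simp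
  finally show False using v assms(3) by auto
qed

lemma independent_card_le_5:
  fixes F :: "'a set"
  assumes "independent F" shows "finite F \<and> card F \<le> 5"
proof -
  obtain B :: "'a set" where B: "B \<subseteq> UNIV" "independent B" "UNIV \<subseteq> span B"
      "card B = dim (UNIV :: 'a set)"
    by (rule real_vector.basis_exists)
  then have "finite B" using dim5 by (intro card_ge_0_finite) simp
  then show ?thesis using independent_span_bound[OF _ assms, of B] B dim5 by auto
qed

text \<open>One Gram-Schmidt step: fewer than five vectors do not span, and a vector outside their
  span is freed of its projections and normalised.\<close>

lemma ex_unit_orthogonal:
  assumes "finite F" "card F < 5"
    and on: "\<And>v w. v \<in> F \<Longrightarrow> w \<in> F \<Longrightarrow> g v w = (if v = w then 1 else 0)"
  shows "\<exists>u. g u u = 1 \<and> (\<forall>v\<in>F. g u v = 0)"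
proof -
  have "span F \<noteq> UNIV"
    using real_vector.dim_le_card[of UNIV F] assms(1,2) dim5 by auto
  then obtain x where x: "x \<notin> span F" by blast
  define w where "w = x - (\<Sum>v\<in>F. g x v *\<^sub>R v)"
  have orth: "g w v = 0" if "v \<in> F" for v
  proof -
    have "g (\<Sum>v\<in>F. g x v *\<^sub>R v) v = (\<Sum>u\<in>F. g x u * g u v)"
      by (simp add: linear_sum[OF linear_g_left] g_lin)
    also have "\<dots> = (\<Sum>u\<in>F. if u = v then g x v else 0)"
      using on that by (intro sum.cong) auto
    also have "\<dots> = g x v" using that \<open>finite F\<close> by simp
    finally show ?thesis by (simp add: w_def g_lin)
  qed
  have "(\<Sum>v\<in>F. g x v *\<^sub>R v) \<in> span F"
    by (intro span_sum span_scale span_base)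
  then have "w \<noteq> 0" using x by (auto simp: w_def)
  then have p: "g w w > 0" by (rule g_pos)
  define u where "u = (1 / sqrt (g w w)) *\<^sub>R w"
  have "g u u = 1" using p by (simp add: u_def g_lin del: g_self_eq_0)
  moreover have "g u v = 0" if "v \<in> F" for v using orth[OF that] by (simp add: u_def g_lin)
  ultimately show ?thesis by blast
qed

definition onb :: "(frame \<Rightarrow> 'a) \<Rightarrow> bool" where
  "onb b \<longleftrightarrow> (\<forall>i j. g (b i) (b j) = (if i = j then 1 else 0))"

text \<open>A non-zero remainder after subtracting the projections would be a sixth vector in an
  orthogonal, hence independent, family.\<close>

lemma onb_expand:
  assumes "onb b" shows "x = (\<Sum>i\<in>UNIV. g x (b i) *\<^sub>R b i)"
proof (rule ccontr)
  define w where "w = x - (\<Sum>i\<in>UNIV. g x (b i) *\<^sub>R b i)"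
  assume "\<not> ?thesis"
  then have w0: "w \<noteq> 0" by (simp add: w_def)
  have b: "g (b i) (b j) = (if i = j then 1 else 0)" for i j
    using assms by (simp add: onb_def)
  have orth: "g w (b i) = 0" for i
    by (simp add: w_def g_lin linear_sum[OF linear_g_left] b if_distrib cong: if_cong)
  have inj: "inj b" using b by (metis injI zero_neq_one)
  have wn: "w \<notin> range b" using orth w0 by (metis g_self_eq_0 imageE)
  have "independent (insert w (range b))"
  proof (rule independent_orthogonal)
    show "0 \<notin> insert w (range b)" using w0 b by (metis g_self_eq_0 imageE insertE zero_neq_one)
  next
    fix u v assume "u \<in> insert w (range b)" "v \<in> insert w (range b)" "u \<noteq> v"
    then show "g u v = 0" using orth b g_sym by (auto split: if_splits)
  qed simp
  then have "card (insert w (range b)) \<le> 5" using independent_card_le_5 by blast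
  moreover have "card (range b) = 5"
    using inj by (simp add: card_image UNIV_frame)
  ultimately show False using wn by simp
qed

text \<open>The family indexed by \<open>frame\<close> serves sums and traces; five named vectors
  serve the bracket computations.\<close>

definition onb5 :: "'a \<Rightarrow> 'a \<Rightarrow> 'a \<Rightarrow> 'a \<Rightarrow> 'a \<Rightarrow> bool" where
  "onb5 e f e' f' \<xi> \<longleftrightarrow> onb (case_frame e f e' f' \<xi>)"

lemma onb5_iff:
  "onb5 e f e' f' \<xi> \<longleftrightarrow>
    g e e = 1 \<and> g f f = 1 \<and> g e' e' = 1 \<and> g f' f' = 1 \<and> g \<xi> \<xi> = 1 \<and>
    g e f = 0 \<and> g e e' = 0 \<and> g e f' = 0 \<and> g e \<xi> = 0 \<and> g f e' = 0 \<and> g f f' = 0 \<and> g f \<xi> = 0 \<and>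
    g e' f' = 0 \<and> g e' \<xi> = 0 \<and> g f' \<xi> = 0"
  using g_sym by (auto simp: onb5_def onb_def all_frame)

lemma onb5_D:
  assumes "onb5 e f e' f' \<xi>"
  shows "g e e = 1" "g f f = 1" "g e' e' = 1" "g f' f' = 1" "g \<xi> \<xi> = 1"
    "g e f = 0" "g e e' = 0" "g e f' = 0" "g e \<xi> = 0" "g f e' = 0" "g f f' = 0" "g f \<xi> = 0"
    "g e' f' = 0" "g e' \<xi> = 0" "g f' \<xi> = 0"
    "g f e = 0" "g e' e = 0" "g f' e = 0" "g \<xi> e = 0" "g e' f = 0" "g f' f = 0" "g \<xi> f = 0"
    "g f' e' = 0" "g \<xi> e' = 0" "g \<xi> f' = 0"
  using assms g_sym by (auto simp: onb5_iff)

lemma onb5_expand: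
  assumes "onb5 e f e' f' \<xi>"
  shows "x = g x e *\<^sub>R e + g x f *\<^sub>R f + g x e' *\<^sub>R e' + g x f' *\<^sub>R f' + g x \<xi> *\<^sub>R \<xi>"
  using onb_expand[OF assms[unfolded onb5_def], of x] by (simp add: sum_frame)

end

context metric_lie5
begin

lemma onb5_extend3:
  assumes "g \<xi> \<xi> = 1" "g e e = 1" "g e \<xi> = 0" "g f f = 1" "g f \<xi> = 0" "g f e = 0"
  shows "\<exists>e' f'. onb5 e f e' f' \<xi>"
proof -
  have sym: "g \<xi> e = 0" "g \<xi> f = 0" "g e f = 0" using assms g_sym by metis+
  have "\<exists>u. g u u = 1 \<and> (\<forall>v\<in>{\<xi>, e, f}. g u v = 0)"
    by (rule ex_unit_orthogonal) (use assms sym in \<open>auto simp: card_insert_if\<close>)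
  then obtain e' where e': "g e' e' = 1" "g e' \<xi> = 0" "g e' e = 0" "g e' f = 0" by auto
  then have sym': "g \<xi> e' = 0" "g e e' = 0" "g f e' = 0" using g_sym by metis+
  have "\<exists>u. g u u = 1 \<and> (\<forall>v\<in>{\<xi>, e, f, e'}. g u v = 0)"
    by (rule ex_unit_orthogonal) (use assms sym e' sym' in \<open>auto simp: card_insert_if\<close>)
  then obtain f' where "g f' f' = 1" "g f' \<xi> = 0" "g f' e = 0" "g f' f = 0" "g f' e' = 0" by auto
  then show ?thesis using assms e' g_sym unfolding onb5_iff by metis
qed

lemma onb5_extend:
  assumes "g \<xi> \<xi> = 1"
  shows "\<exists>e f e' f'. onb5 e f e' f' \<xi>"
proof -
  obtain e where e: "g e e = 1" "g e \<xi> = 0"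
    using ex_unit_orthogonal[of "{\<xi>}"] assms by auto
  then have "g \<xi> e = 0" using g_sym by metis
  then have "\<exists>u. g u u = 1 \<and> (\<forall>v\<in>{\<xi>, e}. g u v = 0)"
    by (intro ex_unit_orthogonal) (use assms e in \<open>auto simp: card_insert_if\<close>)
  then obtain f where f: "g f f = 1" "g f \<xi> = 0" "g f e = 0" by auto
  show ?thesis using onb5_extend3[OF assms e(1,2) f] by blast
qed

lemma ex_onb: "\<exists>b. onb b"
proof -
  obtain u where "g u u = 1" using ex_unit_orthogonal[of "{}"] by auto
  then show ?thesis using onb5_extend onb5_def by blast
qed

section \<open>The Koszul form and the CKY equation expressed by it\<close>

lemma riesz:
  assumes "linear \<theta>" shows "\<exists>v. \<forall>z. g v z = \<theta> z"
proof -
  obtain b where b: "onb b" using ex_onb by blast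
  have "g (\<Sum>i\<in>UNIV. \<theta> (b i) *\<^sub>R b i) z = \<theta> z" for z
  proof -
    have "\<theta> z = \<theta> (\<Sum>i\<in>UNIV. g z (b i) *\<^sub>R b i)" using onb_expand[OF b, of z] by simp
    also have "\<dots> = (\<Sum>i\<in>UNIV. g z (b i) * \<theta> (b i))"
      by (simp add: linear_sum[OF assms] linear_scale[OF assms])
    finally show ?thesis
      by (simp add: linear_sum[OF linear_g_left] g_lin g_sym[of z] mult.commute)
  qed
  then show ?thesis by blast
qed

text \<open>Twice the Levi-Civita connection, as a trilinear form.\<close>

definition koszul :: "'a \<Rightarrow> 'a \<Rightarrow> 'a \<Rightarrow> real" where
  "koszul x y z = g (br x y) z - g (br y z) x + g (br z x) y"

lemma levi_civita: "2 * g (levi_civita br g x y) z = koszul x y z"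
proof -
  have "linear (\<lambda>z. koszul x y z / 2)"
    by (auto simp: koszul_def g_lin br_lin field_simps intro!: linearI)
  then obtain v where v': "\<And>z. g v z = koszul x y z / 2" using riesz by blast
  have v: "2 * g v z = koszul x y z" for z using v'[of z] by linarith
  have "\<forall>z. 2 * g (levi_civita br g x y) z = g (br x y) z - g (br y z) x + g (br z x) y"
    unfolding levi_civita_def
  proof (rule theI)
    show "\<forall>z. 2 * g v z = g (br x y) z - g (br y z) x + g (br z x) y"
      by (simp add: v koszul_def)
  next
    fix w assume w: "\<forall>z. 2 * g w z = g (br x y) z - g (br y z) x + g (br z x) y"
    then show "w = v" proof (intro eq_by_g)
      fix z
      show "g w z = g v z" using spec[OF w, of z] v[of z] unfolding koszul_def by linarith
    qed
  qed
  then show ?thesis by (simp add: koszul_def)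
qed

lemma koszul_skew: "koszul x z y = - koszul x y z"
  using br_skew[of x y] br_skew[of y z] br_skew[of z x] by (simp add: koszul_def g_lin)

lemma koszul_lin:
  "koszul (x + x') y z = koszul x y z + koszul x' y z"
  "koszul x (y + y') z = koszul x y z + koszul x y' z"
  "koszul x y (z + z') = koszul x y z + koszul x y z'"
  "koszul (r *\<^sub>R x) y z = r * koszul x y z"
  "koszul x (r *\<^sub>R y) z = r * koszul x y z"
  "koszul x y (r *\<^sub>R z) = r * koszul x y z"
  by (simp_all add: koszul_def g_lin br_lin algebra_simps)

lemma koszul_self [simp]: "koszul x y y = 0"
  using koszul_skew[of x y y] by simp

text \<open>As T is skew, twice <(nabla_x T)y, z> equals
  \<open>koszul x (T y) z + koszul x y (T z)\<close>. From here on the connection enters only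
  through \<open>koszul\<close>.\<close>

lemma cky_koszul:
  assumes T: "skew_endomorphism g T" and \<theta>: "cky_one_form br g T \<theta>"
  shows "koszul x (T y) z + koszul x y (T z) + koszul y (T x) z + koszul y x (T z)
    = 2 * (2 * g x y * \<theta> z - g y z * \<theta> x - g x z * \<theta> y)"
proof -
  have *: "2 * g (cov_deriv br g x T y) z = koszul x (T y) z + koszul x y (T z)" for x y z
    using T by (simp add: cov_deriv_def skew_endomorphism_def g_lin algebra_simps flip: levi_civita)
  show ?thesis
  proof -
    have "g (cov_deriv br g x T y) z + g (cov_deriv br g y T x) z =
        2 * g x y * \<theta> z - g y z * \<theta> x - g x z * \<theta> y"
      using \<theta> by (simp add: cky_one_form_def)
    then show ?thesis using *[of x y z] *[of y x z] by algebra
  qed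
qed

lemma ex_nonzero_orthogonal: "\<exists>x. x \<noteq> 0 \<and> g x z = 0"
proof (cases "z = 0")
  case True
  obtain u where "g u u = 1" using ex_unit_orthogonal[of "{}"] by auto
  then have "u \<noteq> 0" by (auto simp: g_lin)
  then show ?thesis using True by (auto simp: g_lin)
next
  case False
  define u where "u = (1 / sqrt (g z z)) *\<^sub>R z"
  have u: "g u u = 1" using g_pos[OF False] by (simp add: u_def g_lin del: g_self_eq_0)
  obtain x where x: "g x x = 1" "g x u = 0"
    using ex_unit_orthogonal[of "{u}"] u by auto
  then have "x \<noteq> 0" by (metis g_lin(9) zero_neq_one)
  moreover have "g x z = 0" using x(2) False by (simp add: u_def g_lin)
  ultimately show ?thesis by blast
qed

text \<open>For x = y orthogonal to z, the right-hand side reduces to a multiple of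
  \<open>g x x * \<theta> z\<close>.\<close>

lemma cky_one_form_unique:
  assumes T: "skew_endomorphism g T" and \<theta>: "cky_one_form br g T \<theta>" "cky_one_form br g T \<theta>'"
  shows "\<theta> = \<theta>'"
proof
  fix z
  obtain x where x: "x \<noteq> 0" "g x z = 0" using ex_nonzero_orthogonal by blast
  have "g x x * \<theta> z = g x x * \<theta>' z"
    using cky_koszul[OF T \<theta>(1), of x x z] cky_koszul[OF T \<theta>(2), of x x z] x by simp
  then show "\<theta> z = \<theta>' z" using x by simp
qed

section \<open>Consequences of the CKY equation\<close>

text \<open>What the later arguments use of the CKY equation. It is homogeneous under joint
  rescaling of T and xi, so it serves both the unit case and the comparison of two tensors whose
  vectors have different lengths.\<close>

definition central_cky :: "('a \<Rightarrow> 'a) \<Rightarrow> 'a \<Rightarrow> bool" where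
  "central_cky T \<xi> \<longleftrightarrow> linear T \<and> (\<forall>x y. g (T x) y = - g x (T y)) \<and> (\<forall>y. br \<xi> y = 0) \<and> \<xi> \<noteq> 0 \<and>
    T \<xi> = 0 \<and> (\<forall>y z. g (br y (T z)) \<xi> = 2 * (g \<xi> \<xi> * g y z - g \<xi> y * g \<xi> z)) \<and>
    (\<forall>x y z. g x \<xi> = 0 \<longrightarrow> g y \<xi> = 0 \<longrightarrow> g z \<xi> = 0 \<longrightarrow>
      koszul x (T y) z + koszul x y (T z) + koszul y (T x) z + koszul y x (T z) = 0)"

lemma central_cky_scale:
  assumes "central_cky T \<xi>" "k \<noteq> 0"
  shows "central_cky (\<lambda>x. k *\<^sub>R T x) (k *\<^sub>R \<xi>)"
  unfolding central_cky_def
proof (intro conjI allI impI)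
  fix x y z assume "g x (k *\<^sub>R \<xi>) = 0" "g y (k *\<^sub>R \<xi>) = 0" "g z (k *\<^sub>R \<xi>) = 0"
  then have "koszul x (T y) z + koszul x y (T z) + koszul y (T x) z + koszul y x (T z) = 0"
    using assms by (auto simp: central_cky_def g_lin)
  then have "k * (koszul x (T y) z + koszul x y (T z) + koszul y (T x) z + koszul y x (T z)) = 0"
    by simp
  then show "koszul x (k *\<^sub>R T y) z + koszul x y (k *\<^sub>R T z)
      + koszul y (k *\<^sub>R T x) z + koszul y x (k *\<^sub>R T z) = 0"
    by (simp add: koszul_lin algebra_simps)
next
  fix y z
  have "g (br y (T z)) \<xi> = 2 * (g \<xi> \<xi> * g y z - g \<xi> y * g \<xi> z)"
    using assms by (simp add: central_cky_def)
  then show "g (br y (k *\<^sub>R T z)) (k *\<^sub>R \<xi>)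
      = 2 * (g (k *\<^sub>R \<xi>) (k *\<^sub>R \<xi>) * g y z - g (k *\<^sub>R \<xi>) y * g (k *\<^sub>R \<xi>) z)"
    by (simp only: g_lin br_lin, simp add: algebra_simps)
qed (use assms in \<open>auto simp: central_cky_def g_lin br_lin linear_scale linear_compose_scale_right
    algebra_simps\<close>)

lemma central_cky:
  assumes "strict_cky_tensor br g T" "associated_vector br g T \<xi>" "\<xi> \<in> lie_center br"
  shows "central_cky T \<xi>"
proof -
  have T: "skew_endomorphism g T" using assms by (simp add: strict_cky_tensor_def cky_tensor_def)
  obtain \<theta> where \<theta>: "cky_one_form br g T \<theta>" "\<And>x. \<theta> x = g \<xi> x"
    using assms by (auto simp: associated_vector_def)
  have "\<theta> \<noteq> (\<lambda>_. 0)"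
    using assms cky_one_form_unique[OF T \<theta>(1)] by (auto simp: strict_cky_tensor_def)
  then have \<xi>0: "\<xi> \<noteq> 0" using \<theta>(2) by (auto simp: g_lin)
  then have n: "g \<xi> \<xi> > 0" by (rule g_pos)
  have lin: "linear T" and skew: "g (T x) y = - g x (T y)" for x y
    using T by (auto simp: skew_endomorphism_def)
  have cl: "br \<xi> y = 0" for y using assms by (simp add: lie_center_def)
  have cr: "br y \<xi> = 0" for y using cl[of y] br_skew[of y \<xi>] by simp
  define \<mu> where "\<mu> x y = g (br x y) \<xi>" for x y
  have \<mu>_skew: "\<mu> y x = - \<mu> x y" for x y using br_skew[of x y] by (simp add: \<mu>_def g_lin)
  have K1: "koszul \<xi> x y = - \<mu> x y" and K2: "koszul x \<xi> y = - \<mu> x y" for x y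
    using br_skew[of y x] by (simp_all add: koszul_def \<mu>_def cl cr g_lin)
  define \<eta> where "\<eta> = T \<xi>"
  have \<eta>\<xi>: "g \<xi> \<eta> = 0" using skew[of \<xi> \<xi>] g_sym[of \<xi> \<eta>] by (simp add: \<eta>_def)
  \<comment> \<open>The CKY equation with xi in the first slot. Since xi is central,
    \<open>koszul\<close> with xi among its first two arguments is just -mu.\<close>
  have E: "- \<mu> (T y) z - \<mu> y (T z) + koszul y \<eta> z - \<mu> y (T z)
      = 2 * (g \<xi> y * g \<xi> z - g \<xi> \<xi> * g y z)" for y z
    using cky_koszul[OF T \<theta>(1), of \<xi> y z] g_sym[of y \<xi>]
    by (simp add: K1 K2 \<theta>(2) \<eta>_def algebra_simps)
  \<comment> \<open>Putting y = xi in \<open>E\<close> shows that mu annihilates eta = T xi. Then y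
    = z = eta makes every term on the left vanish and leaves g xi xi times g eta eta.\<close>
  have \<mu>\<eta>: "\<mu> \<eta> z = 0" for z
    using E[of \<xi> z] K1 by (simp add: \<mu>_def cl cr g_lin \<eta>_def[symmetric])
  have "g \<eta> \<eta> = 0"
    using E[of \<eta> \<eta>] \<mu>_skew[of \<eta> "T \<eta>"] n \<mu>\<eta>[of "T \<eta>"] \<eta>\<xi> \<xi>0 by simp
  then have T\<xi>: "T \<xi> = 0" by (simp add: \<eta>_def)
  have E': "\<mu> (T y) z + 2 * \<mu> y (T z) = 2 * (g \<xi> \<xi> * g y z - g \<xi> y * g \<xi> z)" for y z
    using E[of y z] T\<xi> by (simp add: \<eta>_def koszul_def br_lin g_lin cr)
  \<comment> \<open>The right-hand side R of \<open>E'\<close> is symmetric in y and z. With A =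
    mu(y, Tz) and B = mu(z, Ty), the equation and its swapped version read 2A - B = R and 2B - A =
    R, so A = R.\<close>
  have S: "\<mu> y (T z) = 2 * (g \<xi> \<xi> * g y z - g \<xi> y * g \<xi> z)" for y z
  proof -
    have "g z y = g y z" "g \<xi> z * g \<xi> y = g \<xi> y * g \<xi> z"
      by (rule g_sym, rule mult.commute)
    then have "\<mu> (T z) y + 2 * \<mu> z (T y) = 2 * (g \<xi> \<xi> * g y z - g \<xi> y * g \<xi> z)"
      using E'[of z y] by (simp only:)
    then show ?thesis
      using E'[of y z] \<mu>_skew[of y "T z"] \<mu>_skew[of z "T y"] by linarith
  qed
  have KY: "koszul x (T y) z + koszul x y (T z) + koszul y (T x) z + koszul y x (T z) = 0"
    if "g x \<xi> = 0" "g y \<xi> = 0" "g z \<xi> = 0" for x y z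
    using cky_koszul[OF T \<theta>(1), of x y z] that by (simp add: \<theta>(2) g_sym[of \<xi>])
  show ?thesis
    unfolding central_cky_def
    using lin skew cl \<xi>0 T\<xi> S[unfolded \<mu>_def] KY by (intro conjI allI impI)
qed

end

section \<open>Bases adapted to T, and parallelism of T\<close>

lemma quadratic_nonneg_imp_linear_coeff_0:
  fixes A B :: real
  assumes "\<And>s. A * s\<^sup>2 + 2 * B * s \<ge> 0"
  shows "B = 0"
proof (rule ccontr)
  assume "B \<noteq> 0"
  define d where "d = \<bar>A\<bar> + 1"
  have d: "d > 0" "A - 2 * d < 0" by (auto simp: d_def)
  have "A * (- B / d)\<^sup>2 + 2 * B * (- B / d) = (B / d)\<^sup>2 * (A - 2 * d)"
    using d by (simp add: power2_eq_square field_simps)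
  moreover have "\<dots> < 0" using d \<open>B \<noteq> 0\<close> by (simp add: mult_pos_neg)
  ultimately show False using assms[of "- B / d"] by linarith
qed

context metric_lie5
begin

lemma koszul_neg_zero:
  "koszul (- x) y z = - koszul x y z" "koszul x (- y) z = - koszul x y z"
  "koszul x y (- z) = - koszul x y z"
  "koszul 0 y z = 0" "koszul x 0 z = 0" "koszul x y 0 = 0"
  by (simp_all add: koszul_def g_lin br_lin)

lemma linear_vanishes:
  fixes F :: "'a \<Rightarrow> real"
  assumes "onb5 e f e' f' \<xi>" "linear F" "F e = 0" "F f = 0" "F e' = 0" "F f' = 0" "g x \<xi> = 0"
  shows "F x = 0"
proof -
  have "F x = F (g x e *\<^sub>R e + g x f *\<^sub>R f + g x e' *\<^sub>R e' + g x f' *\<^sub>R f' + g x \<xi> *\<^sub>R \<xi>)"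
    using onb5_expand[OF assms(1), of x] by simp
  also have "\<dots> = 0"
    using assms by (simp add: linear_add linear_scale)
  finally show ?thesis .
qed

text \<open>A maximiser e of |Tx|^2 on the unit sphere satisfies <Te, Ty> = M <e, y> for all y,
  which is T^2 e = -M e. The maximum is taken in coordinates, because \<open>'a\<close> is a bare
  real vector space that carries no topology.\<close>

lemma ex_eigenvector:
  assumes T: "linear T" "\<And>x y. g (T x) y = - g x (T y)" and nz: "T x0 \<noteq> 0"
  shows "\<exists>e M. g e e = 1 \<and> M > 0 \<and> T (T e) = - (M *\<^sub>R e)"
proof -
  obtain b where b: "onb b" using ex_onb by blast
  define \<psi> :: "real ^ frame \<Rightarrow> 'a" where "\<psi> v = (\<Sum>i\<in>UNIV. v $ i *\<^sub>R b i)" for v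
  have b': "g (b i) (b j) = (if i = j then 1 else 0)" for i j using b by (simp add: onb_def)
  have gT: "g (T (\<psi> v)) (T (\<psi> v)) = (\<Sum>i\<in>UNIV. \<Sum>j\<in>UNIV. v $ i * v $ j * g (T (b j)) (T (b i)))" for v
    by (simp add: \<psi>_def linear_sum[OF T(1)] linear_scale[OF T(1)] linear_sum[OF linear_g_left]
        linear_sum[OF linear_g_right] g_lin sum_distrib_left mult_ac)
  have g\<psi>: "g (\<psi> v) (\<psi> v) = v \<bullet> v" for v
    by (simp add: \<psi>_def linear_sum[OF linear_g_left]
        linear_sum[OF linear_g_right] g_lin b' if_distrib inner_vec_def cong: if_cong)
  have surj: "\<exists>v. x = \<psi> v" for x
    using onb_expand[OF b, of x] by (intro exI[of _ "\<chi> i. g x (b i)"]) (simp add: \<psi>_def)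
  have "continuous_on (sphere 0 1) (\<lambda>v. g (T (\<psi> v)) (T (\<psi> v)))"
    unfolding gT by (intro continuous_intros)
  moreover have "compact (sphere 0 1 :: (real ^ frame) set)" "sphere 0 1 \<noteq> ({} :: (real ^ frame) set)"
    by simp_all
  ultimately obtain v where v: "v \<in> sphere 0 1"
    and max: "\<And>w. w \<in> sphere 0 1 \<Longrightarrow> g (T (\<psi> w)) (T (\<psi> w)) \<le> g (T (\<psi> v)) (T (\<psi> v))"
    using continuous_attains_sup[of "sphere 0 1" "\<lambda>v. g (T (\<psi> v)) (T (\<psi> v))"] by blast
  define e M where "e = \<psi> v" and "M = g (T e) (T e)"
  have e1: "g e e = 1" using v by (simp add: e_def g\<psi> norm_eq_1)
  have le: "g (T x) (T x) \<le> M * g x x" for x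
  proof (cases "x = 0")
    case True then show ?thesis by (simp add: linear_0[OF T(1)] g_lin)
  next
    case False
    define y where "y = (1 / sqrt (g x x)) *\<^sub>R x"
    have p: "g x x > 0" using False by (rule g_pos)
    obtain w where w: "y = \<psi> w" using surj by blast
    have "g y y = 1" using p by (simp add: y_def g_lin del: g_self_eq_0)
    then have "w \<in> sphere 0 1" using g\<psi>[of w] w by (simp add: norm_eq_1)
    then have "g (T y) (T y) \<le> M" using max w by (simp add: M_def e_def)
    moreover have "g (T y) (T y) = g (T x) (T x) / g x x"
      using p by (simp add: y_def linear_scale[OF T(1)] g_lin)
    ultimately show ?thesis using p by (simp add: divide_simps)
  qed
  have crit: "g (T e) (T y) = M * g e y" for y
  proof -
    \<comment> \<open>The vector e + s y obeys the bound \<open>le\<close> for every s, with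
      equality at s = 0, so the linear coefficient in s has to vanish.\<close>
    have "(M * g y y - g (T y) (T y)) * s\<^sup>2 + 2 * (M * g e y - g (T e) (T y)) * s \<ge> 0" for s
    proof -
      have "g (T (e + s *\<^sub>R y)) (T (e + s *\<^sub>R y)) \<le> M * g (e + s *\<^sub>R y) (e + s *\<^sub>R y)"
        by (rule le)
      then show ?thesis
        using e1 by (simp add: linear_add[OF T(1)] linear_scale[OF T(1)] g_lin M_def[symmetric]
            power2_eq_square algebra_simps g_sym[of y e] g_sym[of "T y" "T e"])
    qed
    then have "M * g e y - g (T e) (T y) = 0" by (rule quadratic_nonneg_imp_linear_coeff_0)
    then show ?thesis by simp
  qed
  have "T (T e) = - (M *\<^sub>R e)"
    by (rule eq_by_g) (use crit T(2) in \<open>simp add: g_lin\<close>)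
  moreover have "M > 0"
  proof -
    have "0 < g (T x0) (T x0)" using nz by (rule g_pos)
    also have "\<dots> \<le> M * g x0 x0" by (rule le)
    finally show ?thesis using g_nonneg[of x0] by (simp add: zero_less_mult_iff)
  qed
  ultimately show ?thesis using e1 by blast
qed

definition T_basis :: "('a \<Rightarrow> 'a) \<Rightarrow> 'a \<Rightarrow> real \<Rightarrow> real \<Rightarrow> 'a \<Rightarrow> 'a \<Rightarrow> 'a \<Rightarrow> 'a \<Rightarrow> bool" where
  "T_basis T \<xi> a1 a2 e f e' f' \<longleftrightarrow> onb5 e f e' f' \<xi> \<and> a1 > 0 \<and> a2 > 0 \<and>
    T e = a1 *\<^sub>R f \<and> T f = - (a1 *\<^sub>R e) \<and> T e' = a2 *\<^sub>R f' \<and> T f' = - (a2 *\<^sub>R e')"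

lemma ex_normalize:
  assumes "central_cky T \<xi>"
  shows "\<exists>k>0. g (k *\<^sub>R \<xi>) (k *\<^sub>R \<xi>) = 1 \<and> central_cky (\<lambda>x. k *\<^sub>R T x) (k *\<^sub>R \<xi>)"
proof -
  have "\<xi> \<noteq> 0" using assms by (simp add: central_cky_def)
  then have p: "g \<xi> \<xi> > 0" "\<xi> \<noteq> 0" using g_pos by auto
  then have "g ((1 / sqrt (g \<xi> \<xi>)) *\<^sub>R \<xi>) ((1 / sqrt (g \<xi> \<xi>)) *\<^sub>R \<xi>) = 1"
    by (simp add: g_lin del: g_self_eq_0)
  then show ?thesis using p central_cky_scale[OF assms, of "1 / sqrt (g \<xi> \<xi>)"]
    by (intro exI[of _ "1 / sqrt (g \<xi> \<xi>)"]) auto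
qed

end

locale unit_cky = metric_lie5 +
  fixes T :: "'a \<Rightarrow> 'a" and \<xi> :: 'a
  assumes cky: "central_cky T \<xi>" and unit: "g \<xi> \<xi> = 1"
begin

lemma linear_T: "linear T" and T_skew: "g (T x) y = - g x (T y)"
  and central [simp]: "br \<xi> y = 0" and T_\<xi> [simp]: "T \<xi> = 0"
  and br_T: "g (br y (T z)) \<xi> = 2 * (g y z - g \<xi> y * g \<xi> z)"
  and KY: "g x \<xi> = 0 \<Longrightarrow> g y \<xi> = 0 \<Longrightarrow> g z \<xi> = 0 \<Longrightarrow>
    koszul x (T y) z + koszul x y (T z) + koszul y (T x) z + koszul y x (T z) = 0"
  using cky unit by (auto simp: central_cky_def)

lemma central' [simp]: "br y \<xi> = 0"
  using br_skew[of \<xi> y] by simp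

lemmas T_lin = linear_add[OF linear_T] linear_scale[OF linear_T] linear_neg[OF linear_T]
  linear_0[OF linear_T] linear_diff[OF linear_T]

lemma T_perp: "g (T x) \<xi> = 0" "g \<xi> (T x) = 0"
  using T_skew[of x \<xi>] g_sym[of \<xi> "T x"] by (simp_all add: g_lin)

lemma T_inj: "g z \<xi> = 0 \<Longrightarrow> T z = 0 \<Longrightarrow> z = 0"
  using br_T[of z z] g_sym[of z \<xi>] by (simp add: br_lin g_lin)

lemma T_self: "g x (T x) = 0" "g (T x) x = 0"
  using T_skew[of x x] g_sym[of x "T x"] by simp_all

text \<open>An eigenvector e of T^2 and its image span one plane. T is skew on the orthogonal plane
  inside the complement of xi, hence acts there as c times a quarter turn; replacing f' by -f' makes
  c positive.\<close>

lemma ex_T_basis: "\<exists>a1 a2 e f e' f'. T_basis T \<xi> a1 a2 e f e' f'"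
proof -
  obtain x0 where x0: "g x0 x0 = 1" "g x0 \<xi> = 0"
    using onb5_extend[OF unit] unfolding onb5_iff by blast
  then have "x0 \<noteq> 0" by (auto simp: g_lin)
  then have "T x0 \<noteq> 0" using T_inj x0 by blast
  then obtain e M where e: "g e e = 1" "M > 0" "T (T e) = - (M *\<^sub>R e)"
    using ex_eigenvector[OF linear_T T_skew] by blast
  define a where "a = sqrt M"
  have a: "a > 0" "a * a = M" using e(2) by (simp_all add: a_def)
  define f where "f = (1 / a) *\<^sub>R T e"
  have Te: "T e = a *\<^sub>R f" using a by (simp add: f_def)
  have Tf: "T f = - (a *\<^sub>R e)" using a e(3) by (simp add: f_def T_lin field_simps flip: a(2))
  \<comment> \<open>The image of T is orthogonal to xi, and e is a multiple of T(Te).\<close>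
  have "a * (a * g e \<xi>) = 0" using T_perp(1)[of "T e"] e(3) a by (simp add: g_lin flip: mult.assoc)
  then have e\<xi>: "g e \<xi> = 0" using a by simp
  have f\<xi>: "g f \<xi> = 0" by (simp add: f_def g_lin T_perp)
  have fe: "g f e = 0" by (simp add: f_def g_lin T_self)
  have "a * g f f = a" using T_skew[of e f] Te Tf e(1) a by (simp add: g_lin)
  then have ff: "g f f = 1" using a by simp
  obtain e' f' where o: "onb5 e f e' f' \<xi>"
    using onb5_extend3[OF unit e(1) e\<xi> ff f\<xi> fe] by blast
  note oD = onb5_D[OF o]
  define c where "c = g (T e') f'"
  have Te': "T e' = c *\<^sub>R f'"
    using onb5_expand[OF o, of "T e'"] T_skew[of e' e] T_skew[of e' f]
    by (simp add: c_def T_self T_perp Te Tf g_lin oD)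
  have Tf': "T f' = - (c *\<^sub>R e')"
    using onb5_expand[OF o, of "T f'"] T_skew[of f' e] T_skew[of f' f] T_skew[of f' e']
    by (simp add: T_self T_perp Te Tf g_lin oD Te')
  have "c \<noteq> 0"
  proof
    assume "c = 0"
    then have "e' = 0" using T_inj[of e'] oD Te' by simp
    then show False using oD by (simp add: g_lin)
  qed
  then consider "c > 0" | "- c > 0" by linarith
  then show ?thesis
  proof cases
    case 1
    then have "T_basis T \<xi> a c e f e' f'" using o a Te Tf Te' Tf' by (simp add: T_basis_def)
    then show ?thesis by blast
  next
    case 2
    have "onb5 e f e' (- f') \<xi>" using oD by (simp add: onb5_iff g_lin)
    then have "T_basis T \<xi> a (- c) e f e' (- f')"
      using 2 a Te Tf Te' Tf' by (simp add: T_basis_def T_lin)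
    then show ?thesis by blast
  qed
qed

text \<open>The covariant derivative of \<open>T\<close> is totally skew on the complement of \<open>\<xi>\<close> and vanishes on pairs
  \<open>e, f\<close> and \<open>e', f'\<close>; any three basis vectors repeat one of them or contain such a pair.\<close>

lemma parallel:
  assumes "g x \<xi> = 0" "g y \<xi> = 0" "g z \<xi> = 0"
  shows "koszul x (T y) z + koszul x y (T z) = 0"
proof -
  obtain a1 a2 e f e' f' where t: "T_basis T \<xi> a1 a2 e f e' f'" using ex_T_basis by blast
  then have o: "onb5 e f e' f' \<xi>" and T: "T e = a1 *\<^sub>R f" "T f = - (a1 *\<^sub>R e)"
    "T e' = a2 *\<^sub>R f'" "T f' = - (a2 *\<^sub>R e')" by (auto simp: T_basis_def)
  note oD = onb5_D[OF o]
  define \<phi> where "\<phi> x y z = koszul x (T y) z + koszul x y (T z)" for x y z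
  have lin: "linear (\<lambda>x. \<phi> x y z)" "linear (\<lambda>y. \<phi> x y z)" "linear (\<lambda>z. \<phi> x y z)" for x y z
    by (auto simp: \<phi>_def koszul_lin T_lin algebra_simps intro!: linearI)
  have s23: "\<phi> x z y = - \<phi> x y z" for x y z
    using koszul_skew[of x "T y" z] koszul_skew[of x y "T z"] by (simp add: \<phi>_def)
  have s12: "\<phi> y x z = - \<phi> x y z" if "g x \<xi> = 0" "g y \<xi> = 0" "g z \<xi> = 0" for x y z
    using KY[of x y z] that by (simp add: \<phi>_def)
  have pair: "\<phi> x e f = 0" "\<phi> x e' f' = 0" for x
    by (simp_all add: \<phi>_def T koszul_lin koszul_neg_zero)
  have eq: "\<phi> x x z = 0" "\<phi> x z z = 0" "\<phi> x z x = 0" if "g x \<xi> = 0" "g z \<xi> = 0" for x z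
    using s12[of x x z] s23[of x z z] s23[of x z x] that by auto
  have perm: "\<phi> x v u = 0" "\<phi> u x v = 0" "\<phi> u v x = 0" "\<phi> v x u = 0" "\<phi> v u x = 0"
    if "\<And>x. \<phi> x u v = 0" "g u \<xi> = 0" "g v \<xi> = 0" "g x \<xi> = 0" for x u v
    using s23[of x u v] s12[of x u v] s23[of u x v] s12[of x v u] s23[of v x u] that by auto
  note zeros = pair eq perm[OF pair(1)] perm[OF pair(2)]
  have b: "\<phi> u v w = 0" if "u \<in> {e, f, e', f'}" "v \<in> {e, f, e', f'}" "w \<in> {e, f, e', f'}" for u v w
    using that by (auto simp: zeros oD)
  have "\<phi> x v w = 0" if "v \<in> {e, f, e', f'}" "w \<in> {e, f, e', f'}" for v w
    using that b by (intro linear_vanishes[OF o lin(1) _ _ _ _ assms(1)]) auto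
  then have "\<phi> x y w = 0" if "w \<in> {e, f, e', f'}" for w
    using that by (intro linear_vanishes[OF o lin(2) _ _ _ _ assms(2)]) auto
  then have "\<phi> x y z = 0"
    by (intro linear_vanishes[OF o lin(3) _ _ _ _ assms(3)]) auto
  then show ?thesis by (simp add: \<phi>_def)
qed

text \<open>These are instances of \<open>br_T\<close>: mu pairs a basis vector only with its
  partner under T.\<close>

lemma T_basis_br:
  assumes "T_basis T \<xi> a1 a2 e f e' f'"
  shows "g (br e f) \<xi> = 2 / a1" "g (br e' f') \<xi> = 2 / a2" "g (br e e') \<xi> = 0"
    "g (br e f') \<xi> = 0" "g (br f e') \<xi> = 0" "g (br f f') \<xi> = 0"
proof -
  have a: "a1 > 0" "a2 > 0" and T: "T e = a1 *\<^sub>R f" "T f = - (a1 *\<^sub>R e)"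
    "T e' = a2 *\<^sub>R f'" "T f' = - (a2 *\<^sub>R e')" and oD: "onb5 e f e' f' \<xi>"
    using assms by (auto simp: T_basis_def)
  note oD = onb5_D[OF oD]
  show "g (br e f) \<xi> = 2 / a1" using br_T[of e e] a by (simp add: T br_lin g_lin oD field_simps)
  show "g (br e' f') \<xi> = 2 / a2" using br_T[of e' e'] a by (simp add: T br_lin g_lin oD field_simps)
  show "g (br e e') \<xi> = 0" using br_T[of e f'] a by (simp add: T br_lin g_lin oD)
  show "g (br e f') \<xi> = 0" using br_T[of e e'] a by (simp add: T br_lin g_lin oD)
  show "g (br f e') \<xi> = 0" using br_T[of f f'] a by (simp add: T br_lin g_lin oD)
  show "g (br f f') \<xi> = 0" using br_T[of f e'] a by (simp add: T br_lin g_lin oD)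
qed

end

section \<open>Two distinct eigenvalues\<close>

lemma ex_rotation_orthogonal:
  fixes A B :: real
  shows "\<exists>c s. c\<^sup>2 + s\<^sup>2 = 1 \<and> c * A + s * B = 0"
proof (cases "A = 0 \<and> B = 0")
  case True
  then show ?thesis by (intro exI[of _ 1] exI[of _ 0]) simp
next
  case False
  define d where "d = sqrt (A\<^sup>2 + B\<^sup>2)"
  have "A\<^sup>2 + B\<^sup>2 > 0" using False by (auto simp: sum_power2_gt_zero_iff)
  then have "d > 0" "d\<^sup>2 = A\<^sup>2 + B\<^sup>2" by (simp_all add: d_def)
  then have d: "d\<^sup>2 > 0" "d\<^sup>2 = A\<^sup>2 + B\<^sup>2" by (metis zero_less_power, blast)
  have "(- B / d)\<^sup>2 + (A / d)\<^sup>2 = (A\<^sup>2 + B\<^sup>2) / d\<^sup>2"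
    by (simp add: power_divide add_divide_distrib)
  also have "\<dots> = 1" using d by (metis divide_self less_irrefl)
  finally have "(- B / d)\<^sup>2 + (A / d)\<^sup>2 = 1" .
  then show ?thesis by (intro exI[of _ "- B / d"] exI[of _ "A / d"]) simp
qed

section \<open>Brackets from the connection, and the orthonormal models\<close>

context metric_lie5
begin

lemma jacobi_g: "g (br x (br y z)) w + g (br y (br z x)) w + g (br z (br x y)) w = 0"
  using jacobi[of x y z] by (simp add: g_lin(9) flip: g_lin(1))

text \<open>The connection is torsion free. This transfers the constraints that parallelism puts on
  \<open>koszul\<close> to the brackets, where the Jacobi identity lives.\<close>

lemma br_koszul: "2 * g (br x y) z = koszul x y z - koszul y x z"
  using br_skew[of x y] br_skew[of x z] br_skew[of y z] by (simp add: koszul_def g_lin)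

text \<open>Models with respect to an orthonormal basis: \<open>prod_form\<close> covers the items (1)-(4) and (8) of the list,
  \<open>d4_form\<close> the items (5) and (7), \<open>d42_form\<close> the item (6).\<close>

definition prod_form :: "'a \<Rightarrow> real \<Rightarrow> real \<Rightarrow> real \<Rightarrow> real \<Rightarrow> real \<Rightarrow> bool" where
  "prod_form \<xi> a1 a2 p q b \<longleftrightarrow> (\<exists>e f e' f'. onb5 e f e' f' \<xi> \<and> (\<forall>y. br \<xi> y = 0) \<and>
     a1 \<noteq> 0 \<and> a2 \<noteq> 0 \<and> q * b = 0 \<and>
     br e f = p *\<^sub>R f + (2 / a1) *\<^sub>R \<xi> \<and> br e' f' = q *\<^sub>R f' + (2 / a2) *\<^sub>R \<xi> \<and>
     br e e' = b *\<^sub>R f' \<and> br e f' = - (b *\<^sub>R e') \<and> br f e' = 0 \<and> br f f' = 0)"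

definition d4_form :: "'a \<Rightarrow> real \<Rightarrow> real \<Rightarrow> real \<Rightarrow> bool" where
  "d4_form \<xi> c p r \<longleftrightarrow> (\<exists>e f e' f'. onb5 e f e' f' \<xi> \<and> (\<forall>y. br \<xi> y = 0) \<and> c \<noteq> 0 \<and> p \<noteq> 0 \<and>
     br e f = p *\<^sub>R f + (2 / c) *\<^sub>R \<xi> \<and> br e' f' = p *\<^sub>R f + (2 / c) *\<^sub>R \<xi> \<and>
     br e e' = (p / 2) *\<^sub>R e' + r *\<^sub>R f' \<and> br e f' = - (r *\<^sub>R e') + (p / 2) *\<^sub>R f' \<and>
     br f e' = 0 \<and> br f f' = 0)"

definition d42_form :: "'a \<Rightarrow> real \<Rightarrow> real \<Rightarrow> bool" where
  "d42_form \<xi> c p \<longleftrightarrow> (\<exists>e f e' f'. onb5 e f e' f' \<xi> \<and> (\<forall>y. br \<xi> y = 0) \<and> c \<noteq> 0 \<and> p \<noteq> 0 \<and>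
     br e f = p *\<^sub>R f + (2 / c) *\<^sub>R \<xi> \<and> br e' f' = (2 / c) *\<^sub>R \<xi> \<and>
     br e e' = - ((p / 2) *\<^sub>R e') \<and> br e f' = (p / 2) *\<^sub>R f' \<and>
     br f e' = - (p *\<^sub>R f') \<and> br f f' = 0)"

lemma prod_formI:
  assumes "onb5 e f e' f' \<xi>" "\<And>y. br \<xi> y = 0" "a1 \<noteq> 0" "a2 \<noteq> 0" "q * b = 0"
    "br e f = p *\<^sub>R f + (2 / a1) *\<^sub>R \<xi>" "br e' f' = q *\<^sub>R f' + (2 / a2) *\<^sub>R \<xi>"
    "br e e' = b *\<^sub>R f'" "br e f' = - (b *\<^sub>R e')" "br f e' = 0" "br f f' = 0"
  shows "prod_form \<xi> a1 a2 p q b"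
  using assms unfolding prod_form_def by metis

lemma d4_formI:
  assumes "onb5 e f e' f' \<xi>" "\<And>y. br \<xi> y = 0" "c \<noteq> 0" "p \<noteq> 0"
    "br e f = p *\<^sub>R f + (2 / c) *\<^sub>R \<xi>" "br e' f' = p *\<^sub>R f + (2 / c) *\<^sub>R \<xi>"
    "br e e' = (p / 2) *\<^sub>R e' + r *\<^sub>R f'" "br e f' = - (r *\<^sub>R e') + (p / 2) *\<^sub>R f'"
    "br f e' = 0" "br f f' = 0"
  shows "d4_form \<xi> c p r"
  using assms unfolding d4_form_def by metis

lemma d42_formI:
  assumes "onb5 e f e' f' \<xi>" "\<And>y. br \<xi> y = 0" "c \<noteq> 0" "p \<noteq> 0"
    "br e f = p *\<^sub>R f + (2 / c) *\<^sub>R \<xi>" "br e' f' = (2 / c) *\<^sub>R \<xi>"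
    "br e e' = - ((p / 2) *\<^sub>R e')" "br e f' = (p / 2) *\<^sub>R f'"
    "br f e' = - (p *\<^sub>R f')" "br f f' = 0"
  shows "d42_form \<xi> c p"
  using assms unfolding d42_form_def by metis

end

context unit_cky
begin

lemma T_basis_rotate:
  assumes "T_basis T \<xi> a1 a2 e f e' f'" "c\<^sup>2 + s\<^sup>2 = 1"
  shows "T_basis T \<xi> a1 a2 (c *\<^sub>R e + s *\<^sub>R f) (c *\<^sub>R f - s *\<^sub>R e) e' f'"
proof -
  have o: "onb5 e f e' f' \<xi>" using assms by (simp add: T_basis_def)
  have "onb5 (c *\<^sub>R e + s *\<^sub>R f) (c *\<^sub>R f - s *\<^sub>R e) e' f' \<xi>"
    using assms(2) onb5_D[OF o] by (simp add: onb5_iff g_lin power2_eq_square)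
  then show ?thesis using assms(1) by (simp add: T_basis_def T_lin algebra_simps)
qed

lemma br_rotate:
  "c\<^sup>2 + s\<^sup>2 = 1 \<Longrightarrow> br (c *\<^sub>R e + s *\<^sub>R f) (c *\<^sub>R f - s *\<^sub>R e) = br e f"
proof -
  assume "c\<^sup>2 + s\<^sup>2 = 1"
  moreover have "br (c *\<^sub>R e + s *\<^sub>R f) (c *\<^sub>R f - s *\<^sub>R e) = (c\<^sup>2 + s\<^sup>2) *\<^sub>R br e f"
    using br_skew[of e f] by (simp add: br_lin algebra_simps power2_eq_square)
  ultimately show ?thesis by simp
qed

lemma T_basis_swap:
  assumes "T_basis T \<xi> a1 a2 e f e' f'" shows "T_basis T \<xi> a2 a1 e' f' e f"
proof -
  have o: "onb5 e f e' f' \<xi>" using assms by (simp add: T_basis_def)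
  have "onb5 e' f' e f \<xi>" by (simp add: onb5_iff onb5_D[OF o])
  then show ?thesis using assms by (simp add: T_basis_def)
qed

text \<open>Turning e and f within their plane leaves their bracket unchanged
  (\<open>br_rotate\<close>), so the turn can be chosen to make e orthogonal to it.\<close>

lemma T_basis_align:
  assumes "T_basis T \<xi> a1 a2 e f e' f'"
  shows "\<exists>e f. T_basis T \<xi> a1 a2 e f e' f' \<and> g (br e f) e = 0"
proof -
  obtain c s where cs: "c\<^sup>2 + s\<^sup>2 = 1" "c * g (br e f) e + s * g (br e f) f = 0"
    using ex_rotation_orthogonal by blast
  have "g (br (c *\<^sub>R e + s *\<^sub>R f) (c *\<^sub>R f - s *\<^sub>R e)) (c *\<^sub>R e + s *\<^sub>R f) = 0"
    unfolding br_rotate[OF cs(1)] using cs(2) by (simp add: g_lin)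
  then show ?thesis using T_basis_rotate[OF assms cs(1)] by blast
qed

text \<open>Parallelism with distinct eigenvalues makes the connection preserve both eigenplanes, so
  the mixed \<open>koszul\<close> terms vanish. What remains besides p and q are b, d, by which e, f
  rotate the second plane, and m, n, by which e', f' rotate the first. The Jacobi identity kills at
  least one of these two pairs, and a turn of the acting plane leaves a single rotation
  coefficient.\<close>

lemma product_case:
  assumes "T_basis T \<xi> a1 a2 e0 f0 e0' f0'" "a1 \<noteq> a2"
  shows "\<exists>a1 a2 p q b. prod_form \<xi> a1 a2 p q b"
proof -
  obtain e f where "T_basis T \<xi> a1 a2 e f e0' f0'" and ef: "g (br e f) e = 0"
    using T_basis_align[OF assms(1)] by blast
  then obtain e' f' where "T_basis T \<xi> a2 a1 e' f' e f" and ef': "g (br e' f') e' = 0"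
    using T_basis_align T_basis_swap by blast
  then have t: "T_basis T \<xi> a1 a2 e f e' f'" using T_basis_swap by blast
  then have o: "onb5 e f e' f' \<xi>" and a: "a1 > 0" "a2 > 0" and T: "T e = a1 *\<^sub>R f"
      "T f = - (a1 *\<^sub>R e)" "T e' = a2 *\<^sub>R f'" "T f' = - (a2 *\<^sub>R e')"
    by (auto simp: T_basis_def)
  note oD = onb5_D[OF o]
  have a2: "a1\<^sup>2 - a2\<^sup>2 \<noteq> 0" using a assms(2) by (simp add: power2_eq_iff)
  have K: "koszul x e e' = 0" "koszul x f f' = 0" "koszul x e f' = 0" "koszul x f e' = 0"
    if "g x \<xi> = 0" for x
  proof -
    have E: "a1 * koszul x f e' + a2 * koszul x e f' = 0"
      "a1 * koszul x f f' - a2 * koszul x e e' = 0"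
      "- a1 * koszul x e e' + a2 * koszul x f f' = 0"
      "- a1 * koszul x e f' - a2 * koszul x f e' = 0"
      using parallel[of x e e'] parallel[of x e f'] parallel[of x f e'] parallel[of x f f'] that
      by (simp_all add: T koszul_lin koszul_neg_zero oD)
    \<comment> \<open>The relations \<open>E\<close> form two linear 2x2 systems, each with
      determinant a1^2 - a2^2 up to sign.\<close>
    have "(a1\<^sup>2 - a2\<^sup>2) * koszul x e e' = 0" "(a1\<^sup>2 - a2\<^sup>2) * koszul x f f' = 0"
      "(a1\<^sup>2 - a2\<^sup>2) * koszul x e f' = 0" "(a1\<^sup>2 - a2\<^sup>2) * koszul x f e' = 0"
      using E by algebra+
    then show "koszul x e e' = 0" "koszul x f f' = 0" "koszul x e f' = 0" "koszul x f e' = 0"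
      using a2 by auto
  qed
  have K': "koszul x e' e = 0" "koszul x f' f = 0" "koszul x f' e = 0" "koszul x e' f = 0"
    if "g x \<xi> = 0" for x
    using K[OF that] koszul_skew by (metis minus_zero)+
  define p q m n b d where "p = g (br e f) f" and "q = g (br e' f') f'"
    and "m = g (br f e') e" and "n = g (br f f') e"
    and "b = g (br e e') f'" and "d = g (br f e') f'"
  have cross: "2 * g (br e e') f' = koszul e e' f'" "2 * g (br f e') f' = koszul f e' f'"
    "2 * g (br e e') f = - koszul e' e f" "2 * g (br e f') f = - koszul f' e f"
    "2 * g (br f e') e = koszul e' e f" "2 * g (br f f') e = koszul f' e f"
    "2 * g (br e f') e' = - koszul e e' f'" "2 * g (br f f') e' = - koszul f e' f'"
    using koszul_skew[of _ e f] koszul_skew[of _ e' f'] by (simp_all add: br_koszul K K' oD)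
  have cross0: "2 * g (br e e') e = 0" "2 * g (br e e') e' = 0" "2 * g (br e f') e = 0"
    "2 * g (br e f') f' = 0" "2 * g (br f e') f = 0" "2 * g (br f e') e' = 0"
    "2 * g (br f f') f = 0" "2 * g (br f f') f' = 0" "2 * g (br e f) e' = 0" "2 * g (br e f) f' = 0"
    "2 * g (br e' f') e = 0" "2 * g (br e' f') f = 0"
    unfolding br_koszul by (simp_all add: K K' oD)
  have cross1: "g (br e e') f = - m" "g (br e f') f = - n" "g (br e f') e' = - b"
    "g (br f f') e' = - d"
    using cross by (simp_all add: m_def n_def b_def d_def)
  have B: "br e f = p *\<^sub>R f + (2 / a1) *\<^sub>R \<xi>" "br e' f' = q *\<^sub>R f' + (2 / a2) *\<^sub>R \<xi>"
    "br e e' = b *\<^sub>R f' - m *\<^sub>R f" "br e f' = - (b *\<^sub>R e') - n *\<^sub>R f"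
    "br f e' = d *\<^sub>R f' + m *\<^sub>R e" "br f f' = n *\<^sub>R e - d *\<^sub>R e'"
    using onb5_expand[OF o, of "br e f"] onb5_expand[OF o, of "br e' f'"]
      onb5_expand[OF o, of "br e e'"] onb5_expand[OF o, of "br e f'"]
      onb5_expand[OF o, of "br f e'"] onb5_expand[OF o, of "br f f'"]
      cross0 T_basis_br[OF t] ef ef'
    by (simp_all add: cross1 flip: p_def q_def m_def n_def b_def d_def)
  note B' = B B[THEN arg_cong[of _ _ uminus], folded br_skew]
  have J: "b * n + p * m = 0" "d * n = 0" "p * d = 0" "p * n = b * m" "d * m = 0"
    "q * n = 0" "q * b + m * d = 0" "d * q = m * b" "n * b = 0"
    using jacobi_g[of e f e' e] jacobi_g[of e f e' f] jacobi_g[of e f e' f']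
      jacobi_g[of e f f' e] jacobi_g[of e f f' f] jacobi_g[of e e' f' f] jacobi_g[of e e' f' e']
      jacobi_g[of f e' f' e'] jacobi_g[of f e' f' f']
    by (simp_all add: B' br_lin g_lin oD algebra_simps)
  then have J: "q * n = 0" "p * d = 0" "p * m = 0" "p * n = b * m" "d * n = 0" "d * m = 0"
      "b * q = 0" "d * q = m * b" "n * b = 0"
    by (auto simp: mult.commute)
  show ?thesis
  proof (cases "m = 0 \<and> n = 0")
    case True
    show ?thesis
    proof (cases "d = 0")
      case True
      then have "prod_form \<xi> a1 a2 p q b"
        using \<open>m = 0 \<and> n = 0\<close> a J B by (intro prod_formI[OF o]) auto
      then show ?thesis by blast
    next
      case False
      then have z: "p = 0" "q = 0" using J True by auto
      \<comment> \<open>The condition says that c f - s e acts trivially on the second plane. The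
        turn is harmless because p = 0 leaves no preferred direction in the first plane.\<close>
      obtain c s where cs: "c\<^sup>2 + s\<^sup>2 = 1" "c * d + s * (- b) = 0"
        using ex_rotation_orthogonal by blast
      have "T_basis T \<xi> a1 a2 (c *\<^sub>R e + s *\<^sub>R f) (c *\<^sub>R f - s *\<^sub>R e) e' f'"
        by (rule T_basis_rotate[OF t cs(1)])
      then have "onb5 (c *\<^sub>R e + s *\<^sub>R f) (c *\<^sub>R f - s *\<^sub>R e) e' f' \<xi>" by (simp add: T_basis_def)
      then have "prod_form \<xi> a1 a2 0 0 (c * b + s * d)"
      proof (rule prod_formI)
        show "br (c *\<^sub>R e + s *\<^sub>R f) (c *\<^sub>R f - s *\<^sub>R e) =
            0 *\<^sub>R (c *\<^sub>R f - s *\<^sub>R e) + (2 / a1) *\<^sub>R \<xi>"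
          using z by (simp add: br_rotate[OF cs(1)] B)
      qed (use True a B z cs in \<open>auto simp: br_lin algebra_simps simp flip: scaleR_left_distrib\<close>)
      then show ?thesis by blast
    qed
  next
    case False
    then have z: "d = 0" "b = 0" "p = 0" using J by auto
    \<comment> \<open>The roles of the planes are exchanged. A turn of e', f' would spoil the shape
      of [e', f'] unless q = 0; by \<open>q * n = 0\<close> a turn is needed only in that
      case.\<close>
    obtain c s where cs: "c\<^sup>2 + s\<^sup>2 = 1" "c * n + s * (- m) = 0" "s * q = 0"
    proof (cases "n = 0")
      case True then show ?thesis using that[of 1 0] by simp
    next
      case False
      then have "q = 0" using J by simp
      then show ?thesis using ex_rotation_orthogonal[of n "- m"] that by auto
    qed
    have "T_basis T \<xi> a2 a1 (c *\<^sub>R e' + s *\<^sub>R f') (c *\<^sub>R f' - s *\<^sub>R e') e f"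
      by (rule T_basis_rotate[OF T_basis_swap[OF t] cs(1)])
    then have "onb5 (c *\<^sub>R e' + s *\<^sub>R f') (c *\<^sub>R f' - s *\<^sub>R e') e f \<xi>" by (simp add: T_basis_def)
    moreover have "q *\<^sub>R f' = (c * q) *\<^sub>R (c *\<^sub>R f' - s *\<^sub>R e')"
      using cs by (cases "q = 0") (auto simp: power2_eq_square)
    ultimately have "prod_form \<xi> a2 a1 (c * q) 0 (c * m + s * n)"
    proof (intro prod_formI)
      assume q: "q *\<^sub>R f' = (c * q) *\<^sub>R (c *\<^sub>R f' - s *\<^sub>R e')"
      show "br (c *\<^sub>R e' + s *\<^sub>R f') (c *\<^sub>R f' - s *\<^sub>R e') =
          (c * q) *\<^sub>R (c *\<^sub>R f' - s *\<^sub>R e') + (2 / a2) *\<^sub>R \<xi>"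
        unfolding br_rotate[OF cs(1)] B q ..
    qed (use a B B' z cs in \<open>auto simp: br_lin algebra_simps simp flip: scaleR_left_distrib\<close>)
    then show ?thesis by blast
  qed
qed

end

section \<open>The Kaehler case\<close>

text \<open>A rotation of a plane acts on symmetric forms through the doubled angle, so a condition
  on the doubled angle has to be halved.\<close>

lemma ex_half_angle:
  fixes C S :: real
  assumes "C\<^sup>2 + S\<^sup>2 = 1"
  shows "\<exists>c s. c\<^sup>2 + s\<^sup>2 = 1 \<and> c\<^sup>2 - s\<^sup>2 = C \<and> 2 * c * s = S"
proof -
  obtain t where "C = cos t" "S = sin t" using sincos_total_2pi[OF assms] by metis
  then show ?thesis
    using cos_double[of "t / 2"] sin_double[of "t / 2"]
    by (intro exI[of _ "cos (t / 2)"] exI[of _ "sin (t / 2)"]) simp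
qed

text \<open>The two conditions are orthogonality of one unit vector (C, S) to (A, B) and to (A',
  B'), which are linearly dependent by assumption. If (A, B) = 0, the vector must be chosen from the
  other pair.\<close>

lemma ex_rotation_common:
  fixes A B A' B' :: real
  assumes "A * B' = A' * B"
  shows "\<exists>c s. c\<^sup>2 + s\<^sup>2 = 1 \<and> A * (c\<^sup>2 - s\<^sup>2) + B * (2 * c * s) = 0 \<and>
    A' * (c\<^sup>2 - s\<^sup>2) + B' * (2 * c * s) = 0"
proof -
  have "\<exists>C S. C\<^sup>2 + S\<^sup>2 = 1 \<and> C * A + S * B = 0 \<and> C * A' + S * B' = 0"
  proof (cases "A = 0 \<and> B = 0")
    case True
    then show ?thesis using ex_rotation_orthogonal[of A' B'] by auto
  next
    case False
    obtain C S where CS: "C\<^sup>2 + S\<^sup>2 = 1" "C * A + S * B = 0"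
      using ex_rotation_orthogonal by blast
    have "A * (C * A' + S * B') = 0" "B * (C * A' + S * B') = 0"
      using CS(2) assms by algebra+
    then show ?thesis using CS False by auto
  qed
  then show ?thesis using ex_half_angle by (metis mult.commute)
qed

lemma ex_rotation_isotropic:
  fixes A B :: real
  shows "\<exists>c s. c\<^sup>2 + s\<^sup>2 = 1 \<and> A * (c\<^sup>2 - s\<^sup>2) + B * (2 * c * s) = 0"
  using ex_rotation_common[of A B A B] by blast

text \<open>For the 1-form $\alpha=\langle n,\cdot\rangle$ the left-hand side below is the coefficient of
  $d\alpha\wedge d\alpha=d(\alpha\wedge d\alpha)$, and 3-forms on a unimodular algebra of dimension four are closed.\<close>

lemma pfaffian_identity:
  fixes n0 n1 n2 n3 :: real and c :: "nat \<Rightarrow> nat \<Rightarrow> nat \<Rightarrow> real"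
  defines "A i j \<equiv> n0 * c i j 0 + n1 * c i j 1 + n2 * c i j 2 + n3 * c i j 3"
  assumes skew: "\<And>i j k. i > j \<Longrightarrow> c i j k = - c j i k" "\<And>i k. c i i k = 0"
    and jac: "\<And>i j k. c j k 0 * A i 0 + c j k 1 * A i 1 + c j k 2 * A i 2 + c j k 3 * A i 3 +
       (c k i 0 * A j 0 + c k i 1 * A j 1 + c k i 2 * A j 2 + c k i 3 * A j 3) +
       (c i j 0 * A k 0 + c i j 1 * A k 1 + c i j 2 * A k 2 + c i j 3 * A k 3) = 0"
    and unimodular: "\<And>i. c i 0 0 + c i 1 1 + c i 2 2 + c i 3 3 = 0"
  shows "A 0 1 * A 2 3 - A 0 2 * A 1 3 + A 0 3 * A 1 2 = 0"
proof -
  define J where "J i j k = c j k 0 * A i 0 + c j k 1 * A i 1 + c j k 2 * A i 2 + c j k 3 * A i 3 +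
       (c k i 0 * A j 0 + c k i 1 * A j 1 + c k i 2 * A j 2 + c k i 3 * A j 3) +
       (c i j 0 * A k 0 + c i j 1 * A k 1 + c i j 2 * A k 2 + c i j 3 * A k 3)" for i j k
  define t where "t i = c i 0 0 + c i 1 1 + c i 2 2 + c i 3 3" for i
  have sk: "c 1 0 k = - c 0 1 k" "c 2 0 k = - c 0 2 k" "c 3 0 k = - c 0 3 k"
    "c 2 1 k = - c 1 2 k" "c 3 1 k = - c 1 3 k" "c 3 2 k = - c 2 3 k" for k
    by (rule skew(1); simp)+
  \<comment> \<open>The expansion of d(alpha wedge d alpha). The sums \<open>J\<close> are the
    values of d d alpha, weighted by alpha; the trace \<open>t i\<close> multiplies the value of
    alpha wedge A on the other three indices, up to sign.\<close>
  have "2 * (A 0 1 * A 2 3 - A 0 2 * A 1 3 + A 0 3 * A 1 2) =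
    - n0 * J 1 2 3 + n1 * J 0 2 3 - n2 * J 0 1 3 + n3 * J 0 1 2
    + t 0 * (n1 * A 2 3 + n2 * A 3 1 + n3 * A 1 2) - t 1 * (n0 * A 2 3 + n2 * A 3 0 + n3 * A 0 2)
    + t 2 * (n0 * A 1 3 + n1 * A 3 0 + n3 * A 0 1) - t 3 * (n0 * A 1 2 + n1 * A 2 0 + n2 * A 0 1)"
    unfolding J_def t_def A_def sk skew(2) by algebra
  moreover have "J i j k = 0" "t i = 0" for i j k
    using jac unimodular by (simp_all add: J_def t_def)
  ultimately show ?thesis by simp
qed

text \<open>The Jacobi equations of \<open>kaehler_case\<close> for non-zero q. They leave only the
  abelian family: another solution would satisfy both 5(p + u) = 3v and p + u = 7v with v
  non-zero.\<close>

lemma kaehler_equations_q: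
  fixes p q u r v w y m2 m3 :: real
  assumes "q \<noteq> 0" and m3: "m3 * q = 0"
    and J2: "m2 * w + m3 * (u - v - y) + q * w = 0"
    and J4: "w * q = r * q" and J5: "y * (- 2 * w - r) = p * w + r * (u - v - y)"
    and J6: "2 * w * r + y * (v - p - u) = 0" and J7: "q * (3 * v + y) = 0"
    and J8: "q\<^sup>2 + (u - v - y) * u - w * (- 2 * w - r) =
      p * (u - v - y) + q * m2 + (- 2 * w - r) * w + v * (u - v - y)"
    and J10: "(u + v) * p + m2 * q = q\<^sup>2 + (u + v)\<^sup>2"
    and J11: "(u + v) * q + m3 * (- 2 * w - r) = q * (u - v - y) + v * m2"
  shows "m3 = 0 \<and> w = 0 \<and> r = 0 \<and> v = 0 \<and> y = 0 \<and> q\<^sup>2 + u\<^sup>2 = q * m2 + u * p"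
proof -
  have z: "m3 = 0" "r = w" "y = - 3 * v" using assms by auto
  have a: "(m2 + q) * w = 0" "(m2 + q) * v = 0" "w * (7 * v - p - u) = 0"
      "2 * w\<^sup>2 = 3 * v * (v - p - u)"
    using J2 J11 J5 J6 unfolding z by algebra+
  have "v = 0 \<and> w = 0"
  proof (rule ccontr)
    assume n: "\<not> (v = 0 \<and> w = 0)"
    then have m: "m2 = - q" using a(1,2) by auto
    have "v \<noteq> 0" using n a(4) by auto
    have "v * (3 * v - 5 * (p + u)) = 0"
      using J8 J10 a(4) unfolding z m by algebra
    then have s: "5 * (p + u) = 3 * v" using \<open>v \<noteq> 0\<close> by simp
    then have "5 * w\<^sup>2 = 3 * v\<^sup>2" using a(4) by algebra
    then have "w \<noteq> 0" using \<open>v \<noteq> 0\<close> by auto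
    then have "7 * v = p + u" using a(3) by auto
    then show False using s \<open>v \<noteq> 0\<close> by auto
  qed
  then show ?thesis using z J8 by (simp add: power2_eq_square algebra_simps)
qed

text \<open>The Jacobi equations of \<open>kaehler_case\<close> for q = w = 0. The disjuncts lead,
  in order, to \<open>d42_form\<close> (twice, related by a quarter turn of the e', f' plane), to
  the abelian family (twice, related in the same way), to two products, to \<open>d4_form\<close>
  and to a last product.\<close>

lemma kaehler_equations_0:
  fixes p u r v y m2 m3 :: real
  defines "z \<equiv> u - v - y"
  assumes "m3 * z = 0" "m2 * y = 0" "- (y * r) = r * z" "y * (v - p - u) = 0" "z * (u - p - v) = 0"
    "(u + v) * (p - u - v) = 0" "- (m3 * r) = v * m2" "m2 * r = u * m3"
  shows "(p \<noteq> 0 \<and> y = - p \<and> u = - p / 2 \<and> v = p / 2 \<and> m2 = 0 \<and> m3 = 0 \<and> r = 0) \<or>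
    (p \<noteq> 0 \<and> y = 0 \<and> u = p / 2 \<and> v = - p / 2 \<and> m2 = 0 \<and> m3 = 0 \<and> r = 0) \<or>
    (y = - p \<and> u = 0 \<and> v = p \<and> r = 0 \<and> m2 = 0) \<or>
    (y = 0 \<and> u = p \<and> v = 0 \<and> r = 0 \<and> m3 = 0) \<or>
    (p = 0 \<and> u = 0 \<and> v = 0 \<and> m2 = 0 \<and> m3 = 0) \<or>
    (y = 0 \<and> u = 0 \<and> v = 0 \<and> m2 = 0 \<and> m3 = 0) \<or>
    (p \<noteq> 0 \<and> y = 0 \<and> u = p / 2 \<and> v = p / 2 \<and> m2 = 0 \<and> m3 = 0) \<or>
    (y = 0 \<and> u = 0 \<and> v = 0 \<and> r = 0)"
\<comment> \<open>By the definition of z, the equation \<open>- (y * r) = r * z\<close> says r (u -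
  v) = 0.\<close>
proof (cases "u = v")
  case False
  have "r * (u - v) = 0" using assms(4) unfolding z_def by algebra
  then have r: "r = 0" using False by simp
  then have m: "v * m2 = 0" "u * m3 = 0" using assms by auto
  have uv: "u + v = 0 \<or> u + v = p" using assms(7) by auto
  show ?thesis
  proof (cases "y = 0")
    case True
    then have "z \<noteq> 0" using False by (simp add: z_def)
    then have u: "u = p + v" "m3 = 0" using assms(2,6) by auto
    have "v = 0 \<or> 2 * v = - p" using uv u by auto
    then show ?thesis using True r m u False by auto
  next
    case y: False
    then have v: "v = p + u" "m2 = 0" using assms(3,5) by auto
    then have "z * p = 0" using assms(6) by auto
    moreover have "p \<noteq> 0" using v False by auto
    ultimately have "z = 0" by simp
    then have y': "y = - p" using v by (simp add: z_def)
    have "u = 0 \<or> 2 * u = - p" using uv v by auto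
    then show ?thesis using r m v y' \<open>p \<noteq> 0\<close> by auto
  qed
next
  case True
  then have z: "z = - y" by (simp add: z_def)
  have yp: "y = 0 \<or> p = 0" using assms(5) True by auto
  have u: "u = 0 \<or> p = 2 * u" using assms(7) True by auto
  show ?thesis
  proof (cases "y = 0")
    case y: False
    then have "p = 0" "u = 0" using yp u by auto
    moreover have "m2 = 0" "m3 = 0" using y z assms(2,3) by auto
    ultimately show ?thesis using True by auto
  next
    case y: True
    have e: "u * m2 + m3 * r = 0" "m2 * r - u * m3 = 0" using assms(8,9) True by auto
    \<comment> \<open>By \<open>e\<close>, the vector (m2, m3) is annihilated by a matrix of
      determinant -(u^2 + r^2).\<close>
    have "m2 * (u\<^sup>2 + r\<^sup>2) = u * (u * m2 + m3 * r) + r * (m2 * r - u * m3)"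
      "m3 * (u\<^sup>2 + r\<^sup>2) = r * (u * m2 + m3 * r) - u * (m2 * r - u * m3)"
      by algebra+
    then have "m2 * (u\<^sup>2 + r\<^sup>2) = 0" "m3 * (u\<^sup>2 + r\<^sup>2) = 0" by (simp_all add: e)
    then have "m2 = 0 \<and> m3 = 0 \<or> u = 0 \<and> r = 0"
      by (metis mult_eq_0_iff sum_power2_eq_zero_iff)
    moreover have "u = 0 \<and> v = 0 \<or> p \<noteq> 0 \<and> u = p / 2 \<and> v = p / 2"
      using u True by (cases "u = 0") auto
    ultimately show ?thesis using y by metis
  qed
qed

section \<open>A unit vector orthogonal to all brackets\<close>

context metric_lie5
begin

text \<open>The four vectors may be dependent, so the Gram-Schmidt step above does not apply
  directly. In coordinates their span has dimension at most four and is proper.\<close>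

lemma ex_orthogonal_4: "\<exists>n. g n n = 1 \<and> g n v1 = 0 \<and> g n v2 = 0 \<and> g n v3 = 0 \<and> g n v4 = 0"
proof -
  obtain b where b: "onb b" using ex_onb by blast
  define \<psi> :: "real ^ frame \<Rightarrow> 'a" where "\<psi> v = (\<Sum>i\<in>UNIV. v $ i *\<^sub>R b i)" for v
  have b': "g (b i) (b j) = (if i = j then 1 else 0)" for i j using b by (simp add: onb_def)
  have g\<psi>: "g (\<psi> v) (\<psi> w) = v \<bullet> w" for v w
    by (simp add: \<psi>_def linear_sum[OF linear_g_left]
        linear_sum[OF linear_g_right] g_lin b' if_distrib inner_vec_def mult.commute cong: if_cong)
  have "\<exists>v. x = \<psi> v" for x
    using onb_expand[OF b, of x] by (intro exI[of _ "\<chi> i. g x (b i)"]) (simp add: \<psi>_def)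
  then obtain w1 w2 w3 w4 where w: "v1 = \<psi> w1" "v2 = \<psi> w2" "v3 = \<psi> w3" "v4 = \<psi> w4" by metis
  have "dim {w1, w2, w3, w4} \<le> card {w1, w2, w3, w4}" by (rule dim_le_card) (auto intro: span_base)
  also have "\<dots> \<le> 4" by (simp add: card_insert_if)
  also have "\<dots> < DIM(real ^ frame)" by (simp add: UNIV_frame)
  finally obtain x where x: "x \<noteq> 0" "\<And>y. y \<in> span {w1, w2, w3, w4} \<Longrightarrow> orthogonal x y"
    using orthogonal_to_subspace_exists by metis
  define n where "n = \<psi> ((1 / norm x) *\<^sub>R x)"
  have "x \<bullet> y = 0" if "y \<in> {w1, w2, w3, w4}" for y
    using x(2)[OF span_base[OF that]] by (simp add: orthogonal_def)
  then have "g n v1 = 0 \<and> g n v2 = 0 \<and> g n v3 = 0 \<and> g n v4 = 0" by (simp add: n_def w g\<psi>)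
  moreover have "g n n = 1" using x(1) by (simp add: n_def g\<psi> dot_square_norm power2_eq_square)
  ultimately show ?thesis by blast
qed

definition ad_trace :: "(frame \<Rightarrow> 'a) \<Rightarrow> 'a \<Rightarrow> real" where
  "ad_trace b x = (\<Sum>i\<in>UNIV. g (br x (b i)) (b i))"

text \<open>ad [x, y] is the commutator of ad x and ad y, and a commutator has trace zero.\<close>

lemma ad_trace_br:
  assumes "onb b" shows "ad_trace b (br x y) = 0"
proof -
  have comp: "g (br x (br y (b i))) (b i) =
      (\<Sum>j\<in>UNIV. g (br y (b i)) (b j) * g (br x (b j)) (b i))" for x y i
    by (subst onb_expand[OF assms, of "br y (b i)"])
      (simp add: linear_sum[OF linear_br_right] linear_sum[OF linear_g_left] br_lin g_lin)
  have "(\<Sum>i\<in>UNIV. g (br x (br y (b i))) (b i)) = (\<Sum>i\<in>UNIV. g (br y (br x (b i))) (b i))"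
    unfolding comp by (subst sum.swap) (simp add: mult.commute)
  moreover have "g (br (br x y) (b i)) (b i) =
      g (br x (br y (b i))) (b i) - g (br y (br x (b i))) (b i)" for i
    using jacobi_g[of x y "b i" "b i"] br_skew[of "br x y" "b i"] br_skew[of x "b i"]
    by (simp add: br_lin g_lin)
  ultimately show ?thesis by (simp add: ad_trace_def sum_subtractf)
qed

lemma linear_ad_trace: "linear (ad_trace b)"
  by (auto simp: ad_trace_def br_lin g_lin sum.distrib sum_distrib_left intro!: linearI)

end

context unit_cky
begin

text \<open>If the trace form of the adjoint representation is nonzero, it vanishes on brackets. If it is zero,
  four dimensions leave a 1-form $\alpha\neq0$ with $d\alpha$ anti-self-dual, and
  $d\alpha\wedge d\alpha=0$ forces $d\alpha=0$.\<close>

lemma ex_closed: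
  "\<exists>n. g n n = 1 \<and> g n \<xi> = 0 \<and> (\<forall>x y. g n (br x y) = 0)"
proof -
  obtain e f e' f' where o: "onb5 e f e' f' \<xi>" using onb5_extend[OF unit] by blast
  define b where "b = case_frame e f e' f' \<xi>"
  have b: "onb b" using o by (simp add: b_def onb5_def)
  obtain t where t: "\<And>z. g t z = ad_trace b z" using riesz[OF linear_ad_trace] by blast
  show ?thesis
  proof (cases "t = 0")
    case False
    then have p: "g t t > 0" by (rule g_pos)
    have "g ((1 / sqrt (g t t)) *\<^sub>R t) ((1 / sqrt (g t t)) *\<^sub>R t) = 1"
      using p by (simp add: g_lin del: g_self_eq_0)
    moreover have "g t \<xi> = 0" unfolding t by (simp add: ad_trace_def g_lin)
    ultimately show ?thesis
      using t ad_trace_br[OF b] by (intro exI[of _ "(1 / sqrt (g t t)) *\<^sub>R t"]) (simp add: g_lin)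
  next
    case True
    then have unimodular: "g (br x e) e + g (br x f) f + g (br x e') e' + g (br x f') f' = 0" for x
      using t[of x] by (simp add: g_lin ad_trace_def b_def sum_frame)
    \<comment> \<open>The three self-dual components of d alpha are linear in n. Together with
      orthogonality to xi they are four conditions in dimension five. On a solution the Pfaffian
      below is minus a sum of three squares.\<close>
    obtain n where n: "g n n = 1" "g n \<xi> = 0" "g n (br e f + br e' f') = 0"
      "g n (br e e' - br f f') = 0" "g n (br e f' + br f e') = 0"
      using ex_orthogonal_4 by blast
    define B where "B = (\<lambda>i::nat. if i = 0 then e else if i = 1 then f else if i = 2 then e' else f')"
    define c where "c i j k = g (br (B i) (B j)) (B k)" for i j k
    have B: "B 0 = e" "B 1 = f" "B (Suc 0) = f" "B 2 = e'" "B 3 = f'" by (simp_all add: B_def)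
    have A: "g n (br (B i) (B j)) =
        g n e * c i j 0 + g n f * c i j 1 + g n e' * c i j 2 + g n f' * c i j 3" for i j
      by (subst onb5_expand[OF o, of "br (B i) (B j)"]) (simp add: c_def B g_lin n)
    have "g n (br (B 0) (B 1)) * g n (br (B 2) (B 3)) - g n (br (B 0) (B 2)) * g n (br (B 1) (B 3))
        + g n (br (B 0) (B 3)) * g n (br (B 1) (B 2)) = 0"
      unfolding A
    proof (rule pfaffian_identity, fold A)
      show "c i j k = - c j i k" for i j k
        using br_skew[of "B i" "B j"] by (simp add: c_def g_lin)
      show "c i i k = 0" for i k by (simp add: c_def g_lin)
      have ex: "c j k 0 * g n (br (B i) (B 0)) + c j k 1 * g n (br (B i) (B 1)) +
          c j k 2 * g n (br (B i) (B 2)) + c j k 3 * g n (br (B i) (B 3)) =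
          g n (br (B i) (br (B j) (B k)))" for i j k
        by (subst onb5_expand[OF o, of "br (B j) (B k)"]) (simp add: c_def B g_lin br_lin)
      show "c j k 0 * g n (br (B i) (B 0)) + c j k 1 * g n (br (B i) (B 1)) +
          c j k 2 * g n (br (B i) (B 2)) + c j k 3 * g n (br (B i) (B 3)) +
        (c k i 0 * g n (br (B j) (B 0)) + c k i 1 * g n (br (B j) (B 1)) +
          c k i 2 * g n (br (B j) (B 2)) + c k i 3 * g n (br (B j) (B 3))) +
        (c i j 0 * g n (br (B k) (B 0)) + c i j 1 * g n (br (B k) (B 1)) +
          c i j 2 * g n (br (B k) (B 2)) + c i j 3 * g n (br (B k) (B 3))) = 0" for i j k
        unfolding ex using jacobi_g[of "B i" "B j" "B k" n] by (simp add: g_sym)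
      show "c i 0 0 + c i 1 1 + c i 2 2 + c i 3 3 = 0" for i
        using unimodular[of "B i"] by (simp add: c_def B)
    qed
    then have "(g n (br e f))\<^sup>2 + (g n (br e e'))\<^sup>2 + (g n (br e f'))\<^sup>2 = 0"
      using n(3-5) unfolding B g_lin by algebra
    then have "(g n (br e f))\<^sup>2 = 0 \<and> (g n (br e e'))\<^sup>2 = 0 \<and> (g n (br e f'))\<^sup>2 = 0"
      by (smt (verit) zero_le_power2)
    then have z: "g n (br e f) = 0" "g n (br e e') = 0" "g n (br e f') = 0"
      "g n (br e' f') = 0" "g n (br f f') = 0" "g n (br f e') = 0"
      using n(3-5) by (auto simp: g_lin)
    note z' = z br_skew[of f e] br_skew[of e' e] br_skew[of f' e] br_skew[of f' e']
      br_skew[of f' f] br_skew[of e' f]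
    have "g n (br x y) = 0" for x y
    proof -
      have "g n (br (g x e *\<^sub>R e + g x f *\<^sub>R f + g x e' *\<^sub>R e' + g x f' *\<^sub>R f' + g x \<xi> *\<^sub>R \<xi>)
        (g y e *\<^sub>R e + g y f *\<^sub>R f + g y e' *\<^sub>R e' + g y f' *\<^sub>R f' + g y \<xi> *\<^sub>R \<xi>)) = 0"
        by (simp add: br_lin g_lin z')
      then show ?thesis using onb5_expand[OF o, of x] onb5_expand[OF o, of y] by simp
    qed
    then show ?thesis using n by blast
  qed
qed

lemma T_basis_rotate2:
  assumes "T_basis T \<xi> a1 a2 e f e' f'" "c\<^sup>2 + s\<^sup>2 = 1"
  shows "T_basis T \<xi> a1 a2 e f (c *\<^sub>R e' + s *\<^sub>R f') (c *\<^sub>R f' - s *\<^sub>R e')"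
  by (rule T_basis_swap[OF T_basis_rotate[OF T_basis_swap[OF assms(1)] assms(2)]])

lemma T_square:
  assumes "T_basis T \<xi> c c e f e' f'" "g x \<xi> = 0"
  shows "T (T x) = - (c\<^sup>2 *\<^sub>R x)"
proof -
  have o: "onb5 e f e' f' \<xi>" and T: "T e = c *\<^sub>R f" "T f = - (c *\<^sub>R e)"
    "T e' = c *\<^sub>R f'" "T f' = - (c *\<^sub>R e')" using assms by (auto simp: T_basis_def)
  have x: "x = g x e *\<^sub>R e + g x f *\<^sub>R f + g x e' *\<^sub>R e' + g x f' *\<^sub>R f'"
    using onb5_expand[OF o, of x] assms(2) by simp
  show ?thesis
    by (subst x, subst (5) x) (simp add: T_lin T power2_eq_square algebra_simps)
qed

text \<open>With equal eigenvalues, J = T / c is an orthogonal complex structure on the complement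
  of xi, so any unit vector there starts an adapted basis e, Je, e', Je'.\<close>

lemma T_basis_through:
  assumes t: "T_basis T \<xi> c c e0 f0 e0' f0'" and e: "g e e = 1" "g e \<xi> = 0"
  shows "\<exists>f e' f'. T_basis T \<xi> c c e f e' f'"
proof -
  have c: "c > 0" using t by (simp add: T_basis_def)
  define J where "J x = (1 / c) *\<^sub>R T x" for x
  have J: "g (J x) x = 0" "g x (J x) = 0" "g (J x) \<xi> = 0" "T x = c *\<^sub>R J x" for x
    using c by (simp_all add: J_def g_lin T_self T_perp)
  have JJ: "T (J x) = - (c *\<^sub>R x)" "g (J x) (J x) = g x x" if "g x \<xi> = 0" for x
    using T_square[OF t that] c T_skew[of x "T x"]
    by (simp_all add: J_def T_lin g_lin power2_eq_square)
  have J_skew: "g (J x) y = - g x (J y)" for x y by (simp add: J_def g_lin T_skew)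
  have J_J: "J (J x) = - x" if "g x \<xi> = 0" for x using JJ(1)[OF that] c J_def[of "J x"] by simp
  obtain e' f'' where o: "onb5 e (J e) e' f'' \<xi>"
    using onb5_extend3[OF unit e, of "J e"] J JJ e by auto
  note oD = onb5_D[OF o]
  have "g (J e') e = 0" "g (J e') (J e) = 0"
    using J_skew[of e' e] J_skew[of e' "J e"] J_J[of e] c oD e by (simp_all add: g_lin)
  then have "g e (J e') = 0" "g (J e) (J e') = 0" using g_sym by metis+
  then have "onb5 e (J e) e' (J e') \<xi>"
    using oD J(2,3) JJ(2)[of e'] by (simp add: onb5_iff)
  then have "T_basis T \<xi> c c e (J e) e' (J e')"
    unfolding T_basis_def using c JJ(1)[of e] JJ(1)[of e'] oD J(4)[of e] J(4)[of e'] by blast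
  then show ?thesis by blast
qed

text \<open>The connection commutes with J. Testing this on the pairs e, e' and e, f' for each of
  the four directions x gives the eight relations \<open>K8\<close>. They are solved for eight of
  the 18 structure constants that remain after the e-components have vanished.\<close>

lemma kaehler_brackets:
  assumes t: "T_basis T \<xi> c c e f e' f'" and closed: "\<And>x y. g e (br x y) = 0"
  shows "\<exists>p q k u r v w y m2 m3.
    br e f = p *\<^sub>R f + q *\<^sub>R e' + k *\<^sub>R f' + (2 / c) *\<^sub>R \<xi> \<and>
    br e e' = q *\<^sub>R f + u *\<^sub>R e' + r *\<^sub>R f' \<and>
    br e f' = k *\<^sub>R f + (- 2 * w - r) *\<^sub>R e' + v *\<^sub>R f' \<and>
    br f e' = - (k *\<^sub>R f) + w *\<^sub>R e' + y *\<^sub>R f' \<and>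
    br f f' = q *\<^sub>R f + (u - v - y) *\<^sub>R e' - w *\<^sub>R f' \<and>
    br e' f' = (u + v) *\<^sub>R f + m2 *\<^sub>R e' + m3 *\<^sub>R f' + (2 / c) *\<^sub>R \<xi>"
proof -
  have o: "onb5 e f e' f' \<xi>" and c: "c > 0" and T: "T e = c *\<^sub>R f" "T f = - (c *\<^sub>R e)"
    "T e' = c *\<^sub>R f'" "T f' = - (c *\<^sub>R e')" using t by (auto simp: T_basis_def)
  note oD = onb5_D[OF o]
  have K: "koszul x f e' + koszul x e f' = 0" "koszul x f f' - koszul x e e' = 0"
    if "g x \<xi> = 0" for x
  proof -
    have "c * (koszul x f e' + koszul x e f') = 0" "c * (koszul x f f' - koszul x e e') = 0"
      using parallel[of x e e'] parallel[of x e f'] that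
      by (simp_all add: T koszul_lin koszul_neg_zero oD algebra_simps)
    then show "koszul x f e' + koszul x e f' = 0" "koszul x f f' - koszul x e e' = 0"
      using c by auto
  qed
  have cl: "g (br x y) e = 0" for x y using closed g_sym by metis
  note sk = br_skew[of e f] br_skew[of e e'] br_skew[of e f'] br_skew[of f e'] br_skew[of f f']
    br_skew[of e' f']
  note K8 = K(1)[OF oD(9)] K(1)[OF oD(12)] K(1)[OF oD(14)] K(1)[OF oD(15)]
    K(2)[OF oD(9)] K(2)[OF oD(12)] K(2)[OF oD(14)] K(2)[OF oD(15)]
  have L: "g (br e e') f = g (br e f) e'" "g (br e f') f = g (br e f) f'"
    "g (br e f') e' = - 2 * g (br f e') e' - g (br e e') f'" "g (br f e') f = - g (br e f) f'"
    "g (br f f') f = g (br e f) e'" "g (br f f') e' = g (br e e') e' - g (br e f') f' - g (br f e') f'"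
    "g (br f f') f' = - g (br f e') e'" "g (br e' f') f = g (br e e') e' + g (br e f') f'"
    using K8 unfolding koszul_def by (simp_all add: sk g_lin cl)
  show ?thesis
    using onb5_expand[OF o, of "br e f"] onb5_expand[OF o, of "br e' f'"]
      onb5_expand[OF o, of "br e e'"] onb5_expand[OF o, of "br e f'"]
      onb5_expand[OF o, of "br f e'"] onb5_expand[OF o, of "br f f'"] T_basis_br[OF t]
    by (simp add: cl L) metis
qed

end

section \<open>Solving the Jacobi identity in the Kaehler case\<close>

context unit_cky
begin

text \<open>Here \<open>f, e'\<close> span an abelian ideal on which $x\circ y=[-Jx,y]$ is commutative, associative and
  self-adjoint; the rotation diagonalises this product.\<close>

lemma abelian_case:
  assumes t: "T_basis T \<xi> a a e f e' f'" and m: "q\<^sup>2 + u\<^sup>2 = q * m + u * p"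
    and B: "br e f = p *\<^sub>R f + q *\<^sub>R e' + (2 / a) *\<^sub>R \<xi>" "br e e' = q *\<^sub>R f + u *\<^sub>R e'"
      "br f f' = q *\<^sub>R f + u *\<^sub>R e'" "br e' f' = u *\<^sub>R f + m *\<^sub>R e' + (2 / a) *\<^sub>R \<xi>"
      "br e f' = 0" "br f e' = 0"
  shows "\<exists>p q b. prod_form \<xi> a a p q b"
proof -
  have o: "onb5 e f e' f' \<xi>" and a: "a > 0" using t by (auto simp: T_basis_def)
  note oD = onb5_D[OF o]
  \<comment> \<open>The hypothesis \<open>m\<close> is associativity of the product. Rewritten this
    way, it is the compatibility condition of \<open>ex_rotation_common\<close>.\<close>
  have "q * ((m - q) / 2) = u * ((u - p) / 2)" using m by (simp add: power2_eq_square field_simps)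
  then obtain c s where cs: "c\<^sup>2 + s\<^sup>2 = 1"
    "q * (c\<^sup>2 - s\<^sup>2) + (u - p) / 2 * (2 * c * s) = 0"
    "u * (c\<^sup>2 - s\<^sup>2) + (m - q) / 2 * (2 * c * s) = 0"
    using ex_rotation_common by blast
  \<comment> \<open>These equations say that the product of F and F' is zero. By self-adjointness
    the square of F, with components k and l, is then a multiple of F, and likewise the square of
    F', with components k' and l', is a multiple of F'; this is \<open>kl\<close>.\<close>
  then have H: "q * (c\<^sup>2 - s\<^sup>2) + (u - p) * c * s = 0" "u * (c\<^sup>2 - s\<^sup>2) + (m - q) * c * s = 0"
    by simp_all
  define E F E' F' where "E = c *\<^sub>R e - s *\<^sub>R f'" and "F = c *\<^sub>R f + s *\<^sub>R e'"
    and "E' = c *\<^sub>R f' + s *\<^sub>R e" and "F' = s *\<^sub>R f - c *\<^sub>R e'"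
  define k l where "k = c\<^sup>2 * p + (c * s * q + c * s * q) + s\<^sup>2 * u"
    and "l = c\<^sup>2 * q + (c * s * u + c * s * u) + s\<^sup>2 * m"
  define k' l' where "k' = s\<^sup>2 * p - (c * s * q + c * s * q) + c\<^sup>2 * u"
    and "l' = s\<^sup>2 * q - (c * s * u + c * s * u) + c\<^sup>2 * m"
  have kl: "k = c * (c * k + s * l)" "l = s * (c * k + s * l)"
    "k' = s * (s * k' - c * l')" "l' = - (c * (s * k' - c * l'))"
    using cs(1) H unfolding k_def l_def k'_def l'_def by algebra+
  note B' = B B[THEN arg_cong[of _ _ uminus], folded br_skew]
  have EF: "br E F = k *\<^sub>R f + l *\<^sub>R e' + (2 / a) *\<^sub>R \<xi>"
  proof -
    have "br E F = k *\<^sub>R f + l *\<^sub>R e' + (c\<^sup>2 + s\<^sup>2) *\<^sub>R ((2 / a) *\<^sub>R \<xi>)"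
      unfolding E_def F_def
      by (rule eq_by_g) (simp add: br_lin B' k_def l_def g_lin algebra_simps power2_eq_square)
    then show ?thesis using cs by simp
  qed
  have EF': "br E' F' = k' *\<^sub>R f + l' *\<^sub>R e' + (2 / a) *\<^sub>R \<xi>"
  proof -
    have "br E' F' = k' *\<^sub>R f + l' *\<^sub>R e' + (c\<^sup>2 + s\<^sup>2) *\<^sub>R ((2 / a) *\<^sub>R \<xi>)"
      unfolding E'_def F'_def
      by (rule eq_by_g) (simp add: br_lin B' k'_def l'_def g_lin algebra_simps power2_eq_square)
    then show ?thesis using cs by simp
  qed
  have "prod_form \<xi> a a (c * k + s * l) (s * k' - c * l') 0"
  proof (rule prod_formI)
    show "onb5 E F E' F' \<xi>"
      using cs(1) unfolding E_def F_def E'_def F'_def onb5_iff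
      by (simp add: g_lin oD power2_eq_square algebra_simps)
    show "br E F = (c * k + s * l) *\<^sub>R F + (2 / a) *\<^sub>R \<xi>"
      unfolding EF using kl(1,2) by (simp add: F_def scaleR_add_right mult.commute)
    define M where "M = s * k' - c * l'"
    have "k' = s * M" "l' = - (c * M)" using kl(3,4) by (simp_all add: M_def)
    then have "k' *\<^sub>R f + l' *\<^sub>R e' = M *\<^sub>R F'"
      by (simp add: F'_def scaleR_diff_right mult.commute)
    then show "br E' F' = (s * k' - c * l') *\<^sub>R F' + (2 / a) *\<^sub>R \<xi>"
      unfolding EF' M_def[symmetric] by simp
    have H': "(q * (c\<^sup>2 - s\<^sup>2) + (u - p) * c * s) *\<^sub>R f + (u * (c\<^sup>2 - s\<^sup>2) + (m - q) * c * s) *\<^sub>R e' = 0"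
      by (simp only: H) simp
    show "br E F' = - (0 *\<^sub>R E')" "br F E' = 0"
      using H' unfolding E_def F_def E'_def F'_def
      by (simp_all add: br_lin B' algebra_simps power2_eq_square)
    show "br E E' = 0 *\<^sub>R F'" "br F F' = 0"
      unfolding E_def F_def E'_def F'_def by (simp_all add: br_lin B')
  qed (use a in auto)
  then show ?thesis by blast
qed

lemma kaehler_case:
  assumes t0: "T_basis T \<xi> c c e0 f0 e0' f0'"
  shows "(\<exists>p q b. prod_form \<xi> c c p q b) \<or> (\<exists>p r. d4_form \<xi> c p r) \<or> (\<exists>p. d42_form \<xi> c p)"
proof -
  have c: "c > 0" using t0 by (simp add: T_basis_def)
  obtain e where e: "g e e = 1" "g e \<xi> = 0" and closed: "\<And>x y. g e (br x y) = 0"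
    using ex_closed by blast
  obtain f e1 f1 where t1: "T_basis T \<xi> c c e f e1 f1" using T_basis_through[OF t0 e] by blast
  obtain C S where CS: "C\<^sup>2 + S\<^sup>2 = 1" "C * g (br e f) f1 + S * (- g (br e f) e1) = 0"
    using ex_rotation_orthogonal by blast
  define e2 f2 where "e2 = C *\<^sub>R e1 + S *\<^sub>R f1" and "f2 = C *\<^sub>R f1 - S *\<^sub>R e1"
  have t2: "T_basis T \<xi> c c e f e2 f2"
    unfolding e2_def f2_def by (rule T_basis_rotate2[OF t1 CS(1)])
  have k2: "g (br e f) f2 = 0" using CS(2) by (simp add: f2_def g_lin)
  \<comment> \<open>If \<open>[e, f]\<close> has no component in the plane of \<open>e2, f2\<close>, the rotation of that plane is
    still free and is used to make \<open>ad f\<close> off-diagonal there.\<close>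
  obtain e' f' where t: "T_basis T \<xi> c c e f e' f'" and k0: "g (br e f) f' = 0"
    and w0: "g (br e f) e' = 0 \<Longrightarrow> g (br f e') e' = 0"
  proof (cases "g (br e f) e2 = 0")
    case False
    then show ?thesis using that[OF t2 k2] by blast
  next
    case True
    obtain C' S' where CS': "C'\<^sup>2 + S'\<^sup>2 = 1"
      "g (br f e2) e2 * (C'\<^sup>2 - S'\<^sup>2) + ((g (br f e2) f2 + g (br f f2) e2) / 2) * (2 * C' * S') = 0"
      using ex_rotation_isotropic by blast
    then have iso: "g (br f e2) e2 * (C'\<^sup>2 - S'\<^sup>2) + (g (br f e2) f2 + g (br f f2) e2) * (C' * S') = 0"
      by simp
    have w: "g (br f f2) f2 = - g (br f e2) e2"
    proof -
      have "onb5 e f e2 f2 \<xi>" using t2 by (simp add: T_basis_def)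
      note oD = onb5_D[OF this]
      show ?thesis using kaehler_brackets[OF t2 closed] by (auto simp: g_lin oD)
    qed
    have "T_basis T \<xi> c c e f (C' *\<^sub>R e2 + S' *\<^sub>R f2) (C' *\<^sub>R f2 - S' *\<^sub>R e2)"
      by (rule T_basis_rotate2[OF t2 CS'(1)])
    moreover have "g (br e f) (C' *\<^sub>R f2 - S' *\<^sub>R e2) = 0" using k2 True by (simp add: g_lin)
    moreover have "g (br f (C' *\<^sub>R e2 + S' *\<^sub>R f2)) (C' *\<^sub>R e2 + S' *\<^sub>R f2) = 0"
      using iso w by (simp add: g_lin br_lin algebra_simps power2_eq_square)
    ultimately show ?thesis using that by blast
  qed
  have o: "onb5 e f e' f' \<xi>" using t by (simp add: T_basis_def)
  note oD = onb5_D[OF o]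
  obtain p q k u r v w y m2 m3 where B0:
    "br e f = p *\<^sub>R f + q *\<^sub>R e' + k *\<^sub>R f' + (2 / c) *\<^sub>R \<xi>"
    "br e e' = q *\<^sub>R f + u *\<^sub>R e' + r *\<^sub>R f'"
    "br e f' = k *\<^sub>R f + (- 2 * w - r) *\<^sub>R e' + v *\<^sub>R f'"
    "br f e' = - (k *\<^sub>R f) + w *\<^sub>R e' + y *\<^sub>R f'"
    "br f f' = q *\<^sub>R f + (u - v - y) *\<^sub>R e' - w *\<^sub>R f'"
    "br e' f' = (u + v) *\<^sub>R f + m2 *\<^sub>R e' + m3 *\<^sub>R f' + (2 / c) *\<^sub>R \<xi>"
    using kaehler_brackets[OF t closed] by blast
  have k: "k = 0" using k0 by (simp add: B0 g_lin oD)
  have w: "q = 0 \<Longrightarrow> w = 0" using w0 by (simp add: B0 g_lin oD)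
  define z where "z = u - v - y"
  define h where "h = - 2 * w - r"
  have B: "br e f = p *\<^sub>R f + q *\<^sub>R e' + (2 / c) *\<^sub>R \<xi>"
    "br e e' = q *\<^sub>R f + u *\<^sub>R e' + r *\<^sub>R f'" "br e f' = h *\<^sub>R e' + v *\<^sub>R f'"
    "br f e' = w *\<^sub>R e' + y *\<^sub>R f'" "br f f' = q *\<^sub>R f + z *\<^sub>R e' - w *\<^sub>R f'"
    "br e' f' = (u + v) *\<^sub>R f + m2 *\<^sub>R e' + m3 *\<^sub>R f' + (2 / c) *\<^sub>R \<xi>"
    by (simp_all add: B0 k z_def h_def)
  note B' = B B[THEN arg_cong[of _ _ uminus], folded br_skew]
  have J: "m3 * q = 0" "m2 * w + m3 * z + q * w = 0" "m2 * y - m3 * w + q * y = 0"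
    "w * q = r * q" "y * h = p * w + r * z" "2 * w * r + y * (v - p - u) = 0"
    "z * q = q * (u + v) + v * q"
    "q * q + z * u - w * h = p * z + q * m2 + h * w + v * z" "z * r - w * v = q * m3 - p * w + h * y - v * w"
    "(u + v) * p + m2 * q = q * q + u * (u + v) + v * (u + v)"
    "(u + v) * q + m3 * h = q * z + v * m2" "m2 * r = u * m3 - q * w"
    using jacobi_g[of f e' f' f] jacobi_g[of f e' f' e'] jacobi_g[of f e' f' f']
      jacobi_g[of e f e' f] jacobi_g[of e f e' e'] jacobi_g[of e f e' f']
      jacobi_g[of e f f' f] jacobi_g[of e f f' e'] jacobi_g[of e f f' f']
      jacobi_g[of e e' f' f] jacobi_g[of e e' f' e'] jacobi_g[of e e' f' f']
    by (simp_all add: B' br_lin g_lin oD algebra_simps)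
  show ?thesis
  proof (cases "q = 0")
    case False
    have "m3 = 0 \<and> w = 0 \<and> r = 0 \<and> v = 0 \<and> y = 0 \<and> q\<^sup>2 + u\<^sup>2 = q * m2 + u * p"
    proof (rule kaehler_equations_q[OF False])
      have "q * (u - v - y) = q * (u + 2 * v)" using J(7) by (simp add: z_def algebra_simps)
      then show "q * (3 * v + y) = 0" by (simp add: algebra_simps)
      show "(u + v) * p + m2 * q = q\<^sup>2 + (u + v)\<^sup>2" using J(10) by (simp add: power2_eq_square algebra_simps)
      show "2 * w * r + y * (v - p - u) = 0" by (rule J)
    qed (use J[unfolded z_def h_def] in \<open>simp_all add: power2_eq_square\<close>)
    then have "\<exists>p q b. prod_form \<xi> c c p q b"
      using B by (intro abelian_case[OF t, of q u m2 p]) (auto simp: z_def h_def)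
    then show ?thesis by blast
  next
    case q: True
    then have w: "w = 0" by (rule w)
    then have h: "h = - r" by (simp add: h_def)
    have "m3 * (u - v - y) = 0" "m2 * y = 0" "- (y * r) = r * (u - v - y)" "y * (v - p - u) = 0"
      "(u - v - y) * (u - p - v) = 0" "(u + v) * (p - u - v) = 0" "- (m3 * r) = v * m2"
      "m2 * r = u * m3"
      using J unfolding q w h z_def by (simp_all add: algebra_simps)
    from kaehler_equations_0[OF this] show ?thesis
    proof (elim disjE conjE)
      assume "p \<noteq> 0" "y = - p" "u = - p / 2" "v = p / 2" "m2 = 0" "m3 = 0" "r = 0"
      then have "d42_form \<xi> c p"
        using c by (intro d42_formI[OF o]) (auto simp: B q w h z_def)
      then show ?thesis by blast
    next
      assume "p \<noteq> 0" "y = 0" "u = p / 2" "v = - p / 2" "m2 = 0" "m3 = 0" "r = 0"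
      moreover have "onb5 e f f' (- e') \<xi>" by (simp add: onb5_iff oD g_lin)
      ultimately have "d42_form \<xi> c p"
        using c by (intro d42_formI) (auto simp: B' q w h z_def br_lin)
      then show ?thesis by blast
    next
      assume z: "y = - p" "u = 0" "v = p" "r = 0" "m2 = 0"
      have "T_basis T \<xi> c c e f f' (- e')"
        using T_basis_rotate2[OF t, of 0 1] by simp
      then have "\<exists>p q b. prod_form \<xi> c c p q b"
        by (rule abelian_case[of c e f f' "- e'" 0 p m3 p])
          (auto simp: B' q w h z_def z br_lin power2_eq_square)
      then show ?thesis by blast
    next
      assume z: "y = 0" "u = p" "v = 0" "r = 0" "m3 = 0"
      have "\<exists>p q b. prod_form \<xi> c c p q b"
        by (rule abelian_case[OF t, of 0 p m2 p]) (auto simp: B q w h z_def z power2_eq_square)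
      then show ?thesis by blast
    next
      assume z: "p = 0" "u = 0" "v = 0" "m2 = 0" "m3 = 0"
      \<comment> \<open>Here ad e and ad f act on the plane of e', f' as rotations with coefficients
        r and y. Turning e, f moves the whole rotation to the first vector.\<close>
      obtain C S where CS: "C\<^sup>2 + S\<^sup>2 = 1" "C * y + S * (- r) = 0"
        using ex_rotation_orthogonal by blast
      have "T_basis T \<xi> c c (C *\<^sub>R e + S *\<^sub>R f) (C *\<^sub>R f - S *\<^sub>R e) e' f'"
        by (rule T_basis_rotate[OF t CS(1)])
      then have "onb5 (C *\<^sub>R e + S *\<^sub>R f) (C *\<^sub>R f - S *\<^sub>R e) e' f' \<xi>" by (simp add: T_basis_def)
      then have "prod_form \<xi> c c 0 0 (C * r + S * y)"
      proof (rule prod_formI)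
        show "br (C *\<^sub>R e + S *\<^sub>R f) (C *\<^sub>R f - S *\<^sub>R e) =
            0 *\<^sub>R (C *\<^sub>R f - S *\<^sub>R e) + (2 / c) *\<^sub>R \<xi>"
          using z q by (simp add: br_rotate[OF CS(1)] B)
      qed (use CS c in \<open>auto simp: br_lin B q w h z_def z algebra_simps simp flip: scaleR_left_distrib\<close>)
      then show ?thesis by blast
    next
      assume z: "y = 0" "u = 0" "v = 0" "m2 = 0" "m3 = 0"
      have "prod_form \<xi> c c p 0 r"
        using c by (intro prod_formI[OF o]) (auto simp: B q w h z_def z)
      then show ?thesis by blast
    next
      assume z: "p \<noteq> 0" "y = 0" "u = p / 2" "v = p / 2" "m2 = 0" "m3 = 0"
      have "d4_form \<xi> c p r"
        using c z(1) by (intro d4_formI[OF o]) (auto simp: B q w h z_def z)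
      then show ?thesis by blast
    next
      assume z: "y = 0" "u = 0" "v = 0" "r = 0"
      \<comment> \<open>The second plane is turned until the first of its new vectors is orthogonal
        to [e', f'].\<close>
      obtain C S where CS: "C\<^sup>2 + S\<^sup>2 = 1" "C * m2 + S * m3 = 0"
        using ex_rotation_orthogonal by blast
      have "T_basis T \<xi> c c e f (C *\<^sub>R e' + S *\<^sub>R f') (C *\<^sub>R f' - S *\<^sub>R e')"
        by (rule T_basis_rotate2[OF t CS(1)])
      then have "onb5 e f (C *\<^sub>R e' + S *\<^sub>R f') (C *\<^sub>R f' - S *\<^sub>R e') \<xi>" by (simp add: T_basis_def)
      moreover define l where "l = C * m3 - S * m2"
      ultimately have "prod_form \<xi> c c p l 0"
      proof (intro prod_formI)
        have m: "m2 = - (S * l)" "m3 = C * l"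
          using CS unfolding l_def by algebra+
        have "m2 *\<^sub>R e' + m3 *\<^sub>R f' = l *\<^sub>R (C *\<^sub>R f' - S *\<^sub>R e')"
          by (simp add: m scaleR_diff_right mult.commute)
        then show "br (C *\<^sub>R e' + S *\<^sub>R f') (C *\<^sub>R f' - S *\<^sub>R e') =
            l *\<^sub>R (C *\<^sub>R f' - S *\<^sub>R e') + (2 / c) *\<^sub>R \<xi>"
          unfolding br_rotate[OF CS(1)] B z by simp
      qed (use c in \<open>auto simp: br_lin B q w h z_def z\<close>)
      then show ?thesis by blast
    qed
  qed
qed

lemma ex_normal_form:
  "(\<exists>a1 a2 p q b. prod_form \<xi> a1 a2 p q b) \<or> (\<exists>c p r. d4_form \<xi> c p r) \<or> (\<exists>c p. d42_form \<xi> c p)"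
  using ex_T_basis product_case kaehler_case by metis

end

section \<open>From the models to the list\<close>

lemma axis_expand: "(\<Sum>i\<in>UNIV. v $ i *\<^sub>R axis i 1) = v" for v :: "real ^ frame"
  by (simp add: vec_eq_iff axis_def if_distrib cong: if_cong)

lemma bilinear_list_bracket: "admissible m \<Longrightarrow> bilinear (list_bracket m)"
  and bilinear_list_metric: "admissible m \<Longrightarrow> bilinear (list_metric m)"
  using metric_lie_algebra_list[of m]
  by (simp_all add: metric_lie_algebra_def lie_bracket_def inner_product_def)

lemma bilinear_expand:
  fixes h :: "real ^ frame \<Rightarrow> real ^ frame \<Rightarrow> 'b::real_vector"
  assumes "bilinear h"
  shows "h v w = (\<Sum>i\<in>UNIV. \<Sum>j\<in>UNIV. (v $ i * w $ j) *\<^sub>R h (axis i 1) (axis j 1))"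
proof -
  have l: "linear (\<lambda>x. h x y)" "linear (h x)" for x y using assms by (auto simp: bilinear_def)
  have "h v w = h (\<Sum>i\<in>UNIV. v $ i *\<^sub>R axis i 1) (\<Sum>j\<in>UNIV. w $ j *\<^sub>R axis j 1)"
    by (simp only: axis_expand)
  also have "\<dots> = (\<Sum>i\<in>UNIV. \<Sum>j\<in>UNIV. (v $ i * w $ j) *\<^sub>R h (axis i 1) (axis j 1))"
    by (simp add: linear_sum[OF l(1)] linear_sum[OF l(2)] linear_scale[OF l(1)]
        linear_scale[OF l(2)] scaleR_sum_right) (subst sum.swap, simp add: mult.commute)
  finally show ?thesis .
qed

context metric_lie5
begin

definition frame_map :: "(frame \<Rightarrow> 'a) \<Rightarrow> real ^ frame \<Rightarrow> 'a" where
  "frame_map \<beta> v = (\<Sum>i\<in>UNIV. v $ i *\<^sub>R \<beta> i)"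

text \<open>The images of the standard basis suffice. \<open>frame_map\<close> is injective because
  it preserves a positive metric, and surjective because the rescaled images form an orthonormal
  basis; the isomorphism sought is its inverse.\<close>

lemma isometrically_isomorphic_listI:
  assumes m: "admissible m"
    and G: "\<And>i j. g (\<beta> i) (\<beta> j) = list_metric m (axis i 1) (axis j 1)"
    and B: "\<And>i j. br (\<beta> i) (\<beta> j) = frame_map \<beta> (list_bracket m (axis i 1) (axis j 1))"
  shows "isometrically_isomorphic br g (list_bracket m) (list_metric m)"
proof -
  have pos: "list_metric m x x > 0" if "x \<noteq> 0" for x
    using metric_lie_algebra_list[OF m] that by (simp add: metric_lie_algebra_def inner_product_def)
  have lin: "linear (frame_map \<beta>)"
    by (auto simp: frame_map_def algebra_simps sum.distrib scaleR_sum_right intro!: linearI)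
  have g: "g (frame_map \<beta> v) (frame_map \<beta> w) = list_metric m v w" for v w
    unfolding bilinear_expand[OF bilinear_list_metric[OF m], of v w] frame_map_def
    by (simp add: linear_sum[OF linear_g_left] linear_sum[OF linear_g_right] g_lin G
        sum_distrib_left mult.assoc) (subst sum.swap, simp add: mult.left_commute)
  have b: "br (frame_map \<beta> v) (frame_map \<beta> w) = frame_map \<beta> (list_bracket m v w)" for v w
    unfolding bilinear_expand[OF bilinear_list_bracket[OF m], of v w]
      linear_sum[OF lin] linear_scale[OF lin] B[symmetric] unfolding frame_map_def
    by (simp add: linear_sum[OF linear_br_left] linear_sum[OF linear_br_right] br_lin
        scaleR_sum_right) (subst sum.swap, simp add: mult.commute)
  have inj: "inj (frame_map \<beta>)"
  proof (rule injI)
    fix v w assume "frame_map \<beta> v = frame_map \<beta> w"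
    then have "frame_map \<beta> (v - w) = 0" by (simp add: linear_diff[OF lin])
    then have "list_metric m (v - w) (v - w) = 0" using g[of "v - w" "v - w"] by (simp add: g_lin)
    then show "v = w" using pos[of "v - w"] by force
  qed
  define N where "N i = list_metric m (axis i 1) (axis i 1)" for i
  have N: "N i > 0" for i unfolding N_def by (rule pos) (simp add: axis_eq_0_iff)
  have off: "list_metric m (axis i 1) (axis j 1) = 0" if "i \<noteq> j" for i j
    using that by (cases i; cases j; simp add: list_metric_def axis_def)
  have onb: "onb (\<lambda>i. (1 / sqrt (N i)) *\<^sub>R \<beta> i)"
    unfolding onb_def
  proof (intro allI)
    fix i j
    show "g ((1 / sqrt (N i)) *\<^sub>R \<beta> i) ((1 / sqrt (N j)) *\<^sub>R \<beta> j) = (if i = j then 1 else 0)"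
      using N[of i] by (cases "i = j") (simp_all add: g_lin G off flip: N_def)
  qed
  have surj: "surj (frame_map \<beta>)"
  proof (rule surjI)
    fix x
    show "frame_map \<beta> (\<chi> i. g x ((1 / sqrt (N i)) *\<^sub>R \<beta> i) / sqrt (N i)) = x"
      using onb_expand[OF onb, of x] by (simp add: frame_map_def)
  qed
  define \<phi> where "\<phi> = inv (frame_map \<beta>)"
  have \<phi>: "frame_map \<beta> (\<phi> x) = x" "\<phi> (frame_map \<beta> v) = v" for x v
    using inj surj by (simp_all add: \<phi>_def surj_f_inv_f)
  have "linear \<phi>"
    by (rule linearI; rule injD[OF inj]) (simp_all add: \<phi> linear_add[OF lin] linear_scale[OF lin])
  moreover have "bij \<phi>" using bij_imp_bij_inv[OF bijI[OF inj surj]] by (simp add: \<phi>_def)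
  moreover have "\<phi> (br x y) = list_bracket m (\<phi> x) (\<phi> y)" for x y
    by (rule injD[OF inj]) (simp add: \<phi> flip: b)
  moreover have "list_metric m (\<phi> x) (\<phi> y) = g x y" for x y by (simp add: \<phi> flip: g)
  ultimately show ?thesis unfolding isometrically_isomorphic_def isometric_isomorphism_def by blast
qed

section \<open>Normalising the models and matching them with entries\<close>

lemma prod_form_flips:
  assumes "prod_form \<xi> a1 a2 p q b"
  shows "prod_form \<xi> (- a1) a2 (- p) q (- b)" "prod_form \<xi> (- a1) a2 p q b"
    "prod_form \<xi> a1 (- a2) p (- q) (- b)" "prod_form \<xi> a1 (- a2) p q (- b)"
    "prod_form (- \<xi>) (- a1) (- a2) p q b" "b = 0 \<Longrightarrow> prod_form \<xi> a2 a1 q p 0"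
proof -
  obtain e f e' f' where o: "onb5 e f e' f' \<xi>" and h: "\<And>y. br \<xi> y = 0"
     "a1 \<noteq> 0" "a2 \<noteq> 0" "q * b = 0" "br e f = p *\<^sub>R f + (2 / a1) *\<^sub>R \<xi>"
     "br e' f' = q *\<^sub>R f' + (2 / a2) *\<^sub>R \<xi>"
     "br e e' = b *\<^sub>R f'" "br e f' = - (b *\<^sub>R e')" "br f e' = 0" "br f f' = 0"
    using assms unfolding prod_form_def by blast
  have h': "br e' e = - (b *\<^sub>R f')" "br f' e = b *\<^sub>R e'" "br e' f = 0" "br f' f = 0"
    using h br_skew by (metis minus_minus minus_zero)+
  note oD = onb5_D[OF o]
  show "prod_form \<xi> (- a1) a2 (- p) q (- b)"
    by (rule prod_formI[of "- e" f e' f']) (auto simp: onb5_iff oD h g_lin br_lin)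
  show "prod_form \<xi> (- a1) a2 p q b"
    by (rule prod_formI[of e "- f" e' f']) (use h in \<open>auto simp: onb5_iff oD g_lin br_lin\<close>)
  show "prod_form \<xi> a1 (- a2) p (- q) (- b)"
    by (rule prod_formI[of e f "- e'" f']) (use h in \<open>auto simp: onb5_iff oD g_lin br_lin\<close>)
  show "prod_form \<xi> a1 (- a2) p q (- b)"
    by (rule prod_formI[of e f e' "- f'"]) (use h in \<open>auto simp: onb5_iff oD g_lin br_lin\<close>)
  show "prod_form (- \<xi>) (- a1) (- a2) p q b"
    by (rule prod_formI[of e f e' f']) (use h in \<open>auto simp: onb5_iff oD g_lin br_lin\<close>)
  show "prod_form \<xi> a2 a1 q p 0" if "b = 0"
    by (rule prod_formI[of e' f' e f]) (use h h' that in \<open>auto simp: onb5_iff oD g_lin br_lin\<close>)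
qed

text \<open>The reflections are applied in an order in which none undoes an earlier one: e for p, e'
  for q, f' for b, then xi for a2 and finally f for a1. The last two leave p, q and b alone.\<close>

lemma prod_form_signs:
  assumes "prod_form \<xi> a1 a2 p q b"
  shows "\<exists>\<xi> a1 a2. a1 > 0 \<and> a2 > 0 \<and> prod_form \<xi> a1 a2 \<bar>p\<bar> \<bar>q\<bar> \<bar>b\<bar>"
proof -
  have "\<exists>a1 a2 b'. prod_form \<xi> a1 a2 \<bar>p\<bar> q b' \<and> \<bar>b'\<bar> = \<bar>b\<bar>"
    using assms prod_form_flips(1)[OF assms] by (metis abs_if abs_minus_cancel)
  then obtain a1 a2 b1 where "prod_form \<xi> a1 a2 \<bar>p\<bar> q b1" "\<bar>b1\<bar> = \<bar>b\<bar>" by blast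
  then have "\<exists>a1 a2 b'. prod_form \<xi> a1 a2 \<bar>p\<bar> \<bar>q\<bar> b' \<and> \<bar>b'\<bar> = \<bar>b\<bar>"
    using prod_form_flips(3) by (metis abs_if abs_minus_cancel)
  then obtain a1 a2 b1 where "prod_form \<xi> a1 a2 \<bar>p\<bar> \<bar>q\<bar> b1" "\<bar>b1\<bar> = \<bar>b\<bar>" by blast
  then have "\<exists>a1 a2. prod_form \<xi> a1 a2 \<bar>p\<bar> \<bar>q\<bar> \<bar>b\<bar>"
    using prod_form_flips(4) by (metis abs_if)
  then obtain a1 a2 where P: "prod_form \<xi> a1 a2 \<bar>p\<bar> \<bar>q\<bar> \<bar>b\<bar>" by blast
  then have nz: "a1 \<noteq> 0" "a2 \<noteq> 0" by (auto simp: prod_form_def)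
  have "\<exists>\<xi> a1 a2. prod_form \<xi> a1 a2 \<bar>p\<bar> \<bar>q\<bar> \<bar>b\<bar> \<and> a2 > 0 \<and> a1 \<noteq> 0"
  proof (cases "a2 > 0")
    case True
    then show ?thesis using P nz by blast
  next
    case False
    then have "- a2 > 0" "- a1 \<noteq> 0" using nz by auto
    then show ?thesis using prod_form_flips(5)[OF P] by blast
  qed
  then obtain \<xi>' a1' a2' where P': "prod_form \<xi>' a1' a2' \<bar>p\<bar> \<bar>q\<bar> \<bar>b\<bar>" "a2' > 0" "a1' \<noteq> 0"
    by blast
  show ?thesis
  proof (cases "a1' > 0")
    case True
    then show ?thesis using P' by blast
  next
    case False
    then have "- a1' > 0" using P' by auto
    then show ?thesis using prod_form_flips(2)[OF P'(1)] P'(2) by blast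
  qed
qed

lemma d4_form_flips:
  assumes "d4_form \<xi> c p r"
  shows "d4_form (- \<xi>) (- c) p r" "d4_form \<xi> (- c) p (- r)"
proof -
  obtain e f e' f' where o: "onb5 e f e' f' \<xi>" and h: "\<And>y. br \<xi> y = 0" "c \<noteq> 0" "p \<noteq> 0"
     "br e f = p *\<^sub>R f + (2 / c) *\<^sub>R \<xi>" "br e' f' = p *\<^sub>R f + (2 / c) *\<^sub>R \<xi>"
     "br e e' = (p / 2) *\<^sub>R e' + r *\<^sub>R f'" "br e f' = - (r *\<^sub>R e') + (p / 2) *\<^sub>R f'"
     "br f e' = 0" "br f f' = 0"
    using assms unfolding d4_form_def by blast
  note oD = onb5_D[OF o]
  show "d4_form (- \<xi>) (- c) p r"
    by (rule d4_formI[of e f e' f']) (use h in \<open>auto simp: onb5_iff oD g_lin br_lin\<close>)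
  show "d4_form \<xi> (- c) p (- r)"
    by (rule d4_formI[of e "- f" e' "- f'"]) (use h in \<open>auto simp: onb5_iff oD g_lin br_lin\<close>)
qed

lemma d42_form_flip:
  assumes "d42_form \<xi> c p" shows "d42_form (- \<xi>) (- c) p"
proof -
  obtain e f e' f' where o: "onb5 e f e' f' \<xi>" and h: "\<And>y. br \<xi> y = 0" "c \<noteq> 0" "p \<noteq> 0"
     "br e f = p *\<^sub>R f + (2 / c) *\<^sub>R \<xi>" "br e' f' = (2 / c) *\<^sub>R \<xi>"
     "br e e' = - ((p / 2) *\<^sub>R e')" "br e f' = (p / 2) *\<^sub>R f'"
     "br f e' = - (p *\<^sub>R f')" "br f f' = 0"
    using assms unfolding d42_form_def by blast
  note oD = onb5_D[OF o]
  show ?thesis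
    by (rule d42_formI[of e f e' f']) (use h in \<open>auto simp: onb5_iff oD g_lin br_lin\<close>)
qed

text \<open>Dividing the vectors of a plane by a structure constant turns that constant into 1 and
  the squared norms into its inverse square. For \<open>aff_aff\<close> the planes are divided by p
  and q, so s is p^2 / q^2, and the restriction s \<le> 1 becomes p \<le> q.\<close>

lemma prod_form_listed:
  assumes "prod_form \<xi> a1 a2 p q b" "a1 > 0" "a2 > 0" "p \<ge> 0" "q \<ge> 0" "b \<ge> 0"
  shows "b > 0 \<Longrightarrow> p = 0 \<Longrightarrow>
      isometrically_isomorphic br g (list_bracket (R_e2 a1 a2 (1 / b\<^sup>2))) (list_metric (R_e2 a1 a2 (1 / b\<^sup>2)))"
    and "b > 0 \<Longrightarrow> p > 0 \<Longrightarrow>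
      isometrically_isomorphic br g (list_bracket (r4' (p / b) a1 a2 (1 / b\<^sup>2))) (list_metric (r4' (p / b) a1 a2 (1 / b\<^sup>2)))"
    and "b = 0 \<Longrightarrow> p = 0 \<Longrightarrow> q = 0 \<Longrightarrow>
      isometrically_isomorphic br g (list_bracket (R4 a1 a2)) (list_metric (R4 a1 a2))"
    and "b = 0 \<Longrightarrow> p = 0 \<Longrightarrow> q > 0 \<Longrightarrow>
      isometrically_isomorphic br g (list_bracket (R2_aff a1 a2 (1 / q\<^sup>2))) (list_metric (R2_aff a1 a2 (1 / q\<^sup>2)))"
    and "b = 0 \<Longrightarrow> p > 0 \<Longrightarrow> p < q \<or> p = q \<and> a1 \<ge> a2 \<Longrightarrow>
      isometrically_isomorphic br g (list_bracket (aff_aff a1 a2 (p\<^sup>2 / q\<^sup>2) (1 / p\<^sup>2)))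
        (list_metric (aff_aff a1 a2 (p\<^sup>2 / q\<^sup>2) (1 / p\<^sup>2)))"
proof -
  obtain e f e' f' where o: "onb5 e f e' f' \<xi>" and h: "\<And>y. br \<xi> y = 0"
     "q * b = 0" "br e f = p *\<^sub>R f + (2 / a1) *\<^sub>R \<xi>"
     "br e' f' = q *\<^sub>R f' + (2 / a2) *\<^sub>R \<xi>"
     "br e e' = b *\<^sub>R f'" "br e f' = - (b *\<^sub>R e')" "br f e' = 0" "br f f' = 0"
    using assms unfolding prod_form_def by blast
  have h': "br y \<xi> = 0" "br f e = - (p *\<^sub>R f) - (2 / a1) *\<^sub>R \<xi>"
     "br f' e' = - (q *\<^sub>R f') - (2 / a2) *\<^sub>R \<xi>"
     "br e' e = - (b *\<^sub>R f')" "br f' e = b *\<^sub>R e'" "br e' f = 0" "br f' f = 0" for y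
    using h br_skew[of y \<xi>] br_skew[of f e] br_skew[of f' e'] br_skew[of e' e] br_skew[of f' e]
      br_skew[of e' f] br_skew[of f' f] by simp_all
  note oD = onb5_D[OF o]
  show "isometrically_isomorphic br g (list_bracket (R_e2 a1 a2 (1 / b\<^sup>2))) (list_metric (R_e2 a1 a2 (1 / b\<^sup>2)))"
    if "b > 0" "p = 0"
  proof (rule isometrically_isomorphic_listI)
    fix i j
    \<comment> \<open>The entry has [e1, e2] = -f2, hence the sign on e. Negating f as well
      preserves the xi-component of [e, f].\<close>
    define \<beta> where "\<beta> = case_frame (- (1 / b) *\<^sub>R e) (- (1 / b) *\<^sub>R f) ((1 / b) *\<^sub>R e') ((1 / b) *\<^sub>R f') \<xi>"
    show "g (\<beta> i) (\<beta> j) = list_metric (R_e2 a1 a2 (1 / b\<^sup>2)) (axis i 1) (axis j 1)"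
      by (cases i; cases j; simp add: \<beta>_def list_metric_def axis_def g_lin oD power2_eq_square)
    show "br (\<beta> i) (\<beta> j) = frame_map \<beta> (list_bracket (R_e2 a1 a2 (1 / b\<^sup>2)) (axis i 1) (axis j 1))"
      using that h
      by (cases i; cases j; simp add: \<beta>_def frame_map_def sum_frame list_bracket_def axis_def
          br_lin h' power2_eq_square algebra_simps)
  qed (use assms that in auto)
  show "isometrically_isomorphic br g (list_bracket (r4' (p / b) a1 a2 (1 / b\<^sup>2))) (list_metric (r4' (p / b) a1 a2 (1 / b\<^sup>2)))"
    if "b > 0" "p > 0"
  proof (rule isometrically_isomorphic_listI)
    fix i j
    define \<beta> where "\<beta> = case_frame ((1 / b) *\<^sub>R e) ((1 / b) *\<^sub>R f) ((1 / b) *\<^sub>R e') ((1 / b) *\<^sub>R f') \<xi>"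
    show "g (\<beta> i) (\<beta> j) = list_metric (r4' (p / b) a1 a2 (1 / b\<^sup>2)) (axis i 1) (axis j 1)"
      by (cases i; cases j; simp add: \<beta>_def list_metric_def axis_def g_lin oD power2_eq_square)
    show "br (\<beta> i) (\<beta> j) = frame_map \<beta> (list_bracket (r4' (p / b) a1 a2 (1 / b\<^sup>2)) (axis i 1) (axis j 1))"
      using that h
      by (cases i; cases j; simp add: \<beta>_def frame_map_def sum_frame list_bracket_def axis_def
          br_lin h' power2_eq_square algebra_simps)
  qed (use assms that in auto)
  show "isometrically_isomorphic br g (list_bracket (R4 a1 a2)) (list_metric (R4 a1 a2))"
    if "b = 0" "p = 0" "q = 0"
  proof (rule isometrically_isomorphic_listI)
    fix i j
    define \<beta> where "\<beta> = case_frame e f e' f' \<xi>"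
    show "g (\<beta> i) (\<beta> j) = list_metric (R4 a1 a2) (axis i 1) (axis j 1)"
      by (cases i; cases j; simp add: \<beta>_def list_metric_def axis_def g_lin oD)
    show "br (\<beta> i) (\<beta> j) = frame_map \<beta> (list_bracket (R4 a1 a2) (axis i 1) (axis j 1))"
      using that h
      by (cases i; cases j; simp add: \<beta>_def frame_map_def sum_frame list_bracket_def axis_def
          br_lin h')
  qed (use assms that in auto)
  show "isometrically_isomorphic br g (list_bracket (R2_aff a1 a2 (1 / q\<^sup>2))) (list_metric (R2_aff a1 a2 (1 / q\<^sup>2)))"
    if "b = 0" "p = 0" "q > 0"
  proof (rule isometrically_isomorphic_listI)
    fix i j
    define \<beta> where "\<beta> = case_frame ((1 / q) *\<^sub>R e) ((1 / q) *\<^sub>R f) ((1 / q) *\<^sub>R e') ((1 / q) *\<^sub>R f') \<xi>"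
    show "g (\<beta> i) (\<beta> j) = list_metric (R2_aff a1 a2 (1 / q\<^sup>2)) (axis i 1) (axis j 1)"
      by (cases i; cases j; simp add: \<beta>_def list_metric_def axis_def g_lin oD power2_eq_square)
    show "br (\<beta> i) (\<beta> j) = frame_map \<beta> (list_bracket (R2_aff a1 a2 (1 / q\<^sup>2)) (axis i 1) (axis j 1))"
      using that h
      by (cases i; cases j; simp add: \<beta>_def frame_map_def sum_frame list_bracket_def axis_def
          br_lin h' power2_eq_square algebra_simps)
  qed (use assms that in auto)
  show "isometrically_isomorphic br g (list_bracket (aff_aff a1 a2 (p\<^sup>2 / q\<^sup>2) (1 / p\<^sup>2)))
        (list_metric (aff_aff a1 a2 (p\<^sup>2 / q\<^sup>2) (1 / p\<^sup>2)))"
    if "b = 0" "p > 0" "p < q \<or> p = q \<and> a1 \<ge> a2"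
  proof (rule isometrically_isomorphic_listI)
    have q: "q > 0" using that by auto
    fix i j
    define \<beta> where "\<beta> = case_frame ((1 / p) *\<^sub>R e) ((1 / p) *\<^sub>R f) ((1 / q) *\<^sub>R e') ((1 / q) *\<^sub>R f') \<xi>"
    show "g (\<beta> i) (\<beta> j) = list_metric (aff_aff a1 a2 (p\<^sup>2 / q\<^sup>2) (1 / p\<^sup>2)) (axis i 1) (axis j 1)"
      using that q
      by (cases i; cases j; simp add: \<beta>_def list_metric_def axis_def g_lin oD power2_eq_square)
    show "br (\<beta> i) (\<beta> j) = frame_map \<beta> (list_bracket (aff_aff a1 a2 (p\<^sup>2 / q\<^sup>2) (1 / p\<^sup>2)) (axis i 1) (axis j 1))"
      using that h q
      by (cases i; cases j; simp add: \<beta>_def frame_map_def sum_frame list_bracket_def axis_def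
          br_lin h' power2_eq_square algebra_simps)
    have "p\<^sup>2 < q\<^sup>2" if "p < q" using that \<open>p > 0\<close> by (simp add: power_strict_mono)
    then show "admissible (aff_aff a1 a2 (p\<^sup>2 / q\<^sup>2) (1 / p\<^sup>2))"
      using that q assms by auto
  qed
qed

text \<open>After division by p the rotation coefficient is r / p, which the entry writes as
  -1/\<delta>; so \<delta> is -(p / r), positive exactly when p / r < 0.\<close>

lemma d4_form_listed:
  assumes "d4_form \<xi> c p r"
  shows "r = 0 \<Longrightarrow> c > 0 \<Longrightarrow>
      isometrically_isomorphic br g (list_bracket (d4_half c (1 / p\<^sup>2))) (list_metric (d4_half c (1 / p\<^sup>2)))"
    and "p / r < 0 \<Longrightarrow>
      isometrically_isomorphic br g (list_bracket (d4' (- (p / r)) c (1 / p\<^sup>2))) (list_metric (d4' (- (p / r)) c (1 / p\<^sup>2)))"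
proof -
  obtain e f e' f' where o: "onb5 e f e' f' \<xi>" and h: "\<And>y. br \<xi> y = 0" "c \<noteq> 0" "p \<noteq> 0"
     "br e f = p *\<^sub>R f + (2 / c) *\<^sub>R \<xi>" "br e' f' = p *\<^sub>R f + (2 / c) *\<^sub>R \<xi>"
     "br e e' = (p / 2) *\<^sub>R e' + r *\<^sub>R f'" "br e f' = - (r *\<^sub>R e') + (p / 2) *\<^sub>R f'"
     "br f e' = 0" "br f f' = 0"
    using assms unfolding d4_form_def by blast
  have h': "br y \<xi> = 0" "br f e = - (p *\<^sub>R f) - (2 / c) *\<^sub>R \<xi>"
     "br f' e' = - (p *\<^sub>R f) - (2 / c) *\<^sub>R \<xi>"
     "br e' e = - ((p / 2) *\<^sub>R e') - r *\<^sub>R f'" "br f' e = r *\<^sub>R e' - (p / 2) *\<^sub>R f'"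
     "br e' f = 0" "br f' f = 0" for y
    using h br_skew[of y \<xi>] br_skew[of f e] br_skew[of f' e'] br_skew[of e' e] br_skew[of f' e]
      br_skew[of e' f] br_skew[of f' f] by simp_all
  note oD = onb5_D[OF o]
  define \<beta> where "\<beta> = case_frame ((1 / p) *\<^sub>R e) ((1 / p) *\<^sub>R f) ((1 / p) *\<^sub>R e') ((1 / p) *\<^sub>R f') \<xi>"
  show "isometrically_isomorphic br g (list_bracket (d4_half c (1 / p\<^sup>2))) (list_metric (d4_half c (1 / p\<^sup>2)))"
    if "r = 0" "c > 0"
  proof (rule isometrically_isomorphic_listI)
    fix i j
    show "g (\<beta> i) (\<beta> j) = list_metric (d4_half c (1 / p\<^sup>2)) (axis i 1) (axis j 1)"
      by (cases i; cases j; simp add: \<beta>_def list_metric_def axis_def g_lin oD power2_eq_square)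
    show "br (\<beta> i) (\<beta> j) = frame_map \<beta> (list_bracket (d4_half c (1 / p\<^sup>2)) (axis i 1) (axis j 1))"
      using that h(2,3)
      by (cases i; cases j; simp add: \<beta>_def frame_map_def sum_frame list_bracket_def axis_def
          br_lin h h' power2_eq_square algebra_simps)
  qed (use h that in auto)
  show "isometrically_isomorphic br g (list_bracket (d4' (- (p / r)) c (1 / p\<^sup>2))) (list_metric (d4' (- (p / r)) c (1 / p\<^sup>2)))"
    if "p / r < 0"
  proof (rule isometrically_isomorphic_listI)
    fix i j
    show "g (\<beta> i) (\<beta> j) = list_metric (d4' (- (p / r)) c (1 / p\<^sup>2)) (axis i 1) (axis j 1)"
      by (cases i; cases j; simp add: \<beta>_def list_metric_def axis_def g_lin oD power2_eq_square)
    show "br (\<beta> i) (\<beta> j) = frame_map \<beta> (list_bracket (d4' (- (p / r)) c (1 / p\<^sup>2)) (axis i 1) (axis j 1))"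
      using that h(2,3)
      by (cases i; cases j; simp add: \<beta>_def frame_map_def sum_frame list_bracket_def axis_def
          br_lin h h' power2_eq_square algebra_simps)
  qed (use h that in auto)
qed

lemma d42_form_listed:
  assumes "d42_form \<xi> c p" "c > 0"
  shows "isometrically_isomorphic br g (list_bracket (d4_two c (1 / p\<^sup>2))) (list_metric (d4_two c (1 / p\<^sup>2)))"
proof -
  obtain e f e' f' where o: "onb5 e f e' f' \<xi>" and h: "\<And>y. br \<xi> y = 0" "c \<noteq> 0" "p \<noteq> 0"
     "br e f = p *\<^sub>R f + (2 / c) *\<^sub>R \<xi>" "br e' f' = (2 / c) *\<^sub>R \<xi>"
     "br e e' = - ((p / 2) *\<^sub>R e')" "br e f' = (p / 2) *\<^sub>R f'"
     "br f e' = - (p *\<^sub>R f')" "br f f' = 0"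
    using assms unfolding d42_form_def by blast
  have h': "br y \<xi> = 0" "br f e = - (p *\<^sub>R f) - (2 / c) *\<^sub>R \<xi>"
     "br f' e' = - ((2 / c) *\<^sub>R \<xi>)"
     "br e' e = (p / 2) *\<^sub>R e'" "br f' e = - ((p / 2) *\<^sub>R f')"
     "br e' f = p *\<^sub>R f'" "br f' f = 0" for y
    using h br_skew[of y \<xi>] br_skew[of f e] br_skew[of f' e'] br_skew[of e' e] br_skew[of f' e]
      br_skew[of e' f] br_skew[of f' f] by simp_all
  note oD = onb5_D[OF o]
  \<comment> \<open>The entry has [e1, f1] = -e1 + ..., whereas in the model [e, f] points along f.
    So e1 comes from -f and f1 from e.\<close>
  define \<beta> where "\<beta> = case_frame (- (1 / p) *\<^sub>R f) ((1 / p) *\<^sub>R e) ((1 / p) *\<^sub>R e') ((1 / p) *\<^sub>R f') \<xi>"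
  show ?thesis
  proof (rule isometrically_isomorphic_listI)
    fix i j
    show "g (\<beta> i) (\<beta> j) = list_metric (d4_two c (1 / p\<^sup>2)) (axis i 1) (axis j 1)"
      by (cases i; cases j; simp add: \<beta>_def list_metric_def axis_def g_lin oD power2_eq_square)
    show "br (\<beta> i) (\<beta> j) = frame_map \<beta> (list_bracket (d4_two c (1 / p\<^sup>2)) (axis i 1) (axis j 1))"
      using h(2,3)
      by (cases i; cases j; simp add: \<beta>_def frame_map_def sum_frame list_bracket_def axis_def
          br_lin h h' power2_eq_square algebra_simps)
  qed (use h assms in auto)
qed

definition has_model :: bool where
  "has_model \<longleftrightarrow>
    (\<exists>m. admissible m \<and> isometrically_isomorphic br g (list_bracket m) (list_metric m))"

lemma prod_form_model_sorted:
  assumes P: "prod_form \<xi> a1 a2 p q b" and nn: "a1 > 0" "a2 > 0" "p \<ge> 0" "q \<ge> 0" "b \<ge> 0"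
    and order: "b > 0 \<or> p < q \<or> p = q \<and> a1 \<ge> a2"
  shows has_model
proof -
  note L = prod_form_listed[OF P nn]
  show ?thesis
  proof (cases "b = 0")
    case False
    then have b: "b > 0" using nn by simp
    show ?thesis
    proof (cases "p = 0")
      case True
      have "admissible (R_e2 a1 a2 (1 / b\<^sup>2))" using b nn by simp
      then show ?thesis using L(1)[OF b True] unfolding has_model_def by blast
    next
      case False
      then have p: "p > 0" using nn by simp
      have "admissible (r4' (p / b) a1 a2 (1 / b\<^sup>2))" using b p nn by simp
      then show ?thesis using L(2)[OF b p] unfolding has_model_def by blast
    qed
  next
    case b: True
    show ?thesis
    proof (cases "p = 0")
      case p: True
      show ?thesis
      proof (cases "q = 0")
        case True
        have "admissible (R4 a1 a2)" using nn by simp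
        then show ?thesis using L(3)[OF b p True] unfolding has_model_def by blast
      next
        case False
        then have q: "q > 0" using nn by simp
        have "admissible (R2_aff a1 a2 (1 / q\<^sup>2))" using q nn by simp
        then show ?thesis using L(4)[OF b p q] unfolding has_model_def by blast
      qed
    next
      case False
      then have p: "p > 0" and o: "p < q \<or> p = q \<and> a1 \<ge> a2" using nn order b by auto
      then have q: "q > 0" by auto
      have "p\<^sup>2 < q\<^sup>2" if "p < q" using that p by (simp add: power_strict_mono)
      then have "admissible (aff_aff a1 a2 (p\<^sup>2 / q\<^sup>2) (1 / p\<^sup>2))" using o p q nn by auto
      then show ?thesis using L(5)[OF b p o] unfolding has_model_def by blast
    qed
  qed
qed

text \<open>When b = 0 the two planes may be exchanged, which puts the smaller of p, q first and, in
  a tie, the larger of a1, a2.\<close>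

lemma prod_form_model:
  assumes "prod_form \<xi> a1 a2 p q b" shows has_model
proof -
  obtain \<xi> a1 a2 where P: "prod_form \<xi> a1 a2 \<bar>p\<bar> \<bar>q\<bar> \<bar>b\<bar>" and a: "a1 > 0" "a2 > 0"
    using prod_form_signs[OF assms] by blast
  show ?thesis
  proof (cases "\<bar>b\<bar> > 0 \<or> \<bar>p\<bar> < \<bar>q\<bar> \<or> \<bar>p\<bar> = \<bar>q\<bar> \<and> a1 \<ge> a2")
    case True
    then show ?thesis using prod_form_model_sorted[OF P a] by simp
  next
    case False
    then have "prod_form \<xi> a2 a1 \<bar>q\<bar> \<bar>p\<bar> 0" using prod_form_flips(6)[OF P] by simp
    moreover have "\<bar>q\<bar> < \<bar>p\<bar> \<or> \<bar>q\<bar> = \<bar>p\<bar> \<and> a2 \<ge> a1" using False by auto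
    ultimately show ?thesis using a by (intro prod_form_model_sorted[of \<xi> a2 a1 "\<bar>q\<bar>" "\<bar>p\<bar>" 0]) auto
  qed
qed

text \<open>For r = 0 a flip makes c positive. For r \<noteq> 0 the flips are spent on making p / r
  negative, and c keeps whatever sign results, as \<open>d4'\<close> permits.\<close>

lemma d4_form_model:
  assumes P: "d4_form \<xi> c p r" shows has_model
proof -
  have c: "c \<noteq> 0" "p \<noteq> 0" using assms by (auto simp: d4_form_def)
  consider "r = 0" "c > 0" | "r = 0" "- c > 0" | "p / r < 0" | "p / - r < 0"
    using c by (cases "p > 0"; cases "r > 0"; cases "c > 0"; force simp: divide_simps)
  then show ?thesis
  proof cases
    case 1
    then have "admissible (d4_half c (1 / p\<^sup>2))" using c by simp
    then show ?thesis using d4_form_listed(1)[OF P 1] unfolding has_model_def by blast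
  next
    case 2
    then have "admissible (d4_half (- c) (1 / p\<^sup>2))" using c by simp
    then show ?thesis using d4_form_listed(1)[OF d4_form_flips(1)[OF P] 2] unfolding has_model_def by blast
  next
    case 3
    then have "admissible (d4' (- (p / r)) c (1 / p\<^sup>2))" using c by simp
    then show ?thesis using d4_form_listed(2)[OF P 3] unfolding has_model_def by blast
  next
    case 4
    then have "admissible (d4' (- (p / - r)) (- c) (1 / p\<^sup>2))" using c by simp
    then show ?thesis using d4_form_listed(2)[OF d4_form_flips(2)[OF P] 4] unfolding has_model_def by blast
  qed
qed

lemma d42_form_model:
  assumes P: "d42_form \<xi> c p" shows has_model
proof -
  have c: "c \<noteq> 0" "p \<noteq> 0" using assms by (auto simp: d42_form_def)
  then consider "c > 0" | "- c > 0" by linarith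
  then show ?thesis
  proof cases
    case 1
    then have "admissible (d4_two c (1 / p\<^sup>2))" using c by simp
    then show ?thesis using d42_form_listed[OF P 1] unfolding has_model_def by blast
  next
    case 2
    then have "admissible (d4_two (- c) (1 / p\<^sup>2))" using c by simp
    then show ?thesis using d42_form_listed[OF d42_form_flip[OF P] 2] unfolding has_model_def by blast
  qed
qed

end

lemma (in unit_cky) has_model: has_model
  using ex_normal_form prod_form_model d4_form_model d42_form_model by blast

section \<open>Invariants separating the entries\<close>

text \<open>Expand u in b, exchange the sums, and recognise the inner sum as the expansion of a
  vector of b in u.\<close>

lemma (in metric_lie5) sum_onb_eq:
  fixes F :: "'a \<Rightarrow> 'a \<Rightarrow> real"
  assumes "onb b" "onb u" "bilinear F"
  shows "(\<Sum>i\<in>UNIV. F (u i) (u i)) = (\<Sum>i\<in>UNIV. F (b i) (b i))"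
proof -
  have l: "linear (\<lambda>x. F x y)" "linear (F x)" for x y using assms by (auto simp: bilinear_def)
  have "F (u i) (u i) = (\<Sum>k\<in>UNIV. g (u i) (b k) * F (b k) (u i))" for i
    by (subst (1) onb_expand[OF assms(1), of "u i"])
      (simp add: linear_sum[OF l(1)] linear_scale[OF l(1)])
  then have "(\<Sum>i\<in>UNIV. F (u i) (u i)) = (\<Sum>k\<in>UNIV. \<Sum>i\<in>UNIV. g (b k) (u i) * F (b k) (u i))"
    by (simp add: g_sym[of "u _"]) (rule sum.swap)
  also have "\<dots> = (\<Sum>k\<in>UNIV. F (b k) (\<Sum>i\<in>UNIV. g (b k) (u i) *\<^sub>R u i))"
    by (simp add: linear_sum[OF l(2)] linear_scale[OF l(2)])
  also have "\<dots> = (\<Sum>i\<in>UNIV. F (b i) (b i))"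
    by (simp flip: onb_expand[OF assms(2)])
  finally show ?thesis .
qed

lemma metric_lie5_list: "admissible m \<Longrightarrow> metric_lie5 (list_bracket m) (list_metric m)"
  by (simp add: metric_lie5_def metric_lie_algebra_list UNIV_frame)

text \<open>The trace of a bilinear form with respect to the metric of the entry. By
  \<open>metric_trace_onb\<close> it may be computed in any orthonormal basis.\<close>

definition metric_trace :: "listed \<Rightarrow> (real ^ frame \<Rightarrow> real ^ frame \<Rightarrow> real) \<Rightarrow> real" where
  "metric_trace m F = (F e1 e1 + F f1 f1) / fst (norms_sq m) + (F e2 e2 + F f2 f2) / snd (norms_sq m) + F xi xi"

lemma norms_sq_pos: "admissible m \<Longrightarrow> fst (norms_sq m) > 0 \<and> snd (norms_sq m) > 0"
  by (cases m) auto

lemma metric_trace_onb: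
  assumes "admissible m" "bilinear F" "metric_lie5.onb (list_metric m) u"
  shows "metric_trace m F = (\<Sum>i\<in>UNIV. F (u i) (u i))"
proof -
  interpret metric_lie5 "list_bracket m" "list_metric m" by (rule metric_lie5_list[OF assms(1)])
  have l: "linear (\<lambda>x. F x y)" "linear (F x)" for x y using assms by (auto simp: bilinear_def)
  define b where "b = case_frame ((1 / sqrt (fst (norms_sq m))) *\<^sub>R e1) ((1 / sqrt (fst (norms_sq m))) *\<^sub>R f1)
    ((1 / sqrt (snd (norms_sq m))) *\<^sub>R e2) ((1 / sqrt (snd (norms_sq m))) *\<^sub>R f2) xi"
  note N = norms_sq_pos[OF assms(1)]
  have "onb b" unfolding onb_def
  proof (intro allI)
    fix i j show "list_metric m (b i) (b j) = (if i = j then 1 else 0)"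
      using N by (cases i; cases j; simp add: b_def list_metric_def axis_def)
  qed
  then have "(\<Sum>i\<in>UNIV. F (u i) (u i)) = (\<Sum>i\<in>UNIV. F (b i) (b i))"
    using sum_onb_eq assms by blast
  then show ?thesis
    using N by (simp add: sum_frame b_def metric_trace_def linear_scale[OF l(1)] linear_scale[OF l(2)]
        add_divide_distrib)
qed

lemma metric_trace_isometry:
  assumes "admissible m" "admissible m'" "bilinear F" "linear \<phi>"
    and iso: "\<And>x y. list_metric m' (\<phi> x) (\<phi> y) = list_metric m x y"
  shows "metric_trace m' F = metric_trace m (\<lambda>x y. F (\<phi> x) (\<phi> y))"
proof -
  interpret M: metric_lie5 "list_bracket m" "list_metric m" by (rule metric_lie5_list[OF assms(1)])
  interpret M': metric_lie5 "list_bracket m'" "list_metric m'" by (rule metric_lie5_list[OF assms(2)])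
  obtain u where u: "M.onb u" using M.ex_onb by blast
  then have "M'.onb (\<lambda>i. \<phi> (u i))" by (simp add: M.onb_def M'.onb_def iso)
  then have "metric_trace m' F = (\<Sum>i\<in>UNIV. F (\<phi> (u i)) (\<phi> (u i)))" by (rule metric_trace_onb[OF assms(2,3)])
  moreover have "bilinear (\<lambda>x y. F (\<phi> x) (\<phi> y))"
    using assms(3,4) by (simp add: bilinear_def linear_iff)
  ultimately show ?thesis using metric_trace_onb[OF assms(1) _ u, of "\<lambda>x y. F (\<phi> x) (\<phi> y)"] by simp
qed

lemma metric_trace_lin:
  "metric_trace m (\<lambda>x y. F x y + G x y) = metric_trace m F + metric_trace m G"
  "metric_trace m (\<lambda>x y. r * F x y) = r * metric_trace m F"
  by (simp_all add: metric_trace_def algebra_simps add_divide_distrib)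

text \<open>\<open>cocycle\<close> is mu, and \<open>cocycle_square\<close> is the form of minus the
  square of mu viewed as a skew operator; it is therefore unaffected by the sign of xi.\<close>

definition "ad_trace_form m x = metric_trace m (\<lambda>u v. list_metric m (list_bracket m x u) v)"
definition "killing_form m x y = metric_trace m (\<lambda>u v. list_metric m (list_bracket m x (list_bracket m y u)) v)"
definition "cocycle m x y = list_bracket m x y $ Xi"
definition "cocycle_square m x y = metric_trace m (\<lambda>u v. cocycle m x u * cocycle m y v)"

text \<open>Write tau for the trace form, B for the Killing form and S for
  \<open>cocycle_square\<close>. In order, the invariants are |tau|^2, tr B, the squared norm of the
  bracket, |B|^2, tr S, <B, S>, the pairing of tau tensor tau with S, and |S|^2.\<close>

definition "invX m = metric_trace m (\<lambda>x y. ad_trace_form m x * ad_trace_form m y)"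
definition "invY m = metric_trace m (killing_form m)"
definition "invL m = metric_trace m (\<lambda>x y. metric_trace m (\<lambda>u v. list_metric m (list_bracket m x u) (list_bracket m y v)))"
definition "invW m = metric_trace m (\<lambda>x y. metric_trace m (\<lambda>u v. killing_form m x u * killing_form m y v))"
definition "invU m = metric_trace m (cocycle_square m)"
definition "invV m = metric_trace m (\<lambda>x y. metric_trace m (\<lambda>u v. killing_form m x u * cocycle_square m y v))"
definition "invV' m = metric_trace m (\<lambda>x y. metric_trace m (\<lambda>u v. (ad_trace_form m x * ad_trace_form m u) * cocycle_square m y v))"
definition "invQ m = metric_trace m (\<lambda>x y. metric_trace m (\<lambda>u v. cocycle_square m x u * cocycle_square m y v))"

lemma bilinearI:
  assumes "\<And>x x' y. h (x + x') y = h x y + h x' y" "\<And>r x y. h (r *\<^sub>R x) y = r *\<^sub>R h x y"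
    "\<And>x y y'. h x (y + y') = h x y + h x y'" "\<And>r x y. h x (r *\<^sub>R y) = r *\<^sub>R h x y"
  shows "bilinear h"
  using assms by (auto simp: bilinear_def intro!: linearI)

text \<open>The isomorphism carries each tensor to its counterpart, mu only up to the sign
  \<epsilon>, which cancels in \<open>cocycle_square\<close>. Nested traces are transported one at a
  time.\<close>

lemma list_isometric_invariants:
  assumes m: "admissible m" and m': "admissible m'"
    and iso: "isometric_isomorphism (list_bracket m) (list_metric m) (list_bracket m') (list_metric m') \<phi>"
    and center: "\<phi> xi = \<epsilon> *\<^sub>R xi" "\<epsilon>\<^sup>2 = 1"
  shows "invX m' = invX m" "invY m' = invY m" "invL m' = invL m" "invW m' = invW m"
    "invU m' = invU m" "invV m' = invV m" "invV' m' = invV' m" "invQ m' = invQ m"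
proof -
  have lin: "linear \<phi>" and br: "list_bracket m' (\<phi> x) (\<phi> y) = \<phi> (list_bracket m x y)"
    and g: "list_metric m' (\<phi> x) (\<phi> y) = list_metric m x y" for x y
    using iso by (auto simp: isometric_isomorphism_def)
  interpret M: metric_lie5 "list_bracket m'" "list_metric m'" by (rule metric_lie5_list[OF m'])
  note T = metric_trace_isometry[OF m m' _ lin g]
  note l = M.br_lin M.g_lin
  have ad_trace_form: "ad_trace_form m' (\<phi> x) = ad_trace_form m x" for x
    unfolding ad_trace_form_def by (subst T, rule bilinearI) (simp_all add: l br g)
  have killing_form: "killing_form m' (\<phi> x) (\<phi> y) = killing_form m x y" for x y
    unfolding killing_form_def by (subst T, rule bilinearI) (simp_all add: l br g)
  \<comment> \<open>The last coordinate is the metric pairing with xi, and xi is mapped to its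
    multiple by \<epsilon>.\<close>
  have Xi: "\<phi> v $ Xi = \<epsilon> * v $ Xi" for v
  proof -
    have "\<epsilon> * list_metric m' (\<phi> v) xi = list_metric m v xi" using g[of v xi] by (simp add: center l)
    then have "\<epsilon> * \<phi> v $ Xi = v $ Xi" by (simp add: list_metric_def axis_def)
    then have "\<epsilon> * v $ Xi = \<epsilon>\<^sup>2 * \<phi> v $ Xi"
      by (metis power2_eq_square mult.assoc)
    then show ?thesis using center(2) by simp
  qed
  have cocycle: "cocycle m' (\<phi> x) (\<phi> y) = \<epsilon> * cocycle m x y" for x y by (simp add: cocycle_def br Xi)
  have cocycle_lin: "cocycle m' (x + x') y = cocycle m' x y + cocycle m' x' y" "cocycle m' x (y + y') = cocycle m' x y + cocycle m' x y'"
    "cocycle m' (r *\<^sub>R x) y = r * cocycle m' x y" "cocycle m' x (r *\<^sub>R y) = r * cocycle m' x y" for x x' y y' r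
    by (simp_all add: cocycle_def l)
  have cocycle_square: "cocycle_square m' (\<phi> x) (\<phi> y) = cocycle_square m x y" for x y
  proof -
    have e: "\<epsilon> * (\<epsilon> * a) = a" for a
      using center(2) by (simp add: power2_eq_square flip: mult.assoc)
    show ?thesis
      unfolding cocycle_square_def by (subst T, rule bilinearI) (simp_all add: cocycle_lin cocycle e algebra_simps)
  qed
  have lins: "ad_trace_form m' (x + x') = ad_trace_form m' x + ad_trace_form m' x'" "ad_trace_form m' (r *\<^sub>R x) = r * ad_trace_form m' x"
    "killing_form m' (x + x') y = killing_form m' x y + killing_form m' x' y" "killing_form m' x (y + y') = killing_form m' x y + killing_form m' x y'"
    "killing_form m' (r *\<^sub>R x) y = r * killing_form m' x y" "killing_form m' x (r *\<^sub>R y) = r * killing_form m' x y"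
    "cocycle_square m' (x + x') y = cocycle_square m' x y + cocycle_square m' x' y" "cocycle_square m' x (y + y') = cocycle_square m' x y + cocycle_square m' x y'"
    "cocycle_square m' (r *\<^sub>R x) y = r * cocycle_square m' x y" "cocycle_square m' x (r *\<^sub>R y) = r * cocycle_square m' x y" for x x' y y' r
    by (simp_all add: ad_trace_form_def killing_form_def cocycle_square_def l cocycle_lin metric_trace_lin ring_distribs mult.assoc mult.left_commute)
  have T2: "metric_trace m' (\<lambda>x y. metric_trace m' (\<lambda>u v. H x u * K y v)) =
      metric_trace m (\<lambda>x y. metric_trace m (\<lambda>u v. H (\<phi> x) (\<phi> u) * K (\<phi> y) (\<phi> v)))"
    if "bilinear H" "bilinear K" for H K
  proof -
    note b = bilinear_ladd[OF that(1)] bilinear_radd[OF that(1)] bilinear_lmul[OF that(1)]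
      bilinear_rmul[OF that(1)] bilinear_ladd[OF that(2)] bilinear_radd[OF that(2)]
      bilinear_lmul[OF that(2)] bilinear_rmul[OF that(2)]
    have "metric_trace m' (\<lambda>u v. H x u * K y v) = metric_trace m (\<lambda>u v. H x (\<phi> u) * K y (\<phi> v))" for x y
      by (subst T, rule bilinearI) (simp_all add: b ring_distribs mult.assoc mult.left_commute)
    then show ?thesis
      by (subst T, intro bilinearI) (simp_all add: b metric_trace_lin ring_distribs mult.assoc mult.left_commute)
  qed
  have bk: "bilinear (killing_form m')" and bm: "bilinear (cocycle_square m')" and bt: "bilinear (\<lambda>x y. ad_trace_form m' x * ad_trace_form m' y)"
    by (intro bilinearI; simp add: lins ring_distribs)+
  show "invX m' = invX m" unfolding invX_def by (subst T[OF bt]) (simp add: ad_trace_form)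
  show "invY m' = invY m" unfolding invY_def by (subst T[OF bk]) (simp add: killing_form)
  show "invU m' = invU m" unfolding invU_def by (subst T[OF bm]) (simp add: cocycle_square)
  show "invW m' = invW m" unfolding invW_def by (subst T2[OF bk bk]) (simp add: killing_form)
  show "invV m' = invV m" unfolding invV_def by (subst T2[OF bk bm]) (simp add: killing_form cocycle_square)
  show "invV' m' = invV' m" unfolding invV'_def by (subst T2[OF bt bm]) (simp add: ad_trace_form cocycle_square)
  show "invQ m' = invQ m" unfolding invQ_def by (subst T2[OF bm bm]) (simp add: cocycle_square)
  have "metric_trace m' (\<lambda>u v. list_metric m' (list_bracket m' x u) (list_bracket m' y v)) =
      metric_trace m (\<lambda>u v. list_metric m' (list_bracket m' x (\<phi> u)) (list_bracket m' y (\<phi> v)))" for x y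
    by (subst T, rule bilinearI) (simp_all add: l)
  then show "invL m' = invL m" unfolding invL_def
    by (subst T, intro bilinearI) (simp_all add: l metric_trace_lin br g)
qed


section \<open>Values of the invariants on the list\<close>

lemmas inv_defs = metric_trace_def list_bracket_def list_metric_def axis_def

text \<open>In every entry only [e1, f1] and [e2, f2] have a xi-component, so two numbers describe
  mu.\<close>

lemma cocycle_eq:
  "cocycle m x y = x $ E1 * y $ F1 * cocycle m e1 f1 - x $ F1 * y $ E1 * cocycle m e1 f1 +
     x $ E2 * y $ F2 * cocycle m e2 f2 - x $ F2 * y $ E2 * cocycle m e2 f2"
  by (cases m) (simp_all add: cocycle_def list_bracket_def axis_def algebra_simps)

lemma cocycle_vals:
  "cocycle (R_e2 a1 a2 t) e1 f1 = 2 * t / a1" "cocycle (R_e2 a1 a2 t) e2 f2 = 2 * t / a2"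
  "cocycle (R2_aff a1 a2 t) e1 f1 = 2 * t / a1" "cocycle (R2_aff a1 a2 t) e2 f2 = 2 * t / a2"
  "cocycle (r4' l a1 a2 t) e1 f1 = 2 * t / a1" "cocycle (r4' l a1 a2 t) e2 f2 = 2 * t / a2"
  "cocycle (aff_aff a1 a2 s t) e1 f1 = 2 * t / a1" "cocycle (aff_aff a1 a2 s t) e2 f2 = 2 * t * s / a2"
  "cocycle (d4_half c t) e1 f1 = 2 * t / c" "cocycle (d4_half c t) e2 f2 = 2 * t / c"
  "cocycle (d4_two c t) e1 f1 = 2 * t / c" "cocycle (d4_two c t) e2 f2 = 2 * t / c"
  "cocycle (d4' d c t) e1 f1 = 2 * t / c" "cocycle (d4' d c t) e2 f2 = 2 * t / c"
  "cocycle (R4 a1 a2) e1 f1 = 2 / a1" "cocycle (R4 a1 a2) e2 f2 = 2 / a2"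
  by (simp_all add: cocycle_def list_bracket_def axis_def)

lemma cocycle_square_eq:
  "cocycle_square m x y = (cocycle m e1 f1)\<^sup>2 / fst (norms_sq m) * (x $ E1 * y $ E1 + x $ F1 * y $ F1) +
     (cocycle m e2 f2)\<^sup>2 / snd (norms_sq m) * (x $ E2 * y $ E2 + x $ F2 * y $ F2)"
  unfolding cocycle_square_def metric_trace_def by (subst (1 2 3 4 5 6 7 8 9 10) cocycle_eq)
    (simp add: axis_def power2_eq_square algebra_simps add_divide_distrib)

lemma ad_trace_form_eq:
  assumes "t \<noteq> 0"
  shows "ad_trace_form (R_e2 a1 a2 t) x = 0" "ad_trace_form (R2_aff a1 a2 t) x = x $ E2"
    "ad_trace_form (r4' l a1 a2 t) x = l * x $ E1" "s \<noteq> 0 \<Longrightarrow> ad_trace_form (aff_aff a1 a2 s t) x = x $ E1 + x $ E2"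
    "ad_trace_form (d4_half c t) x = 2 * x $ E1" "ad_trace_form (d4_two c t) x = x $ F1" "ad_trace_form (d4' d c t) x = 2 * x $ E1"
    "ad_trace_form (R4 a1 a2) x = 0"
  using assms by (simp_all add: ad_trace_form_def inv_defs field_simps)

lemma killing_form_eq:
  assumes "t \<noteq> 0"
  shows "killing_form (R_e2 a1 a2 t) x y = - 2 * (x $ E1 * y $ E1)" "killing_form (R2_aff a1 a2 t) x y = x $ E2 * y $ E2"
    "killing_form (r4' l a1 a2 t) x y = (l\<^sup>2 - 2) * (x $ E1 * y $ E1)"
    "s \<noteq> 0 \<Longrightarrow> killing_form (aff_aff a1 a2 s t) x y = x $ E1 * y $ E1 + x $ E2 * y $ E2"
    "killing_form (d4_half c t) x y = 3 / 2 * (x $ E1 * y $ E1)" "killing_form (d4_two c t) x y = 3 / 2 * (x $ F1 * y $ F1)"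
    "d \<noteq> 0 \<Longrightarrow> killing_form (d4' d c t) x y = (3 / 2 - 2 / d\<^sup>2) * (x $ E1 * y $ E1)"
    "killing_form (R4 a1 a2) x y = 0"
  using assms by (simp_all add: killing_form_def inv_defs field_simps power2_eq_square)

lemma axis_nth: "axis i x $ j = (if j = i then x else 0)"
  by (simp add: axis_def)

text \<open>Up to a factor 2 this is $2|\tau|^2-\mathrm{tr}\,B-|[\cdot,\cdot]_{\mathfrak h}|^2$, which vanishes
  exactly for the entries with reducible $\mathfrak h$ ($\tau$ the trace form, $B$ the Killing form).\<close>

definition "invD m = 4 * invX m - 2 * invY m - invL m + invU m"

lemma invU_eq:
  "invU m = 2 * ((cocycle m e1 f1 / fst (norms_sq m))\<^sup>2 + (cocycle m e2 f2 / snd (norms_sq m))\<^sup>2)"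
  by (simp add: invU_def metric_trace_def cocycle_square_eq axis_nth power_divide power2_eq_square field_simps)

lemma invQ_eq:
  "invQ m = 2 * (((cocycle m e1 f1 / fst (norms_sq m))\<^sup>2)\<^sup>2 + ((cocycle m e2 f2 / snd (norms_sq m))\<^sup>2)\<^sup>2)"
  by (simp add: invQ_def metric_trace_def cocycle_square_eq axis_nth power_divide power2_eq_square field_simps)

lemma invU_list:
  assumes "t \<noteq> 0"
  shows "invU (R_e2 a1 a2 t) = 2 * (4 / a1\<^sup>2 + 4 / a2\<^sup>2)" "invU (R2_aff a1 a2 t) = 2 * (4 / a1\<^sup>2 + 4 / a2\<^sup>2)"
    "invU (r4' l a1 a2 t) = 2 * (4 / a1\<^sup>2 + 4 / a2\<^sup>2)"
    "s \<noteq> 0 \<Longrightarrow> invU (aff_aff a1 a2 s t) = 2 * (4 / a1\<^sup>2 + 4 / a2\<^sup>2)"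
    "invU (d4_half c t) = 16 / c\<^sup>2" "invU (d4_two c t) = 16 / c\<^sup>2" "invU (d4' d c t) = 16 / c\<^sup>2"
    "invU (R4 a1 a2) = 2 * (4 / a1\<^sup>2 + 4 / a2\<^sup>2)"
  using assms by (simp_all add: invU_eq cocycle_vals power_divide)

lemma invQ_list:
  "s \<noteq> 0 \<Longrightarrow> t \<noteq> 0 \<Longrightarrow> invQ (aff_aff a1 a2 s t) = 2 * ((4 / a1\<^sup>2)\<^sup>2 + (4 / a2\<^sup>2)\<^sup>2)"
  "invQ (R4 a1 a2) = 2 * ((4 / a1\<^sup>2)\<^sup>2 + (4 / a2\<^sup>2)\<^sup>2)"
  by (simp_all add: invQ_eq cocycle_vals power_divide)

lemma invX_list:
  assumes "t \<noteq> 0"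
  shows "invX (R_e2 a1 a2 t) = 0" "invX (R2_aff a1 a2 t) = 1 / t" "invX (r4' l a1 a2 t) = l\<^sup>2 / t"
    "s \<noteq> 0 \<Longrightarrow> invX (aff_aff a1 a2 s t) = 1 / t + 1 / (t * s)"
    "invX (d4_half c t) = 4 / t" "invX (d4_two c t) = 1 / t" "invX (d4' d c t) = 4 / t"
    "invX (R4 a1 a2) = 0"
  \<comment> \<open>The clause for \<open>R4\<close> does not mention t but inherits the assumption
    t \<noteq> 0, hence the instance at 1.\<close>
  using assms by (simp_all add: invX_def ad_trace_form_eq metric_trace_def axis_nth power2_eq_square ad_trace_form_eq(8)[of 1])

lemma invY_list:
  assumes "t \<noteq> 0"
  shows "invY (R_e2 a1 a2 t) = - 2 / t" "invY (R2_aff a1 a2 t) = 1 / t" "invY (r4' l a1 a2 t) = (l\<^sup>2 - 2) / t"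
    "s \<noteq> 0 \<Longrightarrow> invY (aff_aff a1 a2 s t) = 1 / t + 1 / (t * s)"
    "invY (d4_half c t) = 3 / (2 * t)" "invY (d4_two c t) = 3 / (2 * t)"
    "d \<noteq> 0 \<Longrightarrow> invY (d4' d c t) = (3 / 2 - 2 / d\<^sup>2) / t"
    "invY (R4 a1 a2) = 0"
  using assms by (simp_all add: invY_def killing_form_eq metric_trace_def axis_nth killing_form_eq(8)[of 1])

lemma invW_list:
  assumes "t \<noteq> 0"
  shows "invW (R2_aff a1 a2 t) = (1 / t)\<^sup>2"
    "s \<noteq> 0 \<Longrightarrow> invW (aff_aff a1 a2 s t) = (1 / t)\<^sup>2 + (1 / (t * s))\<^sup>2"
  using assms by (simp_all add: invW_def killing_form_eq metric_trace_def axis_nth power2_eq_square)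

lemma invV_list: "t \<noteq> 0 \<Longrightarrow> invV (R_e2 a1 a2 t) = - 2 / t * (4 / a1\<^sup>2)"
  by (simp add: invV_def killing_form_eq cocycle_square_eq cocycle_vals metric_trace_def axis_nth power2_eq_square)

lemma invV'_list:
  assumes "t \<noteq> 0"
  shows "invV' (R2_aff a1 a2 t) = 1 / t * (4 / a2\<^sup>2)" "invV' (r4' l a1 a2 t) = l\<^sup>2 / t * (4 / a1\<^sup>2)"
    "s \<noteq> 0 \<Longrightarrow> invV' (aff_aff a1 a2 s t) = 1 / t * (4 / a1\<^sup>2) + 1 / (t * s) * (4 / a2\<^sup>2)"
  using assms
  by (simp_all add: invV'_def ad_trace_form_eq cocycle_square_eq cocycle_vals metric_trace_def axis_nth power2_eq_square mult_ac)

lemma invL_list: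
  assumes "t \<noteq> 0"
  shows "invL (R_e2 a1 a2 t) = 4 / t + invU (R_e2 a1 a2 t)"
    "invL (R2_aff a1 a2 t) = 2 / t + invU (R2_aff a1 a2 t)"
    "invL (r4' l a1 a2 t) = (2 * l\<^sup>2 + 4) / t + invU (r4' l a1 a2 t)"
    "s \<noteq> 0 \<Longrightarrow> invL (aff_aff a1 a2 s t) = 2 / t + 2 / (t * s) + invU (aff_aff a1 a2 s t)"
    "invL (d4_half c t) = 5 / t + invU (d4_half c t)" "invL (d4_two c t) = 5 / t + invU (d4_two c t)"
    "d \<noteq> 0 \<Longrightarrow> invL (d4' d c t) = (5 + 4 / d\<^sup>2) / t + invU (d4' d c t)"
    "invL (R4 a1 a2) = invU (R4 a1 a2)"
  using assms
  by (simp_all add: invL_def invU_list invU_list(8)[of 1] inv_defs power2_eq_square field_simps)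

lemma invD_list:
  assumes "t \<noteq> 0"
  shows "invD (R_e2 a1 a2 t) = 0" "invD (R2_aff a1 a2 t) = 0" "invD (r4' l a1 a2 t) = 0"
    "s \<noteq> 0 \<Longrightarrow> invD (aff_aff a1 a2 s t) = 0"
    "invD (d4_half c t) = 8 / t" "invD (d4_two c t) = - 4 / t"
    "d \<noteq> 0 \<Longrightarrow> invD (d4' d c t) = 8 / t" "invD (R4 a1 a2) = 0"
  using assms by (simp_all add: invD_def invL_list invX_list invY_list
      invL_list(8)[of 1] invX_list(8)[of 1] invY_list(8)[of 1] field_simps)

section \<open>Recovering the entry from its invariants\<close>

fun kind :: "listed \<Rightarrow> nat" where
  "kind (R_e2 _ _ _) = 1" | "kind (R2_aff _ _ _) = 2" | "kind (r4' _ _ _ _) = 3"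
| "kind (aff_aff _ _ _ _) = 4" | "kind (d4_half _ _) = 5" | "kind (d4_two _ _) = 6"
| "kind (d4' _ _ _) = 7" | "kind (R4 _ _) = 8"

text \<open>The sign of \<open>invD\<close> isolates \<open>d4_two\<close> and the pair
  \<open>d4_half\<close>, \<open>d4'\<close>; the term 2/\<delta>^2 in tr B separates that pair.
  Among the others, tau = 0 leaves \<open>R4\<close> and \<open>R_e2\<close>, told apart by tr B.
  The rotation in \<open>r4'\<close> makes tr B differ from |tau|^2. Of the last two,
  \<open>R2_aff\<close> has a Killing form of rank one, which is detected by |B|^2 = (tr B)^2, since
  there tr B = |tau|^2.\<close>

lemma kind_eq:
  assumes "admissible m"
  shows "kind m = (if invD m < 0 then 6 else if invD m > 0 then (if 8 * invY m = 3 * invX m then 5 else 7)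
    else if invX m = 0 then (if invY m = 0 then 8 else 1)
    else if invY m \<noteq> invX m then 3 else if invW m = (invX m)\<^sup>2 then 2 else 4)"
proof (cases m)
  case (R_e2 a1 a2 t)
  then show ?thesis using assms by (simp add: invD_list invX_list invY_list)
next
  case (R2_aff a1 a2 t)
  then show ?thesis using assms by (simp add: invD_list invX_list invY_list invW_list)
next
  case (r4' l a1 a2 t)
  then show ?thesis using assms by (simp add: invD_list invX_list invY_list field_simps)
next
  case (aff_aff a1 a2 s t)
  then have p: "t > 0" "s > 0" using assms by auto
  then have "1 / t + 1 / (t * s) > 0" "1 / t * (1 / (t * s)) > 0" by (auto intro: add_pos_pos)
  then have "1 / t + 1 / (t * s) \<noteq> 0" "(1 / t + 1 / (t * s))\<^sup>2 \<noteq> (1 / t)\<^sup>2 + (1 / (t * s))\<^sup>2"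
    by (simp_all only: power2_sum)
  then show ?thesis using p by (simp add: aff_aff invD_list invX_list invY_list invW_list)
next
  case (d4_half c t)
  then show ?thesis using assms by (simp add: invD_list invX_list invY_list)
next
  case (d4_two c t)
  then show ?thesis using assms by (simp add: invD_list invX_list invY_list)
next
  case (d4' d c t)
  then show ?thesis using assms by (simp add: invD_list invX_list invY_list field_simps)
next
  case (R4 a1 a2)
  then show ?thesis by (simp add: invD_list(8)[of 1] invX_list(8)[of 1] invY_list(8)[of 1])
qed

lemma pair_from_power_sums:
  fixes u v u' v' :: real
  assumes "u + v = u' + v'" "u\<^sup>2 + v\<^sup>2 = u'\<^sup>2 + v'\<^sup>2"
  shows "u = u' \<and> v = v' \<or> u = v' \<and> v = u'"
proof -
  have "(u - u') * (u - v') = 0" using assms by algebra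
  then show ?thesis using assms(1) by auto
qed

lemma four_over_square_inj:
  fixes a b :: real
  assumes "4 / a\<^sup>2 = 4 / b\<^sup>2" "a > 0" "b > 0" shows "a = b"
  using assms by (simp add: field_simps)

text \<open>The scale is read off from tau or B. A pairing of S with tau or B weights the two planes
  differently and yields one of a1, a2; tr S yields the other. Since S contains only squares,
  \<open>d4'\<close> determines c up to sign; in \<open>R4\<close> both planes look alike and only
  the unordered pair is recovered.\<close>

lemma same_entry_if_invariants_eq:
  assumes m: "admissible m" "admissible m'"
    and I: "invX m' = invX m" "invY m' = invY m" "invL m' = invL m" "invW m' = invW m"
    "invU m' = invU m" "invV m' = invV m" "invV' m' = invV' m" "invQ m' = invQ m"
  shows "same_entry m m'"
proof -
  have D: "invD m' = invD m" using I by (simp add: invD_def)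
  have k: "kind m = kind m'" using kind_eq[OF m(1)] kind_eq[OF m(2)] I D by simp
  show ?thesis
  proof (cases m)
    case (R_e2 a1 a2 t)
    then obtain b1 b2 t' where m': "m' = R_e2 b1 b2 t'" using k by (cases m') auto
    have p: "a1 > 0" "a2 > 0" "t > 0" "b1 > 0" "b2 > 0" "t' > 0" using m R_e2 m' by auto
    have t: "t = t'" using I(2) p by (simp add: R_e2 m' invY_list)
    have "4 / a1\<^sup>2 = 4 / b1\<^sup>2" using I(6) p by (simp add: R_e2 m' invV_list t)
    then have a1: "a1 = b1" by (rule four_over_square_inj) (fact p)+
    have "4 / a2\<^sup>2 = 4 / b2\<^sup>2" using I(5) p by (simp add: R_e2 m' invU_list a1)
    then have "a2 = b2" by (rule four_over_square_inj) (fact p)+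
    then show ?thesis using a1 t by (simp add: R_e2 m')
  next
    case (R2_aff a1 a2 t)
    then obtain b1 b2 t' where m': "m' = R2_aff b1 b2 t'" using k by (cases m') auto
    have p: "a1 > 0" "a2 > 0" "t > 0" "b1 > 0" "b2 > 0" "t' > 0" using m R2_aff m' by auto
    have t: "t = t'" using I(2) p by (simp add: R2_aff m' invY_list)
    have "4 / a2\<^sup>2 = 4 / b2\<^sup>2" using I(7) p by (simp add: R2_aff m' invV'_list t)
    then have a2: "a2 = b2" by (rule four_over_square_inj) (fact p)+
    have "4 / a1\<^sup>2 = 4 / b1\<^sup>2" using I(5) p by (simp add: R2_aff m' invU_list a2)
    then have "a1 = b1" by (rule four_over_square_inj) (fact p)+
    then show ?thesis using a2 t by (simp add: R2_aff m')
  next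
    case (r4' l a1 a2 t)
    then obtain l' b1 b2 t' where m': "m' = r4' l' b1 b2 t'" using k by (cases m') auto
    have p: "l > 0" "a1 > 0" "a2 > 0" "t > 0" "l' > 0" "b1 > 0" "b2 > 0" "t' > 0"
      using m r4' m' by auto
    have t: "t = t'" using I(1,2) p by (simp add: r4' m' invX_list invY_list diff_divide_distrib)
    have "l\<^sup>2 = l'\<^sup>2" using I(1) p by (simp add: r4' m' invX_list t)
    then have l: "l = l'" using p by simp
    have "4 / a1\<^sup>2 = 4 / b1\<^sup>2" using I(7) p by (simp add: r4' m' invV'_list t l)
    then have a1: "a1 = b1" by (rule four_over_square_inj) (fact p)+
    have "4 / a2\<^sup>2 = 4 / b2\<^sup>2" using I(5) p by (simp add: r4' m' invU_list a1)
    then have "a2 = b2" by (rule four_over_square_inj) (fact p)+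
    then show ?thesis using a1 t l by (simp add: r4' m')
  next
    case (aff_aff a1 a2 s t)
    then obtain b1 b2 s' t' where m': "m' = aff_aff b1 b2 s' t'" using k by (cases m') auto
    have p: "a1 > 0" "a2 > 0" "t > 0" "s > 0" "b1 > 0" "b2 > 0" "t' > 0" "s' > 0" "s \<le> 1" "s' \<le> 1"
      using m aff_aff m' by auto
    then have nz: "t \<noteq> 0" "t' \<noteq> 0" "s \<noteq> 0" "s' \<noteq> 0" by simp_all
    define u v u' v' where "u = 1 / t" and "v = 1 / (t * s)" and "u' = 1 / t'" and "v' = 1 / (t' * s')"
    have "u \<le> v" "u' \<le> v'" using p by (simp_all add: u_def v_def u'_def v'_def field_simps)
    moreover have "u + v = u' + v'" "u\<^sup>2 + v\<^sup>2 = u'\<^sup>2 + v'\<^sup>2"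
      unfolding u_def v_def u'_def v'_def
      using I(1,4)[symmetric] unfolding aff_aff m' invX_list(4)[OF nz(1,3)] invX_list(4)[OF nz(2,4)]
        invW_list(2)[OF nz(1,3)] invW_list(2)[OF nz(2,4)] .
    ultimately have uv: "u = u'" "v = v'" using pair_from_power_sums[of u v u' v'] by auto
    then have t: "t = t'" using p by (simp add: u_def u'_def)
    then have s: "s = s'" using uv(2) p by (simp add: v_def v'_def)
    define A B A' B' where "A = 4 / a1\<^sup>2" and "B = 4 / a2\<^sup>2" and "A' = 4 / b1\<^sup>2" and "B' = 4 / b2\<^sup>2"
    have AB: "A + B = A' + B'" "u * A + v * B = u * A' + v * B'" "A\<^sup>2 + B\<^sup>2 = A'\<^sup>2 + B'\<^sup>2"
      using I(5,7,8) nz unfolding aff_aff m' u_def v_def t s A_def B_def A'_def B'_def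
      by (simp_all add: invU_list invV'_list invQ_list)
    have "A = A' \<and> B = B'"
    proof (cases "s = 1")
      case False
      then have "u - v \<noteq> 0" using p by (simp add: u_def v_def)
      moreover have "(u - v) * (A - A') = 0" using AB(1,2) by algebra
      ultimately show ?thesis using AB(1) by simp
    next
      \<comment> \<open>For s = 1 both planes carry the same weight, so the pairing with tau adds
        nothing to tr S. Then |S|^2 gives the unordered pair, and a1 \<ge> a2 fixes its
        order.\<close>
      case True
      then have "a1 \<ge> a2" "b1 \<ge> b2" using m aff_aff m' s by auto
      then have "A \<le> B" "A' \<le> B'"
        using p by (simp_all add: A_def B_def A'_def B'_def frac_le)
      then show ?thesis using pair_from_power_sums[OF AB(1,3)] by auto
    qed
    then have "4 / a1\<^sup>2 = 4 / b1\<^sup>2" "4 / a2\<^sup>2 = 4 / b2\<^sup>2"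
      unfolding A_def B_def A'_def B'_def by blast+
    then have "a1 = b1" "a2 = b2" using four_over_square_inj p by blast+
    then show ?thesis using t s by (simp add: aff_aff m')
  next
    case (d4_half c t)
    then obtain c' t' where m': "m' = d4_half c' t'" using k by (cases m') auto
    have p: "c > 0" "t > 0" "c' > 0" "t' > 0" using m d4_half m' by auto
    have t: "t = t'" using I(1) p by (simp add: d4_half m' invX_list)
    have "4 / c\<^sup>2 = 4 / c'\<^sup>2" using I(5) p by (simp add: d4_half m' invU_list)
    then have "c = c'" by (rule four_over_square_inj) (fact p)+
    then show ?thesis using t by (simp add: d4_half m')
  next
    case (d4_two c t)
    then obtain c' t' where m': "m' = d4_two c' t'" using k by (cases m') auto
    have p: "c > 0" "t > 0" "c' > 0" "t' > 0" using m d4_two m' by auto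
    have t: "t = t'" using I(1) p by (simp add: d4_two m' invX_list)
    have "4 / c\<^sup>2 = 4 / c'\<^sup>2" using I(5) p by (simp add: d4_two m' invU_list)
    then have "c = c'" by (rule four_over_square_inj) (fact p)+
    then show ?thesis using t by (simp add: d4_two m')
  next
    case (d4' d c t)
    then obtain d' c' t' where m': "m' = d4' d' c' t'" using k by (cases m') auto
    have p: "d > 0" "c \<noteq> 0" "t > 0" "d' > 0" "c' \<noteq> 0" "t' > 0" using m d4' m' by auto
    have t: "t = t'" using I(1) p by (simp add: d4' m' invX_list)
    have "2 / d\<^sup>2 = 2 / d'\<^sup>2" using I(2) p by (simp add: d4' m' invY_list t)
    then have d: "d = d'" using p by simp
    have "c\<^sup>2 = c'\<^sup>2" using I(5) p by (simp add: d4' m' invU_list)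
    then have "c = c' \<or> c = - c'" by (simp add: power2_eq_iff)
    then show ?thesis using t d by (simp add: d4' m')
  next
    case (R4 a1 a2)
    then obtain b1 b2 where m': "m' = R4 b1 b2" using k by (cases m') auto
    have p: "a1 > 0" "a2 > 0" "b1 > 0" "b2 > 0" using m R4 m' by auto
    have "4 / a1\<^sup>2 + 4 / a2\<^sup>2 = 4 / b1\<^sup>2 + 4 / b2\<^sup>2" "(4 / a1\<^sup>2)\<^sup>2 + (4 / a2\<^sup>2)\<^sup>2 = (4 / b1\<^sup>2)\<^sup>2 + (4 / b2\<^sup>2)\<^sup>2"
      using I(5,8) unfolding R4 m' invU_list(8)[of 1, simplified] invQ_list(2) by simp_all
    from pair_from_power_sums[OF this] have "a1 = b1 \<and> a2 = b2 \<or> a1 = b2 \<and> a2 = b1"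
      using p four_over_square_inj by metis
    then show ?thesis by (simp add: R4 m')
  qed
qed

text \<open>The relation mu(y, Tz) = 2<y, z> for the listed form: on a plane with squared norm N and
  form coefficient w, T e1 is (w / N) f1, so mu(e1, f1) w / N = 2N.\<close>

lemma cocycle_form_coeffs:
  assumes "admissible m"
  shows "cocycle m e1 f1 * fst (form_coeffs m) = 2 * (fst (norms_sq m))\<^sup>2"
    "cocycle m e2 f2 * snd (form_coeffs m) = 2 * (snd (norms_sq m))\<^sup>2"
  using assms by (cases m; auto simp: cocycle_vals power2_eq_square)+

lemma cocycle_nonzero: "admissible m \<Longrightarrow> cocycle m e1 f1 \<noteq> 0 \<and> cocycle m e2 f2 \<noteq> 0"
  using cocycle_form_coeffs[of m] norms_sq_pos[of m] by auto

lemma list_bracket_xi: "list_bracket m xi y = 0"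
  by (cases m) (simp_all add: list_bracket_def axis_nth)

text \<open>mu is nondegenerate on the span of e1, f1, e2, f2, so a central vector has no component
  there.\<close>

lemma list_center:
  assumes "admissible m" "\<And>y. list_bracket m x y = 0"
  shows "x = x $ Xi *\<^sub>R xi"
proof -
  have "cocycle m x y = 0" for y using assms(2) by (simp add: cocycle_def)
  from this[of e1] this[of f1] this[of e2] this[of f2] cocycle_nonzero[OF assms(1)]
  have "x $ F1 = 0" "x $ E1 = 0" "x $ F2 = 0" "x $ E2 = 0"
    by (simp_all add: cocycle_eq[of m x] axis_nth)
  then show ?thesis by (simp add: vec_eq_iff all_frame axis_nth)
qed

section \<open>Transport along isometric isomorphisms\<close>

lemma isometric_isomorphism_inv_comp:
  assumes "isometric_isomorphism br g br1 g1 \<phi>1" "isometric_isomorphism br g br2 g2 \<phi>2"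
  shows "isometric_isomorphism br1 g1 br2 g2 (\<phi>2 \<circ> inv \<phi>1)"
proof -
  have 1: "linear \<phi>1" "bij \<phi>1" "\<And>x y. \<phi>1 (br x y) = br1 (\<phi>1 x) (\<phi>1 y)"
    "\<And>x y. g1 (\<phi>1 x) (\<phi>1 y) = g x y"
    and 2: "linear \<phi>2" "bij \<phi>2" "\<And>x y. \<phi>2 (br x y) = br2 (\<phi>2 x) (\<phi>2 y)"
    "\<And>x y. g2 (\<phi>2 x) (\<phi>2 y) = g x y"
    using assms by (auto simp: isometric_isomorphism_def)
  have inv: "\<phi>1 (inv \<phi>1 x) = x" "inv \<phi>1 (\<phi>1 y) = y" for x y
    using 1(2) by (simp_all add: bij_def surj_f_inv_f)
  have "linear (inv \<phi>1)"
    by (rule linearI; rule injD[OF bij_is_inj[OF 1(2)]])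
      (simp_all add: inv linear_add[OF 1(1)] linear_scale[OF 1(1)])
  moreover have "inv \<phi>1 (br1 x y) = br (inv \<phi>1 x) (inv \<phi>1 y)" for x y
    by (rule injD[OF bij_is_inj[OF 1(2)]]) (simp add: inv 1(3))
  moreover have "g (inv \<phi>1 x) (inv \<phi>1 y) = g1 x y" for x y
    by (simp add: inv flip: 1(4))
  ultimately show ?thesis
    using 2 bij_imp_bij_inv[OF 1(2)]
    by (simp add: isometric_isomorphism_def linear_compose bij_comp)
qed

text \<open>The image of a central vector is central, hence a multiple of xi, and the metric gives
  the square of the factor.\<close>

lemma isometric_isomorphism_central:
  assumes m: "admissible m"
    and iso: "isometric_isomorphism br g (list_bracket m) (list_metric m) \<phi>"
    and "\<And>y. br \<xi> y = 0"
  shows "\<exists>\<kappa>. \<phi> \<xi> = \<kappa> *\<^sub>R xi \<and> \<kappa>\<^sup>2 = g \<xi> \<xi>"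
proof -
  have \<phi>: "linear \<phi>" "bij \<phi>" "\<And>x y. \<phi> (br x y) = list_bracket m (\<phi> x) (\<phi> y)"
    "\<And>x y. list_metric m (\<phi> x) (\<phi> y) = g x y"
    using iso by (auto simp: isometric_isomorphism_def)
  have "list_bracket m (\<phi> \<xi>) y = 0" for y
  proof -
    obtain z where "y = \<phi> z" using bij_is_surj[OF \<phi>(2)] by blast
    then show ?thesis using assms(3) linear_0[OF \<phi>(1)] by (simp flip: \<phi>(3))
  qed
  from list_center[OF m this] have e: "\<phi> \<xi> = \<phi> \<xi> $ Xi *\<^sub>R xi" .
  have "g \<xi> \<xi> = list_metric m (\<phi> \<xi> $ Xi *\<^sub>R xi) (\<phi> \<xi> $ Xi *\<^sub>R xi)"
    using \<phi>(4)[of \<xi> \<xi>] e by simp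
  also have "\<dots> = (\<phi> \<xi> $ Xi)\<^sup>2"
    by (simp add: list_metric_def axis_nth power2_eq_square)
  finally show ?thesis using e by metis
qed

lemma listed_unique:
  assumes "admissible m" "admissible m'"
    and "isometrically_isomorphic br g (list_bracket m) (list_metric m)"
    and "isometrically_isomorphic br g (list_bracket m') (list_metric m')"
  shows "same_entry m m'"
proof -
  obtain \<phi> where \<phi>: "isometric_isomorphism (list_bracket m) (list_metric m) (list_bracket m') (list_metric m') \<phi>"
    using assms(3,4) isometric_isomorphism_inv_comp unfolding isometrically_isomorphic_def by blast
  have "list_metric m xi xi = 1" by (simp add: list_metric_def axis_nth)
  then obtain \<epsilon> where "\<phi> xi = \<epsilon> *\<^sub>R xi" "\<epsilon>\<^sup>2 = 1"
    using isometric_isomorphism_central[OF assms(2) \<phi> list_bracket_xi] by auto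
  from list_isometric_invariants[OF assms(1,2) \<phi> this] show ?thesis
    by (rule same_entry_if_invariants_eq[OF assms(1,2)])
qed

section \<open>Uniqueness of T and of its 2-form\<close>

context metric_lie5
begin

text \<open>A vector d orthogonal to \<xi> and annihilated by mu is zero (\<open>null\<close>, by
  testing mu against Td). Applied to the central vector \<xi>' - k\<xi> this gives proportional
  vectors; applied to T'z - kTz it gives proportional tensors with the same factor.\<close>

lemma central_cky_unique:
  assumes T: "central_cky T \<xi>" and T': "central_cky T' \<xi>'"
  shows "\<exists>k. k \<noteq> 0 \<and> (\<forall>x. T' x = k *\<^sub>R T x)"
proof -
  have \<xi>: "\<xi> \<noteq> 0" using T by (simp add: central_cky_def)
  then have n: "g \<xi> \<xi> > 0" by (rule g_pos)
  have S: "g (br y (T z)) \<xi> = 2 * (g \<xi> \<xi> * g y z - g \<xi> y * g \<xi> z)" for y z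
    using T by (simp add: central_cky_def)
  have S': "g (br y (T' z)) \<xi>' = 2 * (g \<xi>' \<xi>' * g y z - g \<xi>' y * g \<xi>' z)" for y z
    using T' by (simp add: central_cky_def)
  have null: "d = 0" if "g \<xi> d = 0" "\<And>y. g (br y d) \<xi> = 0" for d
  proof -
    have "g (br d (T d)) \<xi> = 0" using that(2)[of "T d"] br_skew[of d "T d"] by (simp add: g_lin)
    then show ?thesis using S[of d d] that(1) \<xi> by simp
  qed
  define k where "k = g \<xi> \<xi>' / g \<xi> \<xi>"
  have "\<xi>' - k *\<^sub>R \<xi> = 0"
  proof (rule null)
    show "g \<xi> (\<xi>' - k *\<^sub>R \<xi>) = 0" using n by (simp add: k_def g_lin)
    show "g (br y (\<xi>' - k *\<^sub>R \<xi>)) \<xi> = 0" for y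
      using T T' br_skew[of y \<xi>] br_skew[of y \<xi>'] by (simp add: central_cky_def br_lin g_lin)
  qed
  then have \<xi>': "\<xi>' = k *\<^sub>R \<xi>" by simp
  moreover have "\<xi>' \<noteq> 0" using T' by (simp add: central_cky_def)
  ultimately have k: "k \<noteq> 0" by auto
  have "T' z - k *\<^sub>R T z = 0" for z
  proof (rule null)
    have "g (T z) \<xi> = 0" "g (T' z) \<xi>' = 0" using T T' by (simp_all add: central_cky_def g_lin)
    then show "g \<xi> (T' z - k *\<^sub>R T z) = 0" using k by (simp add: \<xi>' g_lin g_sym[of \<xi>])
    have "k * g (br y (T' z)) \<xi> = k * (k * g (br y (T z)) \<xi>)" for y
      using S'[of y z] unfolding S \<xi>' g_lin by algebra
    then show "g (br y (T' z - k *\<^sub>R T z)) \<xi> = 0" for y using k by (simp add: br_lin g_lin)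
  qed
  then show ?thesis using k by auto
qed

text \<open>The relation mu(u, Tx) = 2<u, x> determines T on the complement of \<xi>, and the listed
  form satisfies the same relation. The factor is the \<kappa> with which \<phi> maps \<xi> to a
  multiple of the listed xi, so it records both the length and the sign of \<xi>.\<close>

lemma central_cky_two_form:
  assumes T: "central_cky T \<xi>" and m: "admissible m"
    and iso: "isometric_isomorphism br g (list_bracket m) (list_metric m) \<phi>"
  shows "\<exists>k. k \<noteq> 0 \<and> (\<forall>x y. two_form g T x y = k * list_form m (\<phi> x) (\<phi> y))"
proof -
  have \<phi>: "linear \<phi>" "bij \<phi>" "\<And>x y. \<phi> (br x y) = list_bracket m (\<phi> x) (\<phi> y)"
    "\<And>x y. g x y = list_metric m (\<phi> x) (\<phi> y)"
    using iso by (auto simp: isometric_isomorphism_def)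
  have S: "g (br y (T z)) \<xi> = 2 * (g \<xi> \<xi> * g y z - g \<xi> y * g \<xi> z)" and T\<xi>: "g (T z) \<xi> = 0"
    and \<xi>: "\<xi> \<noteq> 0" and central: "br \<xi> y = 0" for y z
    using T by (auto simp: central_cky_def g_lin)
  obtain \<kappa> where \<kappa>: "\<phi> \<xi> = \<kappa> *\<^sub>R xi" "\<kappa>\<^sup>2 = g \<xi> \<xi>"
    using isometric_isomorphism_central[OF m iso central] by blast
  have \<kappa>0: "\<kappa> \<noteq> 0" using \<kappa>(2) \<xi> by auto
  define N1 N2 w1 w2 where "N1 = fst (norms_sq m)" and "N2 = snd (norms_sq m)"
    and "w1 = fst (form_coeffs m)" and "w2 = snd (form_coeffs m)"
  define k1 k2 where "k1 = cocycle m e1 f1" and "k2 = cocycle m e2 f2"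
  have kw: "k1 * w1 = 2 * N1\<^sup>2" "k2 * w2 = 2 * N2\<^sup>2" "k1 \<noteq> 0" "k2 \<noteq> 0"
    using cocycle_form_coeffs[OF m] cocycle_nonzero[OF m]
    by (simp_all add: k1_def k2_def w1_def w2_def N1_def N2_def)
  have gl: "list_metric m v w = N1 * (v $ E1 * w $ E1 + v $ F1 * w $ F1)
      + N2 * (v $ E2 * w $ E2 + v $ F2 * w $ F2) + v $ Xi * w $ Xi" for v w
    by (simp add: list_metric_def N1_def N2_def)
  have "two_form g T x y = \<kappa> * list_form m (\<phi> x) (\<phi> y)" for x y
  proof -
    \<comment> \<open>The components of v are found by testing \<open>E\<close> on the four basis
      vectors; \<open>kw\<close> then turns the cocycle values into the form coefficients.\<close>
    define v W where "v = \<phi> (T x)" and "W = \<phi> x"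
    have E: "cocycle m u v = 2 * \<kappa> * (list_metric m u W - u $ Xi * W $ Xi)" for u
    proof -
      obtain z where z: "u = \<phi> z" using bij_is_surj[OF \<phi>(2)] by blast
      have "\<kappa> * cocycle m u v = g (br z (T x)) \<xi>"
        by (simp add: z \<phi>(3,4) \<kappa>(1) v_def cocycle_def gl axis_nth)
      also have "\<dots> = 2 * (\<kappa>\<^sup>2 * list_metric m u W - \<kappa>\<^sup>2 * (u $ Xi * W $ Xi))"
        unfolding S \<kappa>(2)[symmetric] unfolding \<phi>(4) \<kappa>(1) z W_def
        by (simp add: gl axis_nth power2_eq_square)
      also have "\<dots> = \<kappa> * (2 * \<kappa> * (list_metric m u W - u $ Xi * W $ Xi))"
        by (simp add: power2_eq_square algebra_simps)
      finally show ?thesis using \<kappa>0 by simp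
    qed
    have vX: "v $ Xi = 0"
      using T\<xi>[of x] \<kappa>0 by (simp add: \<phi>(4) \<kappa>(1) gl axis_nth v_def)
    have "k1 * v $ F1 = 2 * \<kappa> * (N1 * W $ E1)" "- (k1 * v $ E1) = 2 * \<kappa> * (N1 * W $ F1)"
      "k2 * v $ F2 = 2 * \<kappa> * (N2 * W $ E2)" "- (k2 * v $ E2) = 2 * \<kappa> * (N2 * W $ F2)"
      using E[of e1] E[of f1] E[of e2] E[of f2] unfolding cocycle_eq[of m _ v]
      by (simp_all add: axis_nth gl k1_def k2_def mult.commute)
    then have "k1 * (N1 * v $ F1) = k1 * (\<kappa> * w1 * W $ E1)"
      "k1 * (N1 * v $ E1) = k1 * (- \<kappa> * w1 * W $ F1)"
      "k2 * (N2 * v $ F2) = k2 * (\<kappa> * w2 * W $ E2)"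
      "k2 * (N2 * v $ E2) = k2 * (- \<kappa> * w2 * W $ F2)"
      using kw(1,2) by algebra+
    then have "N1 * v $ F1 = \<kappa> * w1 * W $ E1" "N1 * v $ E1 = - \<kappa> * w1 * W $ F1"
      "N2 * v $ F2 = \<kappa> * w2 * W $ E2" "N2 * v $ E2 = - \<kappa> * w2 * W $ F2"
      using mult_left_cancel[OF kw(3)] mult_left_cancel[OF kw(4)] by blast+
    then have "list_metric m v (\<phi> y) = \<kappa> * list_form m W (\<phi> y)"
      unfolding gl vX list_form_def w1_def[symmetric] w2_def[symmetric] by algebra
    then show ?thesis by (simp add: two_form_def \<phi>(4) v_def W_def)
  qed
  then show ?thesis using \<kappa>0 by blast
qed

end

theorem theorem3p2:
  fixes br :: "'a::real_vector \<Rightarrow> 'a \<Rightarrow> 'a"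
    and g :: "'a \<Rightarrow> 'a \<Rightarrow> real"
    and T :: "'a \<Rightarrow> 'a"
    and \<xi> :: 'a
  assumes "metric_lie_algebra br g"
    and "dim (UNIV :: 'a set) = 5"
    and "strict_cky_tensor br g T"
    and "associated_vector br g T \<xi>"
    and "\<xi> \<in> lie_center br"
  shows "(\<exists>m. admissible m \<and>
            isometrically_isomorphic br g (list_bracket m) (list_metric m) \<and>
            (\<forall>m'. admissible m' \<and>
                isometrically_isomorphic br g (list_bracket m') (list_metric m') \<longrightarrow>
                same_entry m m'))
       \<and> (\<forall>T' \<xi>'. strict_cky_tensor br g T' \<and> associated_vector br g T' \<xi>' \<and> \<xi>' \<in> lie_center br \<longrightarrow>
            (\<exists>k. k \<noteq> 0 \<and> (\<forall>x. T' x = k *\<^sub>R T x)))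
       \<and> (\<forall>m \<phi>. admissible m \<and>
            isometric_isomorphism br g (list_bracket m) (list_metric m) \<phi> \<longrightarrow>
            (\<exists>k. k \<noteq> 0 \<and> (\<forall>x y. two_form g T x y = k * list_form m (\<phi> x) (\<phi> y))))"
proof -
  interpret metric_lie5 br g using assms(1,2) by unfold_locales
  have T: "central_cky T \<xi>" using assms(3-5) by (rule central_cky)
  \<comment> \<open>The rescaled pair provides the model; both uniqueness claims are proved for T
    and \<xi> at their given scale.\<close>
  obtain k where k: "g (k *\<^sub>R \<xi>) (k *\<^sub>R \<xi>) = 1" "central_cky (\<lambda>x. k *\<^sub>R T x) (k *\<^sub>R \<xi>)"
    using ex_normalize[OF T] by blast
  interpret U: unit_cky br g "\<lambda>x. k *\<^sub>R T x" "k *\<^sub>R \<xi>" using k by unfold_locales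
  obtain m where m: "admissible m" "isometrically_isomorphic br g (list_bracket m) (list_metric m)"
    using U.has_model unfolding has_model_def by blast
  have "\<exists>m. admissible m \<and> isometrically_isomorphic br g (list_bracket m) (list_metric m) \<and>
      (\<forall>m'. admissible m' \<and> isometrically_isomorphic br g (list_bracket m') (list_metric m') \<longrightarrow>
        same_entry m m')"
    using m listed_unique by blast
  moreover have "\<exists>k. k \<noteq> 0 \<and> (\<forall>x. T' x = k *\<^sub>R T x)"
    if "strict_cky_tensor br g T' \<and> associated_vector br g T' \<xi>' \<and> \<xi>' \<in> lie_center br" for T' \<xi>'
    using central_cky_unique[OF T] central_cky that by blast
  moreover have "\<exists>k. k \<noteq> 0 \<and> (\<forall>x y. two_form g T x y = k * list_form m (\<phi> x) (\<phi> y))"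
    if "admissible m \<and> isometric_isomorphism br g (list_bracket m) (list_metric m) \<phi>" for m \<phi>
    using central_cky_two_form[OF T] that by blast
  ultimately show ?thesis by blast
qed

end
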